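(* (i) The following decision problem is $\mathbf{NP}$-complete: given a $3$-regular graph $G$, decide whether $G$ has a vertex-labeling by maximum from $\mathbb{N}_3=\{1,2,3\}$. (ii) For every fixed integer $k\geq 3$, the following decision problem is $\mathbf{NP}$-complete: given a $k$-colorable graph $G$, decide whether $G$ has a vertex-labeling by maximum from $\mathbb{N}_k$. (iii) There is a polynomial-time algorithm that, given a graph $G$, decides whether $G$ has a nonempty set of triangular-structured-vertices (TSV).
   Context: All graphs are finite and simple; $u\sim v$ means $u$ is adjacent to $v$. For a positive integer $k$, $\mathbb{N}_k=\{1,\ldots,k\}$. A vertex-labeling by maximum from $\mathbb{N}_k$ of a graph $G$ is a map $f:V(G)\to\mathbb{N}_k$ such that the vertex coloring $c(v)=\max_{u\sim v} f(u)$ satisfies $c(u)\neq c(v)$ for every edge $uv$. For a graph $G$, a subset $S\subseteq V(G)$ is a set of triangular-structured-vertices (TSV) if every $v\in S$ lies in a triangle of the induced subgraph $G[S]$, and for every pair of adjacent vertices $v\in S$, $u\notin S$ there exists $z\in S$ adjacent to both $v$ and $u$. *)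

theory Defs
  imports "HOL-Computational_Algebra.Polynomial"
begin

section \<open>Deterministic multi-tape Turing machines\<close>

text \<open>
  A machine with \<open>k\<close> two-way infinite tapes, \<open>q\<close> non-halting states and \<open>g\<close> tape symbols has
  states \<open>0, \<dots>, q\<close>, where \<open>0\<close> is the start state and \<open>q\<close> the only halting state, and symbols
  \<open>0, \<dots>, g - 1\<close>, where \<open>0\<close> is the blank and \<open>1\<close>, \<open>2\<close> stand for the bits \<^const>\<open>False\<close>,
  \<^const>\<open>True\<close>. The transition function maps the current state and the list of scanned symbols
  to the next state and, for each tape, the symbol to be written and the head movement.
\<close>

datatype dir = Go_Left | Stay | Go_Right

datatype tm = TM
  (tapes: nat) (states: nat) (symbols: nat)
  (trans: "nat \<Rightarrow> nat list \<Rightarrow> nat \<times> (nat \<times> dir) list")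

definition wf_tm :: "tm \<Rightarrow> bool" where
  "wf_tm M \<longleftrightarrow>
     tapes M \<ge> 1 \<and> symbols M \<ge> 3 \<and>
     (\<forall>s < states M. \<forall>as. length as = tapes M \<and> set as \<subseteq> {..<symbols M} \<longrightarrow>
        (case trans M s as of (s', acts) \<Rightarrow>
           s' \<le> states M \<and> length acts = tapes M \<and> fst ` set acts \<subseteq> {..<symbols M}))"

text \<open>A tape consists of its cell contents and the head position.\<close>

type_synonym tape = "(int \<Rightarrow> nat) \<times> int"
type_synonym config = "nat \<times> tape list"

fun move :: "dir \<Rightarrow> int \<Rightarrow> int" where
  "move Go_Left h = h - 1"
| "move Stay h = h"
| "move Go_Right h = h + 1"

fun act :: "nat \<times> dir \<Rightarrow> tape \<Rightarrow> tape" where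
  "act (a, d) (c, h) = (c(h := a), move d h)"

fun step :: "tm \<Rightarrow> config \<Rightarrow> config" where
  "step M (s, ts) =
     (if s \<ge> states M then (s, ts)
      else case trans M s (map (\<lambda>(c, h). c h) ts) of (s', acts) \<Rightarrow> (s', map2 act acts ts))"

definition cells :: "bool list \<Rightarrow> int \<Rightarrow> nat" where
  "cells x i = (if 0 \<le> i \<and> i < int (length x) then (if x ! nat i then 2 else 1) else 0)"

definition initial :: "tm \<Rightarrow> bool list \<Rightarrow> config" where
  "initial M x = (0, (cells x, 0) # replicate (tapes M - 1) (\<lambda>_. 0, 0))"

text \<open>The input is given on the first tape; the output is read off the last tape.\<close>

definition computes_in_time :: "tm \<Rightarrow> (bool list \<Rightarrow> bool list) \<Rightarrow> (nat \<Rightarrow> nat) \<Rightarrow> bool" where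
  "computes_in_time M f T \<longleftrightarrow>
     (\<forall>x. \<exists>t \<le> T (length x). case (step M ^^ t) (initial M x) of (s, ts) \<Rightarrow>
        s = states M \<and> fst (last ts) = cells (f x))"

definition polytime :: "(bool list \<Rightarrow> bool list) \<Rightarrow> bool" where
  "polytime f \<longleftrightarrow> (\<exists>M (p :: nat poly). wf_tm M \<and> computes_in_time M f (poly p))"


section \<open>Complexity classes\<close>

definition class_P :: "bool list set set" where
  "class_P = {L. polytime (\<lambda>x. [x \<in> L])}"

definition pair :: "bool list \<Rightarrow> bool list \<Rightarrow> bool list" where
  "pair x u = concat (map (\<lambda>b. [b, b]) x) @ [False, True] @ u"

definition class_NP :: "bool list set set" where
  "class_NP = {L. \<exists>R \<in> class_P. \<exists>p :: nat poly. \<forall>x.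
      x \<in> L \<longleftrightarrow> (\<exists>u. length u \<le> poly p (length x) \<and> pair x u \<in> R)}"

text \<open>
  A decision problem on a restricted class of inputs is given by the set \<open>I\<close> of its instances and
  the set \<open>Y \<subseteq> I\<close> of its yes-instances. A many-one reduction to such a problem has to produce an
  element of \<open>I\<close> on every input, also on those that are mapped to no-instances. This matters when
  \<open>I\<close> itself is not known to be decidable in polynomial time.
\<close>

definition NP_complete :: "bool list set \<Rightarrow> bool list set \<Rightarrow> bool" where
  "NP_complete I Y \<longleftrightarrow>
     Y \<in> class_NP \<and>
     (\<forall>L \<in> class_NP. \<exists>f. polytime f \<and> (\<forall>x. f x \<in> I) \<and> (\<forall>x. x \<in> L \<longleftrightarrow> f x \<in> Y))"


section \<open>Graphs\<close>

datatype 'a graph = Graph (verts: "'a set") (adj: "'a \<Rightarrow> 'a \<Rightarrow> bool")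

definition simple_graph :: "'a graph \<Rightarrow> bool" where
  "simple_graph G \<longleftrightarrow>
     finite (verts G) \<and>
     (\<forall>u v. adj G u v \<longrightarrow> u \<in> verts G \<and> v \<in> verts G \<and> u \<noteq> v \<and> adj G v u)"

definition neighbors :: "'a graph \<Rightarrow> 'a \<Rightarrow> 'a set" where
  "neighbors G v = {u. adj G u v}"

definition regular :: "nat \<Rightarrow> 'a graph \<Rightarrow> bool" where
  "regular d G \<longleftrightarrow> (\<forall>v \<in> verts G. card (neighbors G v) = d)"

definition colorable :: "nat \<Rightarrow> 'a graph \<Rightarrow> bool" where
  "colorable k G \<longleftrightarrow>
     (\<exists>c. (\<forall>v \<in> verts G. c v \<in> {1..k}) \<and> (\<forall>u v. adj G u v \<longrightarrow> c u \<noteq> c v))"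

text \<open>
  The colour of an isolated vertex would be the maximum of the empty set. It is never used below,
  since only endpoints of edges are compared.
\<close>

definition max_color :: "'a graph \<Rightarrow> ('a \<Rightarrow> nat) \<Rightarrow> 'a \<Rightarrow> nat" where
  "max_color G f v = Max (f ` neighbors G v)"

definition labeling_by_max :: "nat \<Rightarrow> 'a graph \<Rightarrow> ('a \<Rightarrow> nat) \<Rightarrow> bool" where
  "labeling_by_max k G f \<longleftrightarrow>
     (\<forall>v \<in> verts G. f v \<in> {1..k}) \<and>
     (\<forall>u v. adj G u v \<longrightarrow> max_color G f u \<noteq> max_color G f v)"

definition TSV :: "'a graph \<Rightarrow> 'a set \<Rightarrow> bool" where
  "TSV G S \<longleftrightarrow>
     S \<subseteq> verts G \<and>
     (\<forall>v \<in> S. \<exists>x \<in> S. \<exists>y \<in> S. adj G v x \<and> adj G x y \<and> adj G y v) \<and>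
     (\<forall>v \<in> S. \<forall>u \<in> verts G - S. adj G v u \<longrightarrow> (\<exists>z \<in> S. adj G z v \<and> adj G z u))"


section \<open>Graphs as inputs\<close>

text \<open>
  Input graphs have vertex set \<open>{0, \<dots>, n - 1}\<close>, which covers all finite graphs up to isomorphism.
  They are encoded by \<open>n\<close> in unary, followed by the adjacency matrix, row by row.
\<close>

definition input_graph :: "nat graph \<Rightarrow> bool" where
  "input_graph G \<longleftrightarrow> simple_graph G \<and> (\<exists>n. verts G = {..<n})"

definition encode :: "nat graph \<Rightarrow> bool list" where
  "encode G = (let n = card (verts G) in
     replicate n True @ [False] @ concat (map (\<lambda>i. map (\<lambda>j. adj G i j) [0..<n]) [0..<n]))"

definition graph_language :: "(nat graph \<Rightarrow> bool) \<Rightarrow> bool list set" where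
  "graph_language Q = {encode G | G. input_graph G \<and> Q G}"

end

theory Submission
  imports Defs
begin

text \<open>
  In a labeling from three labels only the class \<open>Z\<close> of colour 3 matters: a graph without isolated
  vertices has such a labeling iff it has an independent set \<open>Z\<close> with bipartite complement in which
  every vertex has a neighbour \<open>w\<close> with all neighbours of \<open>w\<close> in \<open>Z\<close>. A triangle contains exactly one
  vertex of \<open>Z\<close>, and the third neighbour of that vertex is such a \<open>w\<close>; so triangles express \<^emph>\<open>exactly
  one of three\<close>, which encodes 3-satisfiability in cubic graphs that are always 3-colourable. Adding
  a vertex joined to everything and a pendant vertex at it passes from \<open>k\<close> to \<open>k + 1\<close> labels. The
  largest TSV is found by deleting violating vertices.

  Running times are handled by a class of functions on tree-encoded values that is closed under
  composition and under folds with polynomially bounded intermediate results: such functions are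
  computed by programs on a fixed number of stacks that leave everything below their argument
  untouched, and these programs are Turing machines. NP-hardness of 3-satisfiability is Cook's
  construction.
\<close>

section \<open>A stack language and its compilation to Turing machines\<close>

text \<open>A reduction has to output an instance on every input, so cubicity and 3-colourability
  cannot be left to the satisfiable case: the gadget graph always has degree at most 3 and a fixed
  colouring, and completing it to a cubic graph must not disturb which vertices can lie in
  \<open>Z\<close>. A vertex of \<open>Z\<close> needs a neighbour that sees nothing but
  \<open>Z\<close>; this requirement is what lets a triangle corner carry the truth value of the
  node attached to it. Each literal position owns two nodes on the chain of its variable, which
  keeps degrees bounded however often a variable occurs. For \<open>k\<close> labels the
  yes-instances must be checked for \<open>k\<close>-colourability too, so the certificate contains
  a colouring besides the labeling. On the machine side values are trees with a prefix-free code: a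
  program finds the end of its argument without knowing what lies below it. Folds need an explicit
  bound on intermediate results, since iterating a polynomial-time function may square the size in
  every round.\<close>

text \<open>
  Six stacks of bits, one per tape: stack 0 receives the reversed input, stack 5 is the reversed
  output. \<open>Branch\<close> and \<open>Loop\<close> pop the bit they test and treat the empty stack like a
  stack with top \<^const>\<open>False\<close>; only \<open>Test\<close> can tell the two apart.
\<close>

datatype com =
    Skip
  | Push nat bool
  | Test nat nat
  | Seq com com (infixr ";;" 60)
  | Branch nat com com
  | Loop nat com

type_synonym store = "nat \<Rightarrow> bool list"

definition top :: "store \<Rightarrow> nat \<Rightarrow> bool" where
  "top s r \<longleftrightarrow> s r \<noteq> [] \<and> hd (s r)"

text \<open>The time index is an upper bound for the compiled code, not an exact count: a pop takes
  two steps, and one more is charged for the jump that ends a branch or a loop body.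
  \<open>Test\<close> pays for looking, returning and writing.\<close>

inductive exec :: "com \<Rightarrow> store \<Rightarrow> nat \<Rightarrow> store \<Rightarrow> bool" where
  exec_Skip: "exec Skip s 0 s"
| exec_Push: "r < 6 \<Longrightarrow> exec (Push r b) s 1 (s(r := b # s r))"
| exec_Test: "r < 6 \<Longrightarrow> q < 6 \<Longrightarrow> exec (Test r q) s 3 (s(q := (s r \<noteq> []) # s q))"
| exec_Seq: "exec c s t s' \<Longrightarrow> exec d s' t' s'' \<Longrightarrow> exec (c ;; d) s (t + t') s''"
| exec_Branch: "r < 6 \<Longrightarrow> exec (if top s r then c else d) (s(r := tl (s r))) t s' \<Longrightarrow>
    exec (Branch r c d) s (t + 3) s'"
| exec_Loop_end: "r < 6 \<Longrightarrow> \<not> top s r \<Longrightarrow> exec (Loop r c) s 2 (s(r := tl (s r)))"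
| exec_Loop: "r < 6 \<Longrightarrow> top s r \<Longrightarrow> exec c (s(r := tl (s r))) t s' \<Longrightarrow>
    exec (Loop r c) s' t' s'' \<Longrightarrow> exec (Loop r c) s (t + t' + 3) s''"

text \<open>No rule lets a stack grow by more than the time it charges. This later bounds the size
  of a result by the running time.\<close>

lemma exec_length: "exec c s t s' \<Longrightarrow> length (s' q) \<le> length (s q) + t"
  by (induction rule: exec.induct) (auto split: if_splits)

text \<open>
  An instruction names a tape and maps the symbol scanned there to the symbol to be written, the
  head movement and the next address.
\<close>

type_synonym instr = "nat \<times> (nat \<Rightarrow> nat \<times> dir \<times> nat)"

definition sym :: "bool \<Rightarrow> nat" where
  "sym b = (if b then 2 else 1)"

fun csize :: "com \<Rightarrow> nat" where
  "csize Skip = 0"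
| "csize (Push r b) = 1"
| "csize (Test r q) = 4"
| "csize (c ;; d) = csize c + csize d"
| "csize (Branch r c d) = csize c + csize d + 3"
| "csize (Loop r c) = csize c + 3"

text \<open>Code is generated for the absolute start address \<open>p\<close>. The head rests on the
  blank just above the top of a stack, so a pop first moves left; if it meets a blank, the stack was
  empty and the head has to return, otherwise erasing the top leaves the head where it
  belongs.\<close>

fun comp :: "nat \<Rightarrow> com \<Rightarrow> instr list" where
  "comp p Skip = []"
| "comp p (Push r b) = [(r, \<lambda>_. (sym b, Go_Right, p + 1))]"
| "comp p (Test r q) =
    [(r, \<lambda>a. (a, Go_Left, p + 1)),
     (r, \<lambda>a. (a, Go_Right, if a = 0 then p + 2 else p + 3)),
     (q, \<lambda>_. (sym False, Go_Right, p + 4)),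
     (q, \<lambda>_. (sym True, Go_Right, p + 4))]"
| "comp p (c ;; d) = comp p c @ comp (p + csize c) d"
| "comp p (Branch r c d) =
    [(r, \<lambda>a. (a, Go_Left, p + 1)),
     (r, \<lambda>a. (0, if a = 0 then Go_Right else Stay, if a = 2 then p + 2 else p + 3 + csize c))] @
    comp (p + 2) c @ [(r, \<lambda>a. (a, Stay, p + 3 + csize c + csize d))] @ comp (p + 3 + csize c) d"
| "comp p (Loop r c) =
    [(r, \<lambda>a. (a, Go_Left, p + 1)),
     (r, \<lambda>a. (0, if a = 0 then Go_Right else Stay, if a = 2 then p + 2 else p + 3 + csize c))] @
    comp (p + 2) c @ [(r, \<lambda>a. (a, Stay, p))]"

lemma length_comp [simp]: "length (comp p c) = csize c"
  by (induction c arbitrary: p) auto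

text \<open>The clamping by \<^const>\<open>min\<close> makes every program well-formed; it never takes effect.\<close>

definition machine :: "instr list \<Rightarrow> tm" where
  "machine P = TM 6 (length P) 3 (\<lambda>p as. case P ! p of (r, g) \<Rightarrow> case g (as ! r) of (a, d, l) \<Rightarrow>
     (min l (length P), map (\<lambda>i. if i = r then (min a 2, d) else (as ! i, Stay)) [0..<6]))"

lemma machine_simps [simp]:
  "tapes (machine P) = 6" "states (machine P) = length P" "symbols (machine P) = 3"
  by (simp_all add: machine_def)

lemma wf_machine: "wf_tm (machine P)"
  unfolding wf_tm_def
  by (auto simp: machine_def split: prod.split) (metis lessThan_iff nth_mem subsetD)

section \<open>Stacks as tape contents, and the effect of single instructions\<close>

definition conf :: "nat \<Rightarrow> (nat \<Rightarrow> tape) \<Rightarrow> config" where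
  "conf p T = (p, map T [0..<6])"

definition scan :: "tape \<Rightarrow> nat" where
  "scan T = fst T (snd T)"

lemma step_machine:
  assumes "p < length P" "P ! p = (r, g)" "r < 6" "g (scan (T r)) = (a, d, l)" "a \<le> 2" "l \<le> length P"
  shows "step (machine P) (conf p T) = conf l (T(r := act (a, d) (T r)))"
proof -
  have m: "map (\<lambda>(c, h). c h) (map T [0..<6]) = map (\<lambda>i. scan (T i)) [0..<6]"
    by (auto simp: scan_def split: prod.split)
  have "trans (machine P) p (map (\<lambda>i. scan (T i)) [0..<6]) =
      (l, map (\<lambda>i. if i = r then (a, d) else (scan (T i), Stay)) [0..<6])"
    using assms by (auto simp: machine_def)
  moreover have "map2 act (map (\<lambda>i. if i = r then (a, d) else (scan (T i), Stay)) [0..<6]) (map T [0..<6])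
      = map (T(r := act (a, d) (T r))) [0..<6]"
    by (simp add: map2_map_map scan_def) (metis act.simps fun_upd_triv move.simps(2) prod.collapse)
  ultimately show ?thesis
    using assms(1) by (simp add: conf_def m del: map_map)
qed

definition reaches :: "tm \<Rightarrow> nat \<Rightarrow> config \<Rightarrow> config \<Rightarrow> bool" where
  "reaches M n C C' \<longleftrightarrow> (\<exists>m \<le> n. (step M ^^ m) C = C')"

lemma reaches_refl: "reaches M n C C"
  unfolding reaches_def by (intro exI[of _ 0]) auto

lemma reaches_trans:
  assumes "reaches M m C C'" "reaches M n C' C''" "m + n \<le> k"
  shows "reaches M k C C''"
proof -
  obtain i j where "i \<le> m" "(step M ^^ i) C = C'" "j \<le> n" "(step M ^^ j) C' = C''"
    using assms unfolding reaches_def by blast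
  then show ?thesis
    using assms(3) unfolding reaches_def by (intro exI[of _ "j + i"]) (auto simp: funpow_add)
qed

lemma reaches_step:
  assumes "p < length P" "P ! p = (r, g)" "r < 6" "g (scan (T r)) = (a, d, l)" "a \<le> 2" "l \<le> length P"
  shows "reaches (machine P) 1 (conf p T) (conf l (T(r := act (a, d) (T r))))"
  unfolding reaches_def using step_machine[of p P r g T a d l, OF assms] by (intro exI[of _ 1]) auto

text \<open>The bottom of the stack is cell 0, so a tape shows its stack reversed; this is why input
  and output pass through reversed lists.\<close>

definition stack_tape :: "bool list \<Rightarrow> tape" where
  "stack_tape s = (cells (rev s), int (length s))"

definition sconf :: "nat \<Rightarrow> store \<Rightarrow> config" where
  "sconf p s = conf p (\<lambda>r. stack_tape (s r))"

definition code_at :: "instr list \<Rightarrow> nat \<Rightarrow> instr list \<Rightarrow> bool" where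
  "code_at P p xs \<longleftrightarrow> p + length xs \<le> length P \<and> (\<forall>i < length xs. P ! (p + i) = xs ! i)"

lemma code_at_Nil [simp]: "code_at P p [] \<longleftrightarrow> p \<le> length P"
  by (simp add: code_at_def)

lemma code_at_Cons: "code_at P p (x # xs) \<longleftrightarrow> p < length P \<and> P ! p = x \<and> code_at P (Suc p) xs"
  unfolding code_at_def by (auto simp: less_Suc_eq_0_disj nth_Cons split: nat.splits)

lemma code_at_append:
  "code_at P p (xs @ ys) \<longleftrightarrow> code_at P p xs \<and> code_at P (p + length xs) ys"
proof (induction xs arbitrary: p)
  case Nil
  then show ?case by (auto simp: code_at_def)
qed (auto simp: code_at_Cons)

lemma code_at_le: "code_at P p xs \<Longrightarrow> p + length xs \<le> length P"
  by (simp add: code_at_def)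

lemma sym_le [simp]: "sym b \<le> 2" "sym b \<noteq> 0" "sym b = 2 \<longleftrightarrow> b"
  by (auto simp: sym_def)

lemma cells_push: "(cells xs)(int (length xs) := sym b) = cells (xs @ [b])"
  by (auto simp: cells_def fun_eq_iff nth_append sym_def)

lemma cells_pop: "(cells (xs @ [b]))(int (length xs) := 0) = cells xs"
  by (auto simp: cells_def fun_eq_iff nth_append)

lemma cells_outside [simp]: "cells xs (int (length xs)) = 0" "cells xs (- 1) = 0"
  by (auto simp: cells_def)

lemma cells_last [simp]: "cells (xs @ [b]) (int (length xs)) = sym b"
  by (auto simp: cells_def sym_def)

lemma act_push: "act (sym b, Go_Right) (stack_tape s) = stack_tape (b # s)"
  using cells_push[of "rev s" b] by (simp add: stack_tape_def)

lemma scan_stack_tape [simp]: "scan (stack_tape s) = 0"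
  using cells_outside(1)[of "rev s"] by (simp add: stack_tape_def scan_def)

lemma act_stay [simp]: "act (scan T, Stay) T = T"
  by (cases T) (simp add: scan_def)

lemma reaches_push:
  assumes "p < length P" "P ! p = (r, \<lambda>_. (sym b, Go_Right, l))" "r < 6" "l \<le> length P"
  shows "reaches (machine P) 1 (sconf p s) (sconf l (s(r := b # s r)))"
proof -
  have "(\<lambda>r. stack_tape (s r))(r := act (sym b, Go_Right) (stack_tape (s r))) =
      (\<lambda>q. stack_tape ((s(r := b # s r)) q))"
    by (auto simp: act_push fun_eq_iff)
  then show ?thesis
    using reaches_step[of p P r _ "\<lambda>r. stack_tape (s r)" "sym b" Go_Right l] assms
    by (simp add: sconf_def)
qed

lemma reaches_jump:
  assumes "p < length P" "P ! p = (r, \<lambda>a. (a, Stay, l))" "r < 6" "l \<le> length P"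
  shows "reaches (machine P) 1 (sconf p s) (sconf l s)"
proof -
  have "(\<lambda>r. stack_tape (s r))(r := act (0, Stay) (stack_tape (s r))) = (\<lambda>r. stack_tape (s r))"
    using act_stay[of "stack_tape (s r)"] by (simp add: fun_upd_idem del: act_stay)
  then show ?thesis
    using reaches_step[of p P r _ "\<lambda>r. stack_tape (s r)" 0 Stay l] assms
    by (simp add: sconf_def)
qed

text \<open>The tape in the middle of a pop or a test: the head is on the top symbol, or on cell
  \<open>-1\<close> if the stack is empty.\<close>

definition peek :: "bool list \<Rightarrow> tape" where
  "peek s = (cells (rev s), int (length s) - 1)"

lemma reaches_peek:
  assumes "p < length P" "P ! p = (r, \<lambda>a. (a, Go_Left, l))" "r < 6" "l \<le> length P"
  shows "reaches (machine P) 1 (sconf p s) (conf l ((\<lambda>q. stack_tape (s q))(r := peek (s r))))"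
proof -
  have "cells (rev (s r)) (int (length (s r))) = 0"
    using cells_outside(1)[of "rev (s r)"] by simp
  then have "act (0, Go_Left) (stack_tape (s r)) = peek (s r)"
    by (auto simp: stack_tape_def peek_def fun_eq_iff)
  then show ?thesis
    using reaches_step[of p P r _ "\<lambda>r. stack_tape (s r)" 0 Go_Left l] assms
    by (simp add: sconf_def)
qed

lemma scan_peek: "scan (peek s) = (case s of [] \<Rightarrow> 0 | b # _ \<Rightarrow> sym b)"
proof (cases s)
  case (Cons b t)
  then show ?thesis using cells_last[of "rev t" b] by (simp add: scan_def peek_def)
qed (simp add: scan_def peek_def)

lemma act_peek_pop:
  "act (0, if scan (peek s) = 0 then Go_Right else Stay) (peek s) = stack_tape (tl s)"
proof (cases s)
  case Nil
  then show ?thesis by (auto simp: scan_peek) (auto simp: peek_def stack_tape_def fun_eq_iff cells_def)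
next
  case (Cons b t)
  then show ?thesis
    using cells_pop[of "rev t" b] by (simp add: scan_peek) (simp add: peek_def stack_tape_def)
qed

lemma act_peek_back: "act (scan (peek s), Go_Right) (peek s) = stack_tape s"
  by (simp add: peek_def stack_tape_def scan_def)

lemma reaches_pop:
  assumes "p + 1 < length P" "r < 6" "l1 \<le> length P" "l2 \<le> length P"
    and "P ! p = (r, \<lambda>a. (a, Go_Left, p + 1))"
    and "P ! (p + 1) = (r, \<lambda>a. (0, if a = 0 then Go_Right else Stay, if a = 2 then l1 else l2))"
  shows "reaches (machine P) 2 (sconf p s) (sconf (if top s r then l1 else l2) (s(r := tl (s r))))"
proof -
  let ?T = "(\<lambda>q. stack_tape (s q))(r := peek (s r))"
  have 1: "reaches (machine P) 1 (sconf p s) (conf (p + 1) ?T)"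
    using assms by (intro reaches_peek) auto
  have *: "scan (peek (s r)) = 2 \<longleftrightarrow> top s r"
    by (cases "s r") (auto simp: scan_peek top_def)
  have "reaches (machine P) 1 (conf (p + 1) ?T)
      (conf (if top s r then l1 else l2) (?T(r := act (0, if scan (?T r) = 0 then Go_Right else Stay) (?T r))))"
    by (rule reaches_step[where g = "\<lambda>a. (0, if a = 0 then Go_Right else Stay, if a = 2 then l1 else l2)"])
      (use assms * in auto)
  moreover have "?T(r := act (0, if scan (?T r) = 0 then Go_Right else Stay) (?T r)) =
      (\<lambda>q. stack_tape ((s(r := tl (s r))) q))"
    using act_peek_pop[of "s r"] by (auto simp: fun_eq_iff)
  ultimately have "reaches (machine P) 1 (conf (p + 1) ?T)
      (sconf (if top s r then l1 else l2) (s(r := tl (s r))))"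
    by (simp add: sconf_def)
  with 1 show ?thesis by (rule reaches_trans) simp
qed

text \<open>Induction on the derivation rather than on the program, since a loop runs its own code
  again: after the jump back to \<open>p\<close> the remaining iterations are covered by the
  induction hypothesis at the same address.\<close>

lemma reaches_comp:
  assumes "exec c s t s'" "code_at P p (comp p c)"
  shows "reaches (machine P) t (sconf p s) (sconf (p + csize c) s')"
  using assms
proof (induction arbitrary: p rule: exec.induct)
  case (exec_Skip s)
  then show ?case by (simp add: reaches_refl)
next
  case (exec_Push r b s)
  then show ?case using reaches_push[of p P r b "p + 1" s] by (simp add: code_at_Cons fun_upd_def)
next
  case (exec_Test r q s)
  let ?T = "(\<lambda>q. stack_tape (s q))(r := peek (s r))"
  let ?l = "if s r = [] then p + 2 else p + 3"
  have le: "p + 4 \<le> length P"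
    using exec_Test.prems code_at_le by fastforce
  have 1: "reaches (machine P) 1 (sconf p s) (conf (p + 1) ?T)"
    using exec_Test le by (intro reaches_peek) (auto simp: code_at_Cons)
  have *: "scan (peek (s r)) = 0 \<longleftrightarrow> s r = []" "scan (peek (s r)) \<le> 2"
    by (cases "s r"; auto simp: scan_peek)+
  have "reaches (machine P) 1 (conf (p + 1) ?T)
      (conf ?l (?T(r := act (scan (?T r), Go_Right) (?T r))))"
    by (rule reaches_step[where g = "\<lambda>a. (a, Go_Right, if a = 0 then p + 2 else p + 3)"])
      (use exec_Test le * in \<open>auto simp: code_at_Cons\<close>)
  moreover have "?T(r := act (scan (?T r), Go_Right) (?T r)) = (\<lambda>q. stack_tape (s q))"
    using act_peek_back[of "s r"] by (auto simp: fun_eq_iff)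
  ultimately have 2: "reaches (machine P) 1 (conf (p + 1) ?T) (sconf ?l s)"
    by (simp add: sconf_def)
  have 3: "reaches (machine P) 1 (sconf ?l s) (sconf (p + 4) (s(q := (s r \<noteq> []) # s q)))"
    by (rule reaches_push)
      (use exec_Test le in \<open>auto simp: code_at_Cons numeral_eq_Suc\<close>)
  show ?case
    using reaches_trans[OF 1 reaches_trans[OF 2 3 order_refl], of 3] by (simp add: fun_upd_def)
next
  case (exec_Seq c s t s' d t' s'')
  have "reaches (machine P) t (sconf p s) (sconf (p + csize c) s')"
    "reaches (machine P) t' (sconf (p + csize c) s') (sconf (p + csize c + csize d) s'')"
    using exec_Seq by (auto simp: code_at_append)
  then show ?case by (simp add: add.assoc) (erule (1) reaches_trans, simp)
next
  case (exec_Branch r s c d t s')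
  let ?L = "p + 3 + csize c"
  have at: "P ! p = (r, \<lambda>a. (a, Go_Left, p + 1))" 
    "P ! (p + 1) = (r, \<lambda>a. (0, if a = 0 then Go_Right else Stay, if a = 2 then p + 2 else ?L))"
    "code_at P (p + 2) (comp (p + 2) c)" "P ! (p + 2 + csize c) = (r, \<lambda>a. (a, Stay, ?L + csize d))"
    "code_at P ?L (comp ?L d)" and le: "?L + csize d \<le> length P"
    using exec_Branch.prems by (auto simp: code_at_append code_at_Cons numeral_3_eq_3 dest: code_at_le)
  have 1: "reaches (machine P) 2 (sconf p s)
      (sconf (if top s r then p + 2 else ?L) (s(r := tl (s r))))"
    using exec_Branch.hyps le by (intro reaches_pop at) auto
  show ?case
  proof (cases "top s r")
    case True
    have 2: "reaches (machine P) t (sconf (p + 2) (s(r := tl (s r)))) (sconf (p + 2 + csize c) s')"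
      using exec_Branch.IH[of "p + 2"] at True by (simp add: fun_upd_def)
    have 3: "reaches (machine P) 1 (sconf (p + 2 + csize c) s') (sconf (?L + csize d) s')"
      using at le exec_Branch.hyps by (intro reaches_jump) auto
    show ?thesis
      using reaches_trans[OF 1[unfolded if_P[OF True]] reaches_trans[OF 2 3 order_refl], of "t + 3"]
      by (simp add: ac_simps)
  next
    case False
    have 2: "reaches (machine P) t (sconf ?L (s(r := tl (s r)))) (sconf (?L + csize d) s')"
      using exec_Branch.IH[of ?L] at False by (simp add: fun_upd_def)
    show ?thesis
      using reaches_trans[OF 1[unfolded if_not_P[OF False]] 2, of "t + 3"] by (simp add: ac_simps)
  qed
next
  case (exec_Loop_end r s c)
  have "reaches (machine P) 2 (sconf p s)
      (sconf (if top s r then p + 2 else p + 3 + csize c) (s(r := tl (s r))))"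
    using exec_Loop_end
    by (intro reaches_pop) (auto simp: code_at_append code_at_Cons numeral_3_eq_3 dest: code_at_le)
  then show ?case using exec_Loop_end by (simp add: ac_simps fun_upd_def)
next
  case (exec_Loop r s c t s' t' s'')
  have at: "P ! p = (r, \<lambda>a. (a, Go_Left, p + 1))" 
    "P ! (p + 1) = (r, \<lambda>a. (0, if a = 0 then Go_Right else Stay, if a = 2 then p + 2 else p + 3 + csize c))"
    "code_at P (p + 2) (comp (p + 2) c)" "P ! (p + 2 + csize c) = (r, \<lambda>a. (a, Stay, p))"
    and le: "p + 3 + csize c \<le> length P"
    using exec_Loop.prems by (auto simp: code_at_append code_at_Cons numeral_3_eq_3 dest: code_at_le)
  have 1: "reaches (machine P) 2 (sconf p s)
      (sconf (if top s r then p + 2 else p + 3 + csize c) (s(r := tl (s r))))"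
    using exec_Loop.hyps le by (intro reaches_pop at) auto
  have 2: "reaches (machine P) t (sconf (p + 2) (s(r := tl (s r)))) (sconf (p + 2 + csize c) s')"
    using exec_Loop.IH(1)[of "p + 2"] at by (simp add: fun_upd_def)
  have 3: "reaches (machine P) 1 (sconf (p + 2 + csize c) s') (sconf p s')"
    using at le exec_Loop.hyps by (intro reaches_jump) auto
  have 4: "reaches (machine P) t' (sconf p s') (sconf (p + csize (Loop r c)) s'')"
    using exec_Loop by simp
  have 5: "reaches (machine P) (t + t' + 1) (sconf (p + 2) (s(r := tl (s r)))) (sconf (p + csize (Loop r c)) s'')"
    using reaches_trans[OF 2 reaches_trans[OF 3 4 order_refl]] by simp
  show ?case
    using reaches_trans[OF 1[unfolded if_P[OF exec_Loop.hyps(2)]] 5] by simp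
qed

section \<open>Loading the input, and machines for whole programs\<close>

definition input_loop :: instr where
  "input_loop = (0, \<lambda>a. if a = 0 then (0, Stay, 1) else (a, Go_Right, 0))"

definition full :: "com \<Rightarrow> instr list" where
  "full c = input_loop # comp 1 c"

definition input_store :: "bool list \<Rightarrow> store" where
  "input_store x = (\<lambda>_. [])(0 := rev x)"

text \<open>Walking the input head to the first blank turns the given tape into the tape of a stack;
  \<open>?T h\<close> is the situation with the head on cell \<open>h\<close>.\<close>

lemma reaches_input:
  "reaches (machine (full c)) (length x + 1) (initial (machine (full c)) x) (sconf 1 (input_store x))"
proof -
  let ?M = "machine (full c)"
  let ?T = "\<lambda>h. (\<lambda>_. stack_tape [])(0 := (cells x, int h))"
  have init: "initial ?M x = conf 0 (?T 0)"
    by (simp add: initial_def conf_def upt_rec numeral_eq_Suc stack_tape_def)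
      (auto simp: cells_def)
  have mv: "reaches ?M h (conf 0 (?T 0)) (conf 0 (?T h))" if "h \<le> length x" for h
    using that
  proof (induction h)
    case (Suc h)
    have "reaches ?M 1 (conf 0 (?T h)) (conf 0 ((?T h)(0 := act (cells x (int h), Go_Right) ((?T h) 0))))"
      using reaches_step[of 0 "full c" 0 "snd input_loop" "?T h" "cells x (int h)" Go_Right 0] Suc.prems
      by (auto simp: full_def input_loop_def scan_def cells_def)
    then have "reaches ?M 1 (conf 0 (?T h)) (conf 0 (?T (Suc h)))"
      by (simp add: add.commute)
    then show ?case
      using Suc reaches_trans[of ?M h "conf 0 (?T 0)" "conf 0 (?T h)" 1 "conf 0 (?T (Suc h))" "Suc h"]
      by (simp add: fun_upd_def)
  qed (simp add: reaches_refl)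
  have "reaches ?M 1 (conf 0 (?T (length x))) (conf 1 ((?T (length x))(0 := act (0, Stay) ((?T (length x)) 0))))"
    using reaches_step[of 0 "full c" 0 "snd input_loop" "?T (length x)" 0 Stay 1]
    by (simp add: full_def input_loop_def scan_def)
  moreover have "(?T (length x))(0 := act (0, Stay) ((?T (length x)) 0)) = (\<lambda>r. stack_tape (input_store x r))"
    by (auto simp: fun_eq_iff input_store_def stack_tape_def)
  ultimately have "reaches ?M 1 (conf 0 (?T (length x))) (sconf 1 (input_store x))"
    by (simp add: sconf_def)
  with mv[of "length x"] show ?thesis
    unfolding init by (auto intro: reaches_trans)
qed

definition runs :: "com \<Rightarrow> store \<Rightarrow> nat \<Rightarrow> store \<Rightarrow> bool" where
  "runs c s n s' \<longleftrightarrow> (\<exists>t \<le> n. exec c s t s')"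

text \<open>Stack 5 lives on the last of the six tapes, where the output is read; as a tape shows
  its stack reversed, a stack \<open>rev (f x)\<close> displays \<open>f x\<close>.\<close>

lemma polytimeI:
  assumes "\<And>x. \<exists>s. runs c (input_store x) (poly p (length x)) s \<and> s 5 = rev (f x)"
  shows "polytime f"
  unfolding polytime_def
proof (intro exI conjI)
  show "wf_tm (machine (full c))" by (rule wf_machine)
  \<comment> \<open>\<open>[:1, 1:]\<close> is the polynomial n + 1, the cost of walking over the
    input.\<close>
  show "computes_in_time (machine (full c)) f (poly ([:1, 1:] + p))"
    unfolding computes_in_time_def
  proof
    fix x
    obtain s t where s: "t \<le> poly p (length x)" "exec c (input_store x) t s" "s 5 = rev (f x)"
      using assms[of x] unfolding runs_def by blast
    have "code_at (full c) 1 (comp 1 c)"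
      by (simp add: code_at_def full_def)
    then have "reaches (machine (full c)) (poly ([:1, 1:] + p) (length x))
        (initial (machine (full c)) x) (sconf (1 + csize c) s)"
      by (rule reaches_trans[OF reaches_input reaches_comp[OF s(2)]]) (use s(1) in simp)
    then obtain m where m: "m \<le> poly ([:1, 1:] + p) (length x)"
      "(step (machine (full c)) ^^ m) (initial (machine (full c)) x) = sconf (1 + csize c) s"
      unfolding reaches_def by blast
    then show "\<exists>t \<le> poly ([:1, 1:] + p) (length x).
        case (step (machine (full c)) ^^ t) (initial (machine (full c)) x) of (s, ts) \<Rightarrow>
        s = states (machine (full c)) \<and> fst (last ts) = cells (f x)"
      using s(3)
      by (intro exI[of _ m]) (simp add: sconf_def conf_def full_def stack_tape_def last_map)
  qed
qed

section \<open>Polynomial-time functions on encoded values\<close>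

subsection \<open>Trees on stacks\<close>

datatype tree = Lf | Nd tree tree

text \<open>The preorder code of a binary tree is self-delimiting, so values can be stacked on each
  other without separators.\<close>

fun code :: "tree \<Rightarrow> bool list" where
  "code Lf = [False]"
| "code (Nd a b) = True # code a @ code b"

lemma code_prefix_free: "code a @ xs = code b @ ys \<Longrightarrow> a = b \<and> xs = ys"
proof (induction a arbitrary: b xs ys)
  case Lf
  then show ?case by (cases b) auto
next
  case (Nd a1 a2)
  note IH = Nd.IH and prems = Nd.prems
  show ?case
  proof (cases b)
    case (Nd b1 b2)
    then have "code a1 @ (code a2 @ xs) = code b1 @ (code b2 @ ys)"
      using prems by simp
    then show ?thesis
      using IH(1) IH(2)[of xs b2 ys] Nd by blast
  qed (use prems in simp)
qed

lemma code_inject: "code a = code b \<longleftrightarrow> a = b"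
  using code_prefix_free[of a "[]" b "[]"] by auto

lemma runs_Skip: "runs Skip s 0 s"
  unfolding runs_def using exec_Skip by blast

lemma runs_Push: "r < 6 \<Longrightarrow> runs (Push r b) s 1 (s(r := b # s r))"
  unfolding runs_def using exec_Push by blast

lemma runs_Test: "r < 6 \<Longrightarrow> q < 6 \<Longrightarrow> runs (Test r q) s 3 (s(q := (s r \<noteq> []) # s q))"
  unfolding runs_def using exec_Test by blast

lemma runs_Seq: "runs c s m s' \<Longrightarrow> runs d s' n s'' \<Longrightarrow> runs (c ;; d) s (m + n) s''"
  unfolding runs_def by (meson exec_Seq add_mono)

lemma runs_Branch_True:
  assumes "r < 6" "s r = True # xs" "runs c (s(r := xs)) n s'"
  shows "runs (Branch r c d) s (n + 3) s'"
proof -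
  obtain t where "t \<le> n" "exec c (s(r := xs)) t s'"
    using assms(3) unfolding runs_def by blast
  then show ?thesis
    using exec_Branch[of r s c d t s'] assms unfolding runs_def
    by (intro exI[of _ "t + 3"]) (simp add: top_def)
qed

lemma runs_Branch_False:
  assumes "r < 6" "s r = False # xs" "runs d (s(r := xs)) n s'"
  shows "runs (Branch r c d) s (n + 3) s'"
proof -
  obtain t where "t \<le> n" "exec d (s(r := xs)) t s'"
    using assms(3) unfolding runs_def by blast
  then show ?thesis
    using exec_Branch[of r s c d t s'] assms unfolding runs_def
    by (intro exI[of _ "t + 3"]) (simp add: top_def)
qed

lemma runs_Loop_end: "r < 6 \<Longrightarrow> s r = False # xs \<Longrightarrow> runs (Loop r c) s 2 (s(r := xs))"
  unfolding runs_def using exec_Loop_end[of r s c] by (auto simp: top_def)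

lemma runs_Loop:
  assumes "r < 6" "s r = True # xs" "runs c (s(r := xs)) m s'" "runs (Loop r c) s' n s''"
  shows "runs (Loop r c) s (m + n + 3) s''"
proof -
  obtain t u where "t \<le> m" "exec c (s(r := xs)) t s'" "u \<le> n" "exec (Loop r c) s' u s''"
    using assms(3,4) unfolding runs_def by blast
  then show ?thesis
    using exec_Loop[of r s c t s' u s''] assms(1,2) unfolding runs_def
    by (intro exI[of _ "t + u + 3"]) (simp add: top_def)
qed

lemma runs_mono: "runs c s m s' \<Longrightarrow> m \<le> n \<Longrightarrow> runs c s n s'"
  unfolding runs_def by (meson le_trans)

lemma runs_weaken: "runs c s m s' \<Longrightarrow> m \<le> n \<Longrightarrow> s' = s'' \<Longrightarrow> runs c s n s''"
  using runs_mono by blast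

text \<open>
  A bit string parked in reverse order: a marker \<^const>\<open>True\<close> above each bit announces that there is
  more, so that the string can be read back without knowing its length.
\<close>

definition parked :: "bool list \<Rightarrow> bool list \<Rightarrow> bool list" where
  "parked xs ys = fold (\<lambda>b zs. True # b # zs) xs ys"

lemma parked_simps [simp]:
  "parked [] ys = ys" "parked (b # xs) ys = parked xs (True # b # ys)"
  "parked (xs @ zs) ys = parked zs (parked xs ys)"
  by (simp_all add: parked_def)

text \<open>
  Stack 4 counts, in unary, the subtrees that remain to be read.
\<close>

definition mv_body :: "nat \<Rightarrow> nat \<Rightarrow> com" where
  "mv_body i j = Branch i (Push j True ;; Push j True ;; Push 4 True ;; Push 4 True)
     (Push j False ;; Push j True)"

definition mv :: "nat \<Rightarrow> nat \<Rightarrow> com" where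
  "mv i j = Push j False ;; Push 4 False ;; Push 4 True ;; Loop 4 (mv_body i j)"

text \<open>The loop does not stop after one subtree, so the statement is relative to a
  continuation: a run of the loop from the state after \<open>t\<close> extends backwards to a run
  from the state before \<open>t\<close>. In this form the two induction hypotheses for a node
  chain.\<close>

lemma mv_loop:
  assumes "i < 4" "j < 4" "i \<noteq> j"
    and "runs (Loop 4 (mv_body i j)) (s(4 := K, i := R, j := parked (code t) J)) n s'"
  shows "runs (Loop 4 (mv_body i j)) (s(4 := True # K, i := code t @ R, j := J)) (n + 10 * length (code t)) s'"
  using assms(4)
proof (induction t arbitrary: K R J n)
  case Lf
  let ?s = "s(4 := True # K, i := code Lf @ R, j := J)"
  have "runs (mv_body i j) (?s(4 := K)) (1 + 1 + 3) ((s(4 := K, i := R, j := parked (code Lf) J)))"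
    unfolding mv_body_def
    by (rule runs_Branch_False[where xs = R]; (rule runs_weaken[OF runs_Seq[OF runs_Push runs_Push]])?)
      (use assms(1-3) in \<open>auto simp: fun_eq_iff\<close>)
  from runs_Loop[OF _ _ this Lf] show ?case
    by (rule runs_mono) (use assms(1-3) in auto)
next
  case (Nd a b)
  let ?s = "s(4 := True # K, i := code (Nd a b) @ R, j := J)"
  have 1: "runs (mv_body i j) (?s(4 := K)) 7 (s(4 := True # True # K, i := code a @ code b @ R, j := True # True # J))"
    unfolding mv_body_def
    by (rule runs_mono[OF runs_Branch_True[where xs = "code a @ code b @ R", OF _ _
        runs_weaken[OF runs_Seq[OF runs_Push runs_Seq[OF runs_Push runs_Seq[OF runs_Push runs_Push]]] order_refl]]])
      (use assms(1-3) in \<open>auto simp: fun_eq_iff\<close>)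
  have "runs (Loop 4 (mv_body i j)) (s(4 := True # K, i := code b @ R, j := parked (code a) (True # True # J)))
      (n + 10 * length (code b)) s'"
    using Nd.IH(2)[of K R "parked (code a) (True # True # J)" n] Nd.prems by (simp add: fun_upd_def)
  from Nd.IH(1)[OF this]
  have 2: "runs (Loop 4 (mv_body i j)) (s(4 := True # True # K, i := code a @ code b @ R, j := True # True # J))
      (n + 10 * length (code b) + 10 * length (code a)) s'" .
  show ?case
    by (rule runs_mono[OF runs_Loop[OF _ _ 1 2]]) (use assms(1-3) in auto)
qed

text \<open>The \<open>False\<close> under the counter ends the loop; the \<open>False\<close> first
  pushed on stack \<open>j\<close> marks the end of the parked string.\<close>

lemma runs_mv:
  assumes "i < 4" "j < 4" "i \<noteq> j" "s i = code t @ R"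
  shows "runs (mv i j) s (10 * length (code t) + 5) (s(i := R, j := parked (code t) (False # s j)))"
proof -
  let ?s = "s(4 := False # s 4, i := R, j := parked (code t) (False # s j))"
  have 1: "runs (Loop 4 (mv_body i j)) ?s 2 (s(i := R, j := parked (code t) (False # s j)))"
    by (rule runs_weaken[OF runs_Loop_end]) (use assms in \<open>auto simp: fun_eq_iff\<close>)
  have 2: "runs (Loop 4 (mv_body i j)) (s(4 := True # False # s 4, i := code t @ R, j := False # s j))
      (2 + 10 * length (code t)) (s(i := R, j := parked (code t) (False # s j)))"
    by (rule mv_loop[OF assms(1-3) 1])
  have 3: "s(4 := True # False # s 4, i := code t @ R, j := False # s j) =
     s(j := False # s j, 4 := False # s 4, 4 := True # False # s 4)"
    using assms by (auto simp: fun_eq_iff)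
  have e: "runs (Push 4 False) (s(j := False # s j)) 1 (s(j := False # s j, 4 := False # s 4))"
    "runs (Push 4 True) (s(j := False # s j, 4 := False # s 4)) 1 (s(j := False # s j, 4 := False # s 4, 4 := True # False # s 4))"
    using assms by (auto intro!: runs_weaken[OF runs_Push])
  show ?thesis unfolding mv_def
    by (rule runs_mono[OF runs_Seq[OF runs_Push runs_Seq[OF e(1) runs_Seq[OF e(2) 2[unfolded 3]]]]])
      (use assms in auto)
qed

definition dropt :: "nat \<Rightarrow> com" where
  "dropt i = Push 4 False ;; Push 4 True ;; Loop 4 (Branch i (Push 4 True ;; Push 4 True) Skip)"

lemma drop_loop:
  assumes "i < 4"
    and "runs (Loop 4 (Branch i (Push 4 True ;; Push 4 True) Skip)) (s(4 := K, i := R)) n s'"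
  shows "runs (Loop 4 (Branch i (Push 4 True ;; Push 4 True) Skip)) (s(4 := True # K, i := code t @ R))
    (n + 10 * length (code t)) s'"
  using assms(2)
proof (induction t arbitrary: K R n)
  case Lf
  let ?s = "s(4 := True # K, i := code Lf @ R)"
  have "runs (Branch i (Push 4 True ;; Push 4 True) Skip) (?s(4 := K)) 3 (s(4 := K, i := R))"
    by (rule runs_weaken[OF runs_Branch_False[where xs = R, OF _ _ runs_Skip]])
      (use assms(1) in \<open>auto simp: fun_eq_iff\<close>)
  from runs_Loop[OF _ _ this Lf] show ?case
    by (rule runs_mono) (use assms(1) in auto)
next
  case (Nd a b)
  let ?s = "s(4 := True # K, i := code (Nd a b) @ R)"
  have 1: "runs (Branch i (Push 4 True ;; Push 4 True) Skip) (?s(4 := K)) 5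
      (s(4 := True # True # K, i := code a @ code b @ R))"
    by (rule runs_mono[OF runs_Branch_True[where xs = "code a @ code b @ R", OF _ _
        runs_weaken[OF runs_Seq[OF runs_Push runs_Push] order_refl]]])
      (use assms(1) in \<open>auto simp: fun_eq_iff\<close>)
  have 2: "runs (Loop 4 (Branch i (Push 4 True ;; Push 4 True) Skip))
      (s(4 := True # True # K, i := code a @ code b @ R)) (n + 10 * length (code b) + 10 * length (code a)) s'"
    by (rule Nd.IH(1)[OF Nd.IH(2)[OF Nd.prems]])
  show ?case
    by (rule runs_mono[OF runs_Loop[OF _ _ 1 2]]) (use assms(1) in auto)
qed

lemma runs_dropt:
  assumes "i < 4" "s i = code t @ R"
  shows "runs (dropt i) s (10 * length (code t) + 5) (s(i := R))"
proof -
  let ?s = "s(4 := False # s 4, i := R)"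
  have 1: "runs (Loop 4 (Branch i (Push 4 True ;; Push 4 True) Skip)) ?s 2 (s(i := R))"
    by (rule runs_weaken[OF runs_Loop_end]) (use assms in \<open>auto simp: fun_eq_iff\<close>)
  have 2: "runs (Loop 4 (Branch i (Push 4 True ;; Push 4 True) Skip)) (s(4 := True # False # s 4, i := code t @ R))
      (2 + 10 * length (code t)) (s(i := R))"
    by (rule drop_loop[OF assms(1) 1])
  have 3: "s(4 := True # False # s 4, i := code t @ R) = s(4 := False # s 4, 4 := True # False # s 4)"
    using assms by (auto simp: fun_eq_iff)
  have e: "runs (Push 4 True) (s(4 := False # s 4)) 1 (s(4 := False # s 4, 4 := True # False # s 4))"
    by (auto intro!: runs_weaken[OF runs_Push])
  show ?thesis unfolding dropt_def
    by (rule runs_mono[OF runs_Seq[OF runs_Push runs_Seq[OF e 2[unfolded 3]]]]) auto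
qed

definition unpark :: "nat \<Rightarrow> com \<Rightarrow> com \<Rightarrow> com" where
  "unpark j c d = Loop j (Branch j c d)"

text \<open>\<open>S ys zs\<close> is the store in which \<open>ys\<close> has been rebuilt and
  \<open>zs\<close> still lies on stack \<open>j\<close>. The bits come off last first, hence the
  induction from the end of \<open>xs\<close>, and prepending them restores their order.\<close>

lemma runs_unpark:
  assumes "j < 6"
    and step: "\<And>b ys zs. runs (if b then c else d) (S ys zs) n (S (b # ys) zs)"
    and get: "\<And>ys zs. S ys zs j = zs"
    and upd: "\<And>ys zs ws. (S ys zs)(j := ws) = S ys ws"
  shows "runs (unpark j c d) (S [] (parked xs (False # J))) ((n + 6) * length xs + 2) (S xs J)"
proof -
  have "runs (unpark j c d) (S ys (parked xs (False # J))) ((n + 6) * length xs + 2) (S (xs @ ys) J)" for ys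
  proof (induction xs arbitrary: ys rule: rev_induct)
    case Nil
    show ?case unfolding unpark_def
      by (rule runs_weaken[OF runs_Loop_end[where xs = J]]) (auto simp: assms(1) get upd)
  next
    case (snoc b xs)
    let ?Z = "parked xs (False # J)"
    have "runs (Branch j c d) ((S ys (parked (xs @ [b]) (False # J)))(j := b # ?Z)) (n + 3) (S (b # ys) ?Z)"
    proof (cases b)
      case True
      show ?thesis
        by (rule runs_Branch_True[where xs = ?Z]) (use step[of b] True in \<open>auto simp: assms(1) get upd\<close>)
    next
      case False
      show ?thesis
        by (rule runs_Branch_False[where xs = ?Z]) (use step[of b] False in \<open>auto simp: assms(1) get upd\<close>)
    qed
    from runs_Loop[OF assms(1) _ this snoc[unfolded unpark_def]] show ?case
      unfolding unpark_def by (rule runs_weaken) (auto simp: get algebra_simps)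
  qed
  from this[of "[]"] show ?thesis by simp
qed

definition ret :: "nat \<Rightarrow> nat \<Rightarrow> com" where
  "ret j i = unpark j (Push i True) (Push i False)"

lemma runs_ret:
  assumes "i < 6" "j < 6" "i \<noteq> j" "s j = parked xs (False # J)"
  shows "runs (ret j i) s (7 * length xs + 2) (s(j := J, i := xs @ s i))"
proof -
  define S where "S ys zs = s(j := zs, i := ys @ s i)" for ys zs
  have "runs (unpark j (Push i True) (Push i False)) (S [] (parked xs (False # J))) ((1 + 6) * length xs + 2) (S xs J)"
    by (rule runs_unpark)
      (use assms(1-3) in \<open>auto simp: fun_eq_iff S_def intro!: runs_weaken[OF runs_Push]\<close>)
  moreover have "S [] (parked xs (False # J)) = s"
    using assms(4) by (auto simp: S_def fun_eq_iff)
  ultimately show ?thesis by (simp add: ret_def S_def)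
qed

definition ret2 :: "nat \<Rightarrow> nat \<Rightarrow> nat \<Rightarrow> com" where
  "ret2 j i k = unpark j (Push i True ;; Push k True) (Push i False ;; Push k False)"

lemma runs_ret2:
  assumes "i < 6" "j < 6" "k < 6" "i \<noteq> j" "i \<noteq> k" "k \<noteq> j" "s j = parked xs (False # J)"
  shows "runs (ret2 j i k) s (8 * length xs + 2) (s(j := J, i := xs @ s i, k := xs @ s k))"
proof -
  define S where "S ys zs = s(j := zs, i := ys @ s i, k := ys @ s k)" for ys zs
  have "runs (unpark j (Push i True ;; Push k True) (Push i False ;; Push k False))
      (S [] (parked xs (False # J))) ((2 + 6) * length xs + 2) (S xs J)"
    by (rule runs_unpark)
      (use assms(1-6) in \<open>auto simp: fun_eq_iff S_def intro!: runs_weaken[OF runs_Seq[OF runs_Push runs_Push]]\<close>)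
  moreover have "S [] (parked xs (False # J)) = s"
    using assms(7) by (auto simp: S_def fun_eq_iff)
  ultimately show ?thesis by (simp add: ret2_def S_def)
qed

section \<open>Moving, copying and swapping whole trees\<close>

definition transfer :: "nat \<Rightarrow> nat \<Rightarrow> com" where
  "transfer i j = mv i 2 ;; ret 2 j"

lemma runs_transfer:
  assumes "i < 4" "j < 4" "i \<noteq> j" "i \<noteq> 2" "j \<noteq> 2" "s i = code t @ R"
  shows "runs (transfer i j) s (17 * length (code t) + 7) (s(i := R, j := code t @ s j))"
  unfolding transfer_def
  by (rule runs_weaken[OF runs_Seq[OF runs_mv[where R = R and t = t] runs_ret[where xs = "code t" and J = "s 2"]]])
    (use assms in \<open>auto simp: fun_eq_iff\<close>)

definition dupt :: com where
  "dupt = mv 1 2 ;; ret2 2 1 3 ;; transfer 3 1"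

lemma runs_dupt:
  assumes "s 1 = code t @ R"
  shows "runs dupt s (40 * length (code t) + 20) (s(1 := code t @ code t @ R))"
  unfolding dupt_def
  by (rule runs_weaken[OF runs_Seq[OF runs_mv[where R = R and t = t] runs_Seq[OF runs_ret2[where xs = "code t" and J = "s 2"]
     runs_transfer[where t = t and R = "s 3"]]]])
    (use assms in \<open>auto simp: fun_eq_iff\<close>)

definition swapt :: com where
  "swapt = mv 1 2 ;; mv 1 3 ;; ret 2 1 ;; ret 3 1"

lemma runs_swapt:
  assumes "s 1 = code t @ code u @ R"
  shows "runs swapt s (20 * length (code t) + 20 * length (code u) + 20) (s(1 := code u @ code t @ R))"
  unfolding swapt_def
  by (rule runs_weaken[OF runs_Seq[OF runs_mv[where R = "code u @ R" and t = t]
     runs_Seq[OF runs_mv[where R = R and t = u] 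
     runs_Seq[OF runs_ret[where xs = "code t" and J = "s 2"] runs_ret[where xs = "code u" and J = "s 3"]]]]])
    (use assms in \<open>auto simp: fun_eq_iff\<close>)

fun pushes :: "bool list \<Rightarrow> com" where
  "pushes [] = Skip"
| "pushes (b # bs) = pushes bs ;; Push 1 b"

lemma runs_pushes: "runs (pushes bs) s (length bs) (s(1 := bs @ s 1))"
proof (induction bs)
  case (Cons b bs)
  show ?case unfolding pushes.simps
    by (rule runs_weaken[OF runs_Seq[OF Cons runs_Push]]) (auto simp: fun_eq_iff)
qed (simp add: runs_Skip)

subsection \<open>Polynomial bounds\<close>

text \<open>With a base of at least 2, a constant \<open>c\<close> is below \<open>2 ^ c\<close> and
  a sum of two bounds costs one more in the exponent, so single powers suffice and no coefficients
  have to be tracked.\<close>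

definition pbound :: "(nat \<Rightarrow> nat) \<Rightarrow> bool" where
  "pbound T \<longleftrightarrow> (\<exists>k. \<forall>n. T n \<le> (n + 2) ^ k)"

lemma pboundI: "(\<And>n. T n \<le> (n + 2) ^ k) \<Longrightarrow> pbound T"
  unfolding pbound_def by blast

lemma power_exp_mono: "j \<le> k \<Longrightarrow> (n + 2 :: nat) ^ j \<le> (n + 2) ^ k"
  by (rule power_increasing) auto

lemma pbound_const: "pbound (\<lambda>_. c)"
proof (rule pboundI)
  fix n :: nat
  have "c \<le> 2 ^ c" by (rule less_imp_le[OF less_exp])
  also have "\<dots> \<le> (n + 2) ^ c" by (rule power_mono) auto
  finally show "c \<le> (n + 2) ^ c" .
qed

lemma pbound_id: "pbound (\<lambda>n. n)"
  by (rule pboundI[of _ 1]) simp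

lemma pbound_mult:
  assumes "pbound T" "pbound U"
  shows "pbound (\<lambda>n. T n * U n)"
proof -
  obtain j k where "\<And>n. T n \<le> (n + 2) ^ j" "\<And>n. U n \<le> (n + 2) ^ k"
    using assms unfolding pbound_def by blast
  then show ?thesis
    by (intro pboundI[of _ "j + k"]) (simp add: power_add mult_mono)
qed

lemma pbound_add:
  assumes "pbound T" "pbound U"
  shows "pbound (\<lambda>n. T n + U n)"
proof -
  obtain j k where jk: "\<And>n. T n \<le> (n + 2) ^ j" "\<And>n. U n \<le> (n + 2) ^ k"
    using assms unfolding pbound_def by blast
  show ?thesis
  proof (rule pboundI)
    fix n
    have "T n + U n \<le> (n + 2) ^ max j k + (n + 2) ^ max j k"
      by (intro add_mono order_trans[OF jk(1)] order_trans[OF jk(2)] power_exp_mono) auto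
    also have "\<dots> \<le> (n + 2) ^ Suc (max j k)"
      by simp
    finally show "T n + U n \<le> (n + 2) ^ Suc (max j k)" .
  qed
qed

lemma pbound_power: "pbound T \<Longrightarrow> pbound (\<lambda>n. T n ^ k)"
  by (induction k) (auto intro: pbound_mult pbound_const)

lemmas pbound_intros = pbound_add pbound_mult pbound_power pbound_const pbound_id

lemma poly_mono_nat: "m \<le> n \<Longrightarrow> poly (p :: nat poly) m \<le> poly p n"
  by (induction p) (auto intro: add_mono mult_mono)

subsection \<open>Encoded values\<close>

class enc =
  fixes enc :: "'a \<Rightarrow> tree"
  assumes enc_inject: "enc x = enc y \<longleftrightarrow> x = y"

instantiation bool :: enc
begin
definition "enc (b :: bool) = (if b then Nd Lf Lf else Lf)"
instance by standard (auto simp: enc_bool_def)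
end

text \<open>Unary numbers are adequate because all counters that occur are polynomially bounded;
  moreover they are the same trees as lists of units.\<close>

instantiation nat :: enc
begin
fun enc_nat :: "nat \<Rightarrow> tree" where
  "enc_nat 0 = Lf"
| "enc_nat (Suc n) = Nd Lf (enc_nat n)"
instance
proof
  show "enc x = enc y \<longleftrightarrow> x = y" for x y :: nat
  proof (induction x arbitrary: y)
    case 0
    then show ?case by (cases y) auto
  next
    case (Suc x)
    then show ?case by (cases y) auto
  qed
qed
end

instantiation unit :: enc
begin
definition "enc (u :: unit) = Lf"
instance by standard auto
end

instantiation list :: (enc) enc
begin
fun enc_list :: "'a list \<Rightarrow> tree" where
  "enc_list [] = Lf"
| "enc_list (x # xs) = Nd (enc x) (enc_list xs)"
instance
proof
  show "enc x = enc y \<longleftrightarrow> x = y" for x y :: "'a list"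
  proof (induction x arbitrary: y)
    case Nil
    then show ?case by (cases y) auto
  next
    case (Cons a x)
    then show ?case by (cases y) (auto simp: enc_inject)
  qed
qed
end

instantiation prod :: (enc, enc) enc
begin
fun enc_prod :: "'a \<times> 'b \<Rightarrow> tree" where
  "enc_prod (x, y) = Nd (enc x) (enc y)"
instance by standard (auto simp: enc_inject)
end

definition sz :: "'a::enc \<Rightarrow> nat" where
  "sz x = length (code (enc x))"

lemma sz_simps [simp]:
  "sz False = 1" "sz True = 3" "sz (0 :: nat) = 1" "sz (Suc n) = sz n + 2" "sz () = 1"
  "sz ([] :: 'a::enc list) = 1" "sz ((x :: 'a::enc) # xs) = sz x + sz xs + 1"
  "sz ((x, y) :: 'a::enc \<times> 'b::enc) = sz x + sz y + 1"
  by (simp_all add: sz_def enc_bool_def enc_unit_def)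

lemma sz_nat: "sz (n :: nat) = 2 * n + 1"
  by (induction n) auto

lemma sz_pos: "sz x \<ge> 1"
  by (cases "enc x") (auto simp: sz_def)

lemma length_le_sz: "length (xs :: 'a::enc list) \<le> sz xs"
  by (induction xs) auto

lemma sz_mem: "x \<in> set xs \<Longrightarrow> sz x \<le> sz xs"
  by (induction xs) auto

lemma sz_list_bound: "(\<And>x. x \<in> set xs \<Longrightarrow> sz x \<le> B) \<Longrightarrow> sz xs \<le> length xs * (B + 1) + 1"
proof (induction xs)
  case (Cons x xs)
  have "sz x \<le> B" "sz xs \<le> length xs * (B + 1) + 1"
    using Cons by auto
  then show ?case by simp
qed auto

lemma sz_append: "sz (xs @ ys) + 1 = sz xs + sz ys"
  by (induction xs) auto

lemma sz_bools: "sz (xs :: bool list) \<le> 4 * length xs + 1"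
  by (rule order_trans[OF sz_list_bound[where B = 3]]) (simp_all, metis (full_types) One_nat_def one_le_numeral order_refl sz_simps(1,2))

subsection \<open>Polynomial-time functions\<close>

text \<open>\<open>R\<close> and all other stacks are arbitrary and come back exactly as they were,
  scratch stacks included. Hence such programs can be nested while pending values wait below the
  argument.\<close>

definition fp :: "('a::enc \<Rightarrow> 'b::enc) \<Rightarrow> bool" where
  "fp f \<longleftrightarrow> (\<exists>c k. \<forall>x s R. s 1 = code (enc x) @ R \<longrightarrow>
     runs c s ((sz x + 2) ^ k) (s(1 := code (enc (f x)) @ R)))"

lemma fpI:
  assumes "pbound T"
    and "\<And>x s R. s 1 = code (enc x) @ R \<Longrightarrow> runs c s (T (sz x)) (s(1 := code (enc (f x)) @ R))"
  shows "fp f"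
proof -
  obtain k where "\<And>n. T n \<le> (n + 2) ^ k"
    using assms(1) unfolding pbound_def by blast
  then show ?thesis
    using assms(2) unfolding fp_def by (blast intro: runs_mono)
qed

lemma fpE:
  assumes "fp f"
  obtains c k where "\<And>x s R. s 1 = code (enc x) @ R \<Longrightarrow>
     runs c s ((sz x + 2) ^ k) (s(1 := code (enc (f x)) @ R))"
  using assms unfolding fp_def by blast

text \<open>Started with nothing but the argument, the program has no time to write a longer result.
  Composition depends on this, as the second program is charged by the size of the intermediate
  value.\<close>

lemma fp_size:
  fixes f :: "'a::enc \<Rightarrow> 'b::enc"
  assumes "fp f"
  obtains k where "\<And>x. sz (f x) \<le> (sz x + 2) ^ k"
proof -
  obtain c k where c: "\<And>x s R. s 1 = code (enc x) @ R \<Longrightarrow>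
     runs c s ((sz x + 2) ^ k) (s(1 := code (enc (f x)) @ R))"
    using assms by (rule fpE) blast
  have "sz (f x) \<le> sz x + (sz x + 2) ^ k" for x :: 'a
  proof -
    have "runs c ((\<lambda>_. [])(1 := code (enc x))) ((sz x + 2) ^ k) ((\<lambda>_. [])(1 := code (enc (f x))))"
      using c[of "(\<lambda>_. [])(1 := code (enc x))" x "[]"] by simp
    then obtain t where "t \<le> (sz x + 2) ^ k"
      "exec c ((\<lambda>_. [])(1 := code (enc x))) t ((\<lambda>_. [])(1 := code (enc (f x))))"
      unfolding runs_def by blast
    then show ?thesis
      using exec_length[of c _ t _ 1] by (fastforce simp: sz_def)
  qed
  moreover have "pbound (\<lambda>n. n + (n + 2) ^ k)"
    by (intro pbound_intros)
  ultimately show thesis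
    using that unfolding pbound_def by (meson le_trans)
qed

lemma fp_comp:
  fixes f :: "'a::enc \<Rightarrow> 'b::enc" and g :: "'b \<Rightarrow> 'c::enc"
  assumes "fp g" "fp f"
  shows "fp (\<lambda>x. g (f x))"
proof -
  obtain c k where c: "\<And>x s R. s 1 = code (enc x) @ R \<Longrightarrow>
     runs c s ((sz x + 2) ^ k) (s(1 := code (enc (f x)) @ R))"
    using assms(2) by (rule fpE) blast
  obtain d l where d: "\<And>x s R. s 1 = code (enc x) @ R \<Longrightarrow>
     runs d s ((sz x + 2) ^ l) (s(1 := code (enc (g x)) @ R))"
    using assms(1) by (rule fpE) blast
  obtain m where m: "\<And>x. sz (f x) \<le> (sz x + 2) ^ m"
    using assms(2) by (rule fp_size) blast
  show ?thesis
  proof (rule fpI[where c = "c ;; d" and T = "\<lambda>n. (n + 2) ^ k + ((n + 2) ^ m + 2) ^ l"])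
    fix x :: 'a and s :: store and R
    assume s: "s 1 = code (enc x) @ R"
    show "runs (c ;; d) s ((sz x + 2) ^ k + ((sz x + 2) ^ m + 2) ^ l) (s(1 := code (enc (g (f x))) @ R))"
      by (rule runs_weaken[OF runs_Seq[OF c[of s x R, OF s] d]])
        (use m[of x] in \<open>auto intro!: power_mono\<close>)
  qed (intro pbound_intros)
qed

text \<open>A function that does not change the tree is computed by doing nothing, so conversions
  between types with equal encodings are free.\<close>

lemma fp_coerce:
  assumes "\<And>x. enc (h x) = enc x"
  shows "fp h"
  by (rule fpI[where c = Skip and T = "\<lambda>_. 0"])
    (auto intro!: pbound_intros runs_weaken[OF runs_Skip] simp: assms fun_eq_iff)

lemma fp_id: "fp (\<lambda>x. x)"
  by (rule fp_coerce) simp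

lemma fp_const: "fp (\<lambda>_ :: 'a::enc. a)"
proof (rule fpI[where c = "dropt 1 ;; pushes (code (enc a))" and
      T = "\<lambda>n. 10 * n + 5 + length (code (enc a))"])
  fix x :: 'a and s :: store and R
  assume s: "s 1 = code (enc x) @ R"
  show "runs (dropt 1 ;; pushes (code (enc a))) s (10 * sz x + 5 + length (code (enc a)))
      (s(1 := code (enc a) @ R))"
    by (rule runs_weaken[OF runs_Seq[OF runs_dropt[of 1 s "enc x" R] runs_pushes]]) (use s in \<open>auto simp: sz_def\<close>)
qed (intro pbound_intros)

text \<open>The first component has to end up on top, so \<open>g\<close> is computed first and
  swapped below the copy of the argument kept for \<open>f\<close>; the final \<open>True\<close> is
  the root of the pair.\<close>

lemma fp_pair:
  fixes f :: "'a::enc \<Rightarrow> 'b::enc" and g :: "'a \<Rightarrow> 'c::enc"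
  assumes "fp f" "fp g"
  shows "fp (\<lambda>x. (f x, g x))"
proof -
  obtain c k where c: "\<And>x s R. s 1 = code (enc x) @ R \<Longrightarrow>
     runs c s ((sz x + 2) ^ k) (s(1 := code (enc (f x)) @ R))"
    using assms(1) by (rule fpE) blast
  obtain d l where d: "\<And>x s R. s 1 = code (enc x) @ R \<Longrightarrow>
     runs d s ((sz x + 2) ^ l) (s(1 := code (enc (g x)) @ R))"
    using assms(2) by (rule fpE) blast
  obtain m where m: "\<And>x. sz (g x) \<le> (sz x + 2) ^ m"
    using assms(2) by (rule fp_size) blast
  let ?T = "\<lambda>n. 40 * n + 20 + (n + 2) ^ l + (20 * (n + 2) ^ m + 20 * n + 20) + (n + 2) ^ k + 1"
  show ?thesis
  proof (rule fpI[where c = "dupt ;; d ;; swapt ;; c ;; Push 1 True" and T = ?T])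
    fix x :: 'a and s :: store and R
    assume s: "s 1 = code (enc x) @ R"
    have 1: "runs dupt s (40 * sz x + 20) (s(1 := code (enc x) @ code (enc x) @ R))"
      using runs_dupt[of s "enc x" R, OF s] by (simp add: sz_def)
    have 2: "runs d (s(1 := code (enc x) @ code (enc x) @ R)) ((sz x + 2) ^ l) (s(1 := code (enc (g x)) @ code (enc x) @ R))"
      using d[of "s(1 := code (enc x) @ code (enc x) @ R)" x "code (enc x) @ R"] by simp
    have 3: "runs swapt (s(1 := code (enc (g x)) @ code (enc x) @ R)) (20 * sz (g x) + 20 * sz x + 20)
        (s(1 := code (enc x) @ code (enc (g x)) @ R))"
      using runs_swapt[of "s(1 := code (enc (g x)) @ code (enc x) @ R)" "enc (g x)" "enc x" R] by (simp add: sz_def)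
    have 4: "runs c (s(1 := code (enc x) @ code (enc (g x)) @ R)) ((sz x + 2) ^ k) (s(1 := code (enc (f x)) @ code (enc (g x)) @ R))"
      using c[of "s(1 := code (enc x) @ code (enc (g x)) @ R)" x "code (enc (g x)) @ R"] by simp
    show "runs (dupt ;; d ;; swapt ;; c ;; Push 1 True) s (?T (sz x)) (s(1 := code (enc (f x, g x)) @ R))"
      by (rule runs_weaken[OF runs_Seq[OF 1 runs_Seq[OF 2 runs_Seq[OF 3 runs_Seq[OF 4 runs_Push]]]]])
        (use m[of x] in auto)
  qed (intro pbound_intros)
qed

lemma fp_fst': "fp (fst :: 'a::enc \<times> 'b::enc \<Rightarrow> 'a)"
proof (rule fpI[where c = "Branch 1 (mv 1 2 ;; dropt 1 ;; ret 2 1) Skip" and T = "\<lambda>n. 17 * n + 20"])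
  fix p :: "'a \<times> 'b" and s :: store and R
  assume s: "s 1 = code (enc p) @ R"
  obtain x y where p: "p = (x, y)" by (cases p)
  show "runs (Branch 1 (mv 1 2 ;; dropt 1 ;; ret 2 1) Skip) s (17 * sz p + 20) (s(1 := code (enc (fst p)) @ R))"
    by (rule runs_weaken[OF runs_Branch_True[where xs = "code (enc x) @ code (enc y) @ R", OF _ _
        runs_Seq[OF runs_mv[where t = "enc x" and R = "code (enc y) @ R"] runs_Seq[OF
          runs_dropt[where t = "enc y" and R = R] runs_ret[where xs = "code (enc x)" and J = "s 2"]]]]])
      (use s in \<open>auto simp: p sz_def fun_eq_iff\<close>)
qed (intro pbound_intros)

lemma fp_snd': "fp (snd :: 'a::enc \<times> 'b::enc \<Rightarrow> 'b)"
proof (rule fpI[where c = "Branch 1 (dropt 1) Skip" and T = "\<lambda>n. 10 * n + 8"])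
  fix p :: "'a \<times> 'b" and s :: store and R
  assume s: "s 1 = code (enc p) @ R"
  obtain x y where p: "p = (x, y)" by (cases p)
  show "runs (Branch 1 (dropt 1) Skip) s (10 * sz p + 8) (s(1 := code (enc (snd p)) @ R))"
    by (rule runs_weaken[OF runs_Branch_True[where xs = "code (enc x) @ code (enc y) @ R", OF _ _
        runs_dropt[where t = "enc x" and R = "code (enc y) @ R"]]])
      (use s in \<open>auto simp: p sz_def fun_eq_iff\<close>)
qed (intro pbound_intros)

lemma fp_fst: "fp f \<Longrightarrow> fp (\<lambda>e. fst (f e))"
  by (rule fp_comp[OF fp_fst'])

lemma fp_snd: "fp f \<Longrightarrow> fp (\<lambda>e. snd (f e))"
  by (rule fp_comp[OF fp_snd'])

lemma fp_if:
  fixes b :: "'a::enc \<Rightarrow> bool" and f g :: "'a \<Rightarrow> 'b::enc"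
  assumes "fp b" "fp f" "fp g"
  shows "fp (\<lambda>x. if b x then f x else g x)"
proof -
  obtain c k where c: "\<And>x s R. s 1 = code (enc x) @ R \<Longrightarrow>
     runs c s ((sz x + 2) ^ k) (s(1 := code (enc (b x)) @ R))"
    using assms(1) by (rule fpE) blast
  obtain d l where d: "\<And>x s R. s 1 = code (enc x) @ R \<Longrightarrow>
     runs d s ((sz x + 2) ^ l) (s(1 := code (enc (f x)) @ R))"
    using assms(2) by (rule fpE) blast
  obtain e m where e: "\<And>x s R. s 1 = code (enc x) @ R \<Longrightarrow>
     runs e s ((sz x + 2) ^ m) (s(1 := code (enc (g x)) @ R))"
    using assms(3) by (rule fpE) blast
  let ?B = "Branch 1 (dropt 1 ;; dropt 1 ;; d) e"
  let ?T = "\<lambda>n. 40 * n + 20 + (n + 2) ^ k + (30 + (n + 2) ^ l + (n + 2) ^ m + 3)"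
  show ?thesis
  proof (rule fpI[where c = "dupt ;; c ;; ?B" and T = ?T])
    fix x :: 'a and s :: store and R
    assume s: "s 1 = code (enc x) @ R"
    let ?R = "code (enc x) @ R"
    have 1: "runs dupt s (40 * sz x + 20) (s(1 := code (enc x) @ ?R))"
      using runs_dupt[of s "enc x" R, OF s] by (simp add: sz_def)
    have 2: "runs c (s(1 := code (enc x) @ ?R)) ((sz x + 2) ^ k) (s(1 := code (enc (b x)) @ ?R))"
      using c[of "s(1 := code (enc x) @ ?R)" x ?R] by simp
    have 3: "runs ?B (s(1 := code (enc (b x)) @ ?R)) (30 + (sz x + 2) ^ l + (sz x + 2) ^ m + 3)
        (s(1 := code (enc (if b x then f x else g x)) @ R))"
    proof (cases "b x")
      case True
      \<comment> \<open>\<open>True\<close> is encoded by \<open>Nd Lf Lf\<close>: the branch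
        consumes the root, and two leaves remain to be dropped.\<close>
      show ?thesis
        by (rule runs_weaken[OF runs_Branch_True[where xs = "False # False # ?R", OF _ _
            runs_Seq[OF runs_dropt[where t = Lf and R = "False # ?R"] runs_Seq[OF
              runs_dropt[where t = Lf and R = ?R] d[where x = x and R = R]]]]])
          (use True in \<open>auto simp: enc_bool_def\<close>)
    next
      case False
      show ?thesis
        by (rule runs_weaken[OF runs_Branch_False[where xs = ?R, OF _ _ e[where x = x and R = R]]])
          (use False in \<open>auto simp: enc_bool_def\<close>)
    qed
    show "runs (dupt ;; c ;; ?B) s (?T (sz x)) (s(1 := code (enc (if b x then f x else g x)) @ R))"
      by (rule runs_weaken[OF runs_Seq[OF 1 runs_Seq[OF 2 3]]]) auto
  qed (intro pbound_intros)
qed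

lemma fp_null': "fp (\<lambda>xs :: 'a::enc list. xs = [])"
proof (rule fpI[where c = "Branch 1 (dropt 1 ;; dropt 1 ;; pushes (code (enc False))) (pushes (code (enc True)))"
      and T = "\<lambda>n. 10 * n + 20"])
  fix x :: "'a list" and s :: store and R
  assume s: "s 1 = code (enc x) @ R"
  show "runs (Branch 1 (dropt 1 ;; dropt 1 ;; pushes (code (enc False))) (pushes (code (enc True)))) s
      (10 * sz x + 20) (s(1 := code (enc (x = [])) @ R))"
  proof (cases x)
    case Nil
    show ?thesis
      by (rule runs_weaken[OF runs_Branch_False[where xs = R, OF _ _ runs_pushes]])
        (use s Nil in \<open>auto simp: enc_bool_def fun_eq_iff\<close>)
  next
    case (Cons y ys)
    show ?thesis
      by (rule runs_weaken[OF runs_Branch_True[where xs = "code (enc y) @ code (enc ys) @ R", OF _ _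
            runs_Seq[OF runs_dropt[where t = "enc y" and R = "code (enc ys) @ R"] runs_Seq[OF
              runs_dropt[where t = "enc ys" and R = R] runs_pushes]]]])
        (use s Cons in \<open>auto simp: enc_bool_def fun_eq_iff sz_def\<close>)
  qed
qed (intro pbound_intros)

text \<open>\<open>hd []\<close> is a fixed though unspecified value, so its code can be pushed as a
  constant.\<close>

lemma fp_hd': "fp (hd :: 'a::enc list \<Rightarrow> 'a)"
proof (rule fpI[where c = "Branch 1 (mv 1 2 ;; dropt 1 ;; ret 2 1) (pushes (code (enc (hd [] :: 'a))))"
      and T = "\<lambda>n. 17 * n + 20 + sz (hd [] :: 'a)"])
  fix x :: "'a list" and s :: store and R
  assume s: "s 1 = code (enc x) @ R"
  show "runs (Branch 1 (mv 1 2 ;; dropt 1 ;; ret 2 1) (pushes (code (enc (hd [] :: 'a))))) s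
      (17 * sz x + 20 + sz (hd [] :: 'a)) (s(1 := code (enc (hd x)) @ R))"
  proof (cases x)
    case Nil
    show ?thesis
      by (rule runs_weaken[OF runs_Branch_False[where xs = R, OF _ _ runs_pushes]])
        (use s Nil in \<open>auto simp: fun_eq_iff sz_def\<close>)
  next
    case (Cons y ys)
    show ?thesis
      by (rule runs_weaken[OF runs_Branch_True[where xs = "code (enc y) @ code (enc ys) @ R", OF _ _
          runs_Seq[OF runs_mv[where t = "enc y" and R = "code (enc ys) @ R"] runs_Seq[OF
            runs_dropt[where t = "enc ys" and R = R] runs_ret[where xs = "code (enc y)" and J = "s 2"]]]]])
        (use s Cons in \<open>auto simp: sz_def fun_eq_iff\<close>)
  qed
qed (intro pbound_intros)

lemma fp_tl': "fp (tl :: 'a::enc list \<Rightarrow> 'a list)"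
proof (rule fpI[where c = "Branch 1 (dropt 1) (pushes [False])" and T = "\<lambda>n. 10 * n + 20"])
  fix x :: "'a list" and s :: store and R
  assume s: "s 1 = code (enc x) @ R"
  show "runs (Branch 1 (dropt 1) (pushes [False])) s (10 * sz x + 20) (s(1 := code (enc (tl x)) @ R))"
  proof (cases x)
    case Nil
    show ?thesis
      by (rule runs_weaken[OF runs_Branch_False[where xs = R, OF _ _ runs_pushes]])
        (use s Nil in \<open>auto simp: fun_eq_iff sz_def\<close>)
  next
    case (Cons y ys)
    show ?thesis
      by (rule runs_weaken[OF runs_Branch_True[where xs = "code (enc y) @ code (enc ys) @ R", OF _ _
          runs_dropt[where t = "enc y" and R = "code (enc ys) @ R"]]])
        (use s Cons in \<open>auto simp: sz_def fun_eq_iff\<close>)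
  qed
qed (intro pbound_intros)

text \<open>Unparking delivers the last bit first, which is the order in which a list is built from
  its end. Turning values into bit lists later reduces equality at every encoded type to equality of
  bit lists.\<close>

lemma fp_code: "fp (\<lambda>x :: 'a::enc. code (enc x))"
proof (rule fpI[where c = "mv 1 2 ;; Push 1 False ;;
      unpark 2 (pushes (True # code (enc True))) (pushes (True # code (enc False)))"
      and T = "\<lambda>n. 30 * n + 20"])
  fix x :: 'a and s :: store and R
  assume s: "s 1 = code (enc x) @ R"
  let ?c = "pushes (True # code (enc True))" and ?d = "pushes (True # code (enc False))"
  define S where "S ys zs = s(2 := zs, 1 := code (enc ys) @ R)" for ys :: "bool list" and zs
  have 1: "runs (unpark 2 ?c ?d) (S [] (parked (code (enc x)) (False # s 2)))
      ((4 + 6) * length (code (enc x)) + 2) (S (code (enc x)) (s 2))"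
  proof (rule runs_unpark)
    show "runs (if b then ?c else ?d) (S ys zs) 4 (S (b # ys) zs)" for b ys zs
      by (cases b) (auto simp: S_def enc_bool_def simp del: pushes.simps intro!: runs_weaken[OF runs_pushes])
  qed (auto simp: S_def)
  have 2: "runs (mv 1 2) s (10 * sz x + 5) (s(1 := R, 2 := parked (code (enc x)) (False # s 2)))"
    using runs_mv[of 1 2 s "enc x" R] s by (simp add: sz_def)
  have 3: "runs (Push 1 False) (s(1 := R, 2 := parked (code (enc x)) (False # s 2))) 1
      (S [] (parked (code (enc x)) (False # s 2)))"
    by (rule runs_weaken[OF runs_Push]) (auto simp: S_def fun_eq_iff)
  show "runs (mv 1 2 ;; Push 1 False ;; unpark 2 ?c ?d) s (30 * sz x + 20) (s(1 := code (enc (code (enc x))) @ R))"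
    by (rule runs_weaken[OF runs_Seq[OF 2 runs_Seq[OF 3 1]]]) (auto simp: S_def sz_def)
qed (intro pbound_intros)

text \<open>The list waits on stack 3 and the accumulator on stack 1. The node bits of the list
  drive the loop, and a \<open>True\<close> above head and accumulator makes them a pair.
  \<open>bound\<close> ranges over all prefixes because every intermediate accumulator is an
  argument of \<open>g\<close>.\<close>

lemma fp_fold':
  fixes g :: "'x::enc \<times> 'a::enc \<Rightarrow> 'a" and F :: "'e::enc \<Rightarrow> 'x list \<times> 'a"
  assumes "fp g" "fp F" "pbound B"
    and bound: "\<And>e ys zs. fst (F e) = ys @ zs \<Longrightarrow> sz (fold (\<lambda>x a. g (x, a)) ys (snd (F e))) \<le> B (sz e)"
  shows "fp (\<lambda>e. fold (\<lambda>x a. g (x, a)) (fst (F e)) (snd (F e)))"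
proof -
  obtain c k where c: "\<And>x s R. s 1 = code (enc x) @ R \<Longrightarrow>
     runs c s ((sz x + 2) ^ k) (s(1 := code (enc (g x)) @ R))"
    using assms(1) by (rule fpE) blast
  obtain d l where d: "\<And>x s R. s 1 = code (enc x) @ R \<Longrightarrow>
     runs d s ((sz x + 2) ^ l) (s(1 := code (enc (F x)) @ R))"
    using assms(2) by (rule fpE) blast
  obtain m where m: "\<And>x. sz (F x) \<le> (sz x + 2) ^ m"
    using assms(2) by (rule fp_size) blast
  let ?b = "transfer 3 1 ;; Push 1 True ;; c"
  let ?f = "\<lambda>x a. g (x, a)"
  have loop: "runs (Loop 3 ?b) s (length xs * (17 * X + 11 + (X + A + 3) ^ k) + 2)
      (s(3 := S, 1 := code (enc (fold ?f xs a)) @ R))"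
    if "s 3 = code (enc xs) @ S" "s 1 = code (enc a) @ R"
      "\<And>ys zs. xs = ys @ zs \<Longrightarrow> sz (fold ?f ys a) \<le> A" "\<And>x. x \<in> set xs \<Longrightarrow> sz x \<le> X"
    for s :: store and xs :: "'x list" and S a R X A
    using that
  proof (induction xs arbitrary: s a)
    case Nil
    show ?case
      by (rule runs_weaken[OF runs_Loop_end[where xs = S]]) (use Nil in \<open>auto simp: fun_eq_iff\<close>)
  next
    case (Cons x xs)
    let ?s = "s(3 := code (enc xs) @ S, 1 := code (enc (g (x, a))) @ R)"
    have sz: "sz x \<le> X" "sz a \<le> A"
      using Cons.prems(3)[of "[]"] Cons.prems(4) by auto
    have 1: "runs (Loop 3 ?b) ?s (length xs * (17 * X + 11 + (X + A + 3) ^ k) + 2)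
        (?s(3 := S, 1 := code (enc (fold ?f xs (g (x, a)))) @ R))"
    proof (rule Cons.IH)
      show "sz (fold ?f ys (g (x, a))) \<le> A" if "xs = ys @ zs" for ys zs
        using Cons.prems(3)[of "x # ys" zs] that by simp
    qed (use Cons.prems(4) in auto)
    let ?s1 = "s(3 := code (enc x) @ code (enc xs) @ S)"
    have 2: "runs (transfer 3 1) ?s1 (17 * sz x + 7) (s(3 := code (enc xs) @ S, 1 := code (enc x) @ code (enc a) @ R))"
      using runs_transfer[of 3 1 ?s1 "enc x" "code (enc xs) @ S"] Cons.prems(2) by (simp add: sz_def)
    have 3: "runs (Push 1 True) (s(3 := code (enc xs) @ S, 1 := code (enc x) @ code (enc a) @ R)) 1
        (s(3 := code (enc xs) @ S, 1 := code (enc (x, a)) @ R))"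
      by (rule runs_weaken[OF runs_Push]) auto
    have 4: "runs c (s(3 := code (enc xs) @ S, 1 := code (enc (x, a)) @ R)) ((sz (x, a) + 2) ^ k) ?s"
      using c[of "s(3 := code (enc xs) @ S, 1 := code (enc (x, a)) @ R)" "(x, a)" R] by simp
    have pw: "(sz (x, a) + 2) ^ k \<le> (X + A + 3) ^ k"
      using sz by (intro power_mono) auto
    have 5: "runs ?b ?s1 (17 * X + 8 + (X + A + 3) ^ k) ?s"
      by (rule runs_weaken[OF runs_Seq[OF 2 runs_Seq[OF 3 4]]]) (use sz pw in auto)
    show ?case
      by (rule runs_weaken[OF runs_Loop[OF _ _ 5 1]]) (use Cons.prems(1) in \<open>auto simp: fun_eq_iff\<close>)
  qed
  let ?M = "\<lambda>n. (n + 2) ^ m"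
  let ?T = "\<lambda>n. (n + 2) ^ l + (17 * ?M n + 10 + (?M n * (17 * ?M n + 11 + (?M n + B n + 3) ^ k) + 2))"
  let ?c = "d ;; Branch 1 (transfer 1 3 ;; Loop 3 ?b) Skip"
  show ?thesis
  proof (rule fpI[where c = ?c and T = ?T])
    fix e :: 'e and s :: store and R
    assume s: "s 1 = code (enc e) @ R"
    obtain xs a where F: "F e = (xs, a)" by (cases "F e")
    have le: "sz xs \<le> ?M (sz e)" "length xs \<le> ?M (sz e)"
      using m[of e] length_le_sz[of xs] by (auto simp: F)
    have 1: "runs d s ((sz e + 2) ^ l) (s(1 := code (enc (xs, a)) @ R))"
      using d[of s e R, OF s] F by simp
    let ?s1 = "s(1 := code (enc xs) @ code (enc a) @ R)"
    let ?s2 = "s(1 := code (enc a) @ R, 3 := code (enc xs) @ s 3)"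
    have 2: "runs (transfer 1 3) ?s1 (17 * sz xs + 7) ?s2"
      using runs_transfer[of 1 3 ?s1 "enc xs" "code (enc a) @ R"] by (simp add: sz_def)
    have 3: "runs (Loop 3 ?b) ?s2 (length xs * (17 * ?M (sz e) + 11 + (?M (sz e) + B (sz e) + 3) ^ k) + 2)
        (?s2(3 := s 3, 1 := code (enc (fold ?f xs a)) @ R))"
    proof (rule loop)
      show "sz (fold ?f ys a) \<le> B (sz e)" if "xs = ys @ zs" for ys zs
        using bound[of e ys zs] that by (simp add: F)
      show "sz x \<le> ?M (sz e)" if "x \<in> set xs" for x
        using sz_mem[OF that] le by simp
    qed auto
    have 4: "runs (Branch 1 (transfer 1 3 ;; Loop 3 ?b) Skip) (s(1 := code (enc (xs, a)) @ R))
        (17 * sz xs + 7 + (length xs * (17 * ?M (sz e) + 11 + (?M (sz e) + B (sz e) + 3) ^ k) + 2) + 3)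
        (?s2(3 := s 3, 1 := code (enc (fold ?f xs a)) @ R))"
      by (rule runs_Branch_True[where xs = "code (enc xs) @ code (enc a) @ R"])
        (use runs_Seq[OF 2 3] in auto)
    have "length xs * (17 * ?M (sz e) + 11 + (?M (sz e) + B (sz e) + 3) ^ k) \<le>
        ?M (sz e) * (17 * ?M (sz e) + 11 + (?M (sz e) + B (sz e) + 3) ^ k)"
      using le by (intro mult_right_mono) auto
    then show "runs ?c s (?T (sz e)) (s(1 := code (enc (fold ?f (fst (F e)) (snd (F e)))) @ R))"
      by (intro runs_weaken[OF runs_Seq[OF 1 4]]) (use le in \<open>auto simp: F fun_eq_iff intro!: add_mono mult_right_mono\<close>)
  qed (intro pbound_intros assms(3))
qed

subsection \<open>From encoded values to raw tapes\<close>

text \<open>Raw input has no end mark and an empty stack pops like \<open>False\<close>, so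
  \<open>Test\<close> puts the loop guard on stack 3 before each bit. The last input bit is on top,
  so the list is built from its end.\<close>

definition read_input :: com where
  "read_input = Push 1 False ;; Test 0 3 ;;
     Loop 3 (Branch 0 (pushes (True # code (enc True))) (pushes (True # code (enc False))) ;; Test 0 3)"

lemma runs_read_input: "runs read_input (input_store x) (20 * length x + 10) ((\<lambda>_. [])(1 := code (enc x)))"
proof -
  let ?b = "Branch 0 (pushes (True # code (enc True))) (pushes (True # code (enc False))) ;; Test 0 3"
  define S :: "bool list \<Rightarrow> bool list \<Rightarrow> bool list \<Rightarrow> store"
    where "S ys zs ws = (\<lambda>_. [])(0 := ys, 1 := code (enc zs), 3 := ws)" for ys zs ws
  have loop: "runs (Loop 3 ?b) (S ys zs [ys \<noteq> []]) (20 * length ys + 2) (S [] (rev ys @ zs) [])" for ys zs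
  proof (induction ys arbitrary: zs)
    case Nil
    show ?case
      by (rule runs_weaken[OF runs_Loop_end[where xs = "[]"]]) (auto simp: S_def fun_eq_iff)
  next
    case (Cons b ys)
    have 1: "runs (Branch 0 (pushes (True # code (enc True))) (pushes (True # code (enc False)))) (S (b # ys) zs []) 10
        (S ys (b # zs) [])"
    proof (cases b)
      case True
      then show ?thesis
        by (intro runs_weaken[OF runs_Branch_True[where xs = ys, OF _ _ runs_pushes]])
          (auto simp: S_def fun_eq_iff enc_bool_def)
    next
      case False
      then show ?thesis
        by (intro runs_weaken[OF runs_Branch_False[where xs = ys, OF _ _ runs_pushes]])
          (auto simp: S_def fun_eq_iff enc_bool_def)
    qed
    have 2: "runs (Test 0 3) (S ys (b # zs) []) 3 (S ys (b # zs) [ys \<noteq> []])"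
      by (rule runs_weaken[OF runs_Test]) (auto simp: S_def fun_eq_iff)
    have 3: "(S (b # ys) zs [b # ys \<noteq> []])(3 := []) = S (b # ys) zs []"
      by (auto simp: S_def)
    show ?case
      by (rule runs_weaken[OF runs_Loop[where xs = "[]", OF _ _ runs_Seq[OF 1[folded 3] 2] Cons]])
        (auto simp: S_def)
  qed
  have 1: "runs (Push 1 False) (input_store x) 1 (S (rev x) [] [])"
    by (rule runs_weaken[OF runs_Push]) (auto simp: S_def input_store_def fun_eq_iff)
  have 2: "runs (Test 0 3) (S (rev x) [] []) 3 (S (rev x) [] [rev x \<noteq> []])"
    by (rule runs_weaken[OF runs_Test]) (auto simp: S_def fun_eq_iff)
  show ?thesis unfolding read_input_def
    by (rule runs_weaken[OF runs_Seq[OF 1 runs_Seq[OF 2 loop]]]) (auto simp: S_def fun_eq_iff)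
qed

definition write_output :: com where
  "write_output = Loop 1 (Branch 1 (dropt 1 ;; dropt 1 ;; Push 5 True) (Push 5 False))"

lemma runs_write_output:
  "s 1 = code (enc y) @ R \<Longrightarrow> runs write_output s (50 * length y + 2) (s(1 := R, 5 := rev y @ s 5))"
proof (induction y arbitrary: s)
  case Nil
  show ?case unfolding write_output_def
    by (rule runs_weaken[OF runs_Loop_end[where xs = R]]) (use Nil in \<open>auto simp: fun_eq_iff\<close>)
next
  case (Cons b y)
  let ?R = "code (enc y) @ R"
  let ?s = "s(1 := ?R, 5 := b # s 5)"
  have 1: "runs (Branch 1 (dropt 1 ;; dropt 1 ;; Push 5 True) (Push 5 False)) (s(1 := code (enc b) @ ?R)) 40 ?s"
  proof (cases b)
    case True
    show ?thesis
      by (rule runs_weaken[OF runs_Branch_True[where xs = "False # False # ?R", OF _ _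
            runs_Seq[OF runs_dropt[where t = Lf and R = "False # ?R"] runs_Seq[OF
              runs_dropt[where t = Lf and R = ?R] runs_Push]]]])
        (use True in \<open>auto simp: enc_bool_def\<close>)
  next
    case False
    show ?thesis
      by (rule runs_weaken[OF runs_Branch_False[where xs = ?R, OF _ _ runs_Push]])
        (use False in \<open>auto simp: enc_bool_def\<close>)
  qed
  have 2: "runs write_output ?s (50 * length y + 2) (?s(1 := R, 5 := rev y @ ?s 5))"
    by (rule Cons.IH) simp
  show ?case unfolding write_output_def
    by (rule runs_weaken[OF runs_Loop[OF _ _ 1 2[unfolded write_output_def]]])
      (use Cons.prems in \<open>auto simp: fun_eq_iff\<close>)
qed

lemma poly_linear_power: "poly ([:2, 1:] ^ k) n = (n + 2 :: nat) ^ k"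
  by (simp add: poly_power add.commute)

lemma pbound_polyE:
  assumes "pbound T"
  obtains p :: "nat poly" where "\<And>n. T n \<le> poly p n"
  using assms unfolding pbound_def poly_linear_power[symmetric] by blast

lemma polytime_fp:
  assumes "fp f"
  shows "polytime f"
proof -
  obtain c k where c: "\<And>x s R. s 1 = code (enc x) @ R \<Longrightarrow>
     runs c s ((sz x + 2) ^ k) (s(1 := code (enc (f x)) @ R))"
    using assms by (rule fpE) blast
  obtain m where m: "\<And>x. sz (f x) \<le> (sz x + 2) ^ m"
    using assms by (rule fp_size) blast
  let ?T = "\<lambda>n. 20 * n + 10 + ((4 * n + 3) ^ k + (50 * (4 * n + 3) ^ m + 2))"
  have "pbound ?T" by (intro pbound_intros)
  then obtain p :: "nat poly" where p: "\<And>n. ?T n \<le> poly p n"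
    by (rule pbound_polyE) blast
  show ?thesis
  proof (rule polytimeI[where c = "read_input ;; c ;; write_output" and p = p])
    fix x :: "bool list"
    let ?s = "(\<lambda>_. [])(1 := code (enc x)) :: store"
    have 1: "runs c ?s ((sz x + 2) ^ k) (?s(1 := code (enc (f x))))"
      using c[of ?s x "[]"] by simp
    have 2: "runs write_output (?s(1 := code (enc (f x)))) (50 * length (f x) + 2) (?s(1 := [], 5 := rev (f x)))"
      using runs_write_output[of "?s(1 := code (enc (f x)))" "f x" "[]"] by simp
    have "(sz x + 2) ^ k \<le> (4 * length x + 3) ^ k" "(sz x + 2) ^ m \<le> (4 * length x + 3) ^ m"
      using sz_bools[of x] by (auto intro!: power_mono)
    then have "runs (read_input ;; c ;; write_output) (input_store x) (poly p (length x)) (?s(1 := [], 5 := rev (f x)))"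
      by (intro runs_mono[OF runs_Seq[OF runs_read_input runs_Seq[OF 1 2]]] order_trans[OF _ p])
        (use m[of x] length_le_sz[of "f x"] in linarith)
    then show "\<exists>s. runs (read_input ;; c ;; write_output) (input_store x) (poly p (length x)) s \<and> s 5 = rev (f x)"
      by (intro exI[of _ "?s(1 := [], 5 := rev (f x))"]) auto
  qed
qed

subsection \<open>A library of polynomial-time functions\<close>

lemma fp_cong: "fp f \<Longrightarrow> (\<And>e. f e = g e) \<Longrightarrow> fp g"
  by (metis ext)

lemma fp_enc_cong: "fp f \<Longrightarrow> (\<And>e. enc (g e) = enc (f e)) \<Longrightarrow> fp g"
  unfolding fp_def by simp

lemma fp_comp2:
  assumes "fp (\<lambda>p. h (fst p) (snd p))" "fp f" "fp g"
  shows "fp (\<lambda>e. h (f e) (g e))"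
  using fp_comp[OF assms(1) fp_pair[OF assms(2,3)]] by simp

text \<open>The environment \<open>e\<close> travels as a component of the accumulator, so the step
  function may depend on it.\<close>

lemma fp_fold:
  fixes f :: "'e::enc \<Rightarrow> 'x::enc \<Rightarrow> 'a::enc \<Rightarrow> 'a"
  assumes "fp xs" "fp a" "fp (\<lambda>p. f (fst p) (fst (snd p)) (snd (snd p)))" "pbound B"
    and bound: "\<And>e ys zs. xs e = ys @ zs \<Longrightarrow> sz (fold (f e) ys (a e)) \<le> B (sz e)"
  shows "fp (\<lambda>e. fold (f e) (xs e) (a e))"
proof -
  define g where "g = (\<lambda>p :: 'x \<times> 'e \<times> 'a. (fst (snd p), f (fst (snd p)) (fst p) (snd (snd p))))"
  define F where "F = (\<lambda>e. (xs e, (e, a e)))"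
  have fold: "fold (\<lambda>x p. g (x, p)) ys (e, b) = (e, fold (f e) ys b)" for ys e b
    by (induction ys arbitrary: b) (auto simp: g_def)
  have "fp (\<lambda>p :: 'x \<times> 'e \<times> 'a. (fst (snd p), fst p, snd (snd p)))"
    by (intro fp_pair fp_fst fp_snd fp_id)
  from fp_comp[OF assms(3) this] have g: "fp g"
    unfolding g_def by (intro fp_pair fp_fst fp_snd fp_id) simp
  have F: "fp F"
    unfolding F_def by (intro fp_pair fp_id assms)
  have "fp (\<lambda>e. fold (\<lambda>x p. g (x, p)) (fst (F e)) (snd (F e)))"
  proof (rule fp_fold'[OF g F])
    show "pbound (\<lambda>n. n + B n + 1)"
      by (intro pbound_intros assms(4))
    show "sz (fold (\<lambda>x p. g (x, p)) ys (snd (F e))) \<le> sz e + B (sz e) + 1"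
      if "fst (F e) = ys @ zs" for e ys zs
      using bound[of e ys zs] that by (simp add: F_def fold)
  qed
  then show ?thesis
    using fp_snd by (fastforce simp: F_def fold)
qed

lemma fp_not: "fp b \<Longrightarrow> fp (\<lambda>e. \<not> b e)"
  by (rule fp_cong[OF fp_if[OF _ fp_const fp_const, of b False True]]) auto

lemma fp_conj: "fp b \<Longrightarrow> fp c \<Longrightarrow> fp (\<lambda>e. b e \<and> c e)"
  by (rule fp_cong[OF fp_if[OF _ _ fp_const, of b c False]]) auto

lemma fp_disj: "fp b \<Longrightarrow> fp c \<Longrightarrow> fp (\<lambda>e. b e \<or> c e)"
  using fp_not[OF fp_conj[OF fp_not fp_not, of b c]] by simp

lemma fp_imp: "fp b \<Longrightarrow> fp c \<Longrightarrow> fp (\<lambda>e. b e \<longrightarrow> c e)"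
  by (rule fp_cong[OF fp_disj[OF fp_not, of b c]]) auto

lemma fp_null: "fp xs \<Longrightarrow> fp (\<lambda>e. xs e = [])"
  by (rule fp_comp[OF fp_null'])

lemma fp_hd: "fp xs \<Longrightarrow> fp (\<lambda>e. hd (xs e))"
  by (rule fp_comp[OF fp_hd'])

lemma fp_tl: "fp xs \<Longrightarrow> fp (\<lambda>e. tl (xs e))"
  by (rule fp_comp[OF fp_tl'])

lemma fp_Cons: "fp x \<Longrightarrow> fp xs \<Longrightarrow> fp (\<lambda>e. x e # xs e)"
  by (rule fp_comp2[of Cons]) (auto intro: fp_coerce)

lemma sz_rev: "sz (rev xs) = sz xs"
proof (induction xs)
  case (Cons x xs)
  have "sz (rev xs @ [x]) + 1 = sz (rev xs) + sz [x]" by (rule sz_append)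
  then show ?case using Cons by simp
qed simp

lemma fp_rev:
  assumes "fp xs"
  shows "fp (\<lambda>e. rev (xs e))"
proof -
  obtain k where k: "\<And>e. sz (xs e) \<le> (sz e + 2) ^ k"
    using fp_size[OF assms] by blast
  have "fp (\<lambda>e. fold (\<lambda>x a. x # a) (xs e) [])"
  proof (rule fp_fold[where B = "\<lambda>n. (n + 2) ^ k"])
    show "sz (fold (\<lambda>x a. x # a) ys []) \<le> (sz e + 2) ^ k" if "xs e = ys @ zs" for e ys zs
    proof -
      have "sz (ys @ zs) + 1 = sz ys + sz zs" by (rule sz_append)
      then have "sz (fold (\<lambda>x a. x # a) ys []) \<le> sz (xs e)"
        using that sz_pos[of zs] by (simp add: rev_conv_fold[symmetric] sz_rev)
      with k show ?thesis by (meson le_trans)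
    qed
  qed (intro assms fp_const fp_Cons fp_fst fp_snd fp_id pbound_intros)+
  then show ?thesis by (simp add: rev_conv_fold)
qed

lemma sz_prefix: "sz ys \<le> sz (ys @ zs)" "sz zs \<le> sz (ys @ zs)"
  using sz_append[of ys zs] sz_pos[of zs] sz_pos[of ys] by auto

lemma fp_append:
  fixes xs :: "'e::enc \<Rightarrow> 'x::enc list"
  assumes "fp xs" "fp ys"
  shows "fp (\<lambda>e. xs e @ ys e)"
proof -
  obtain k where k: "\<And>e. sz (xs e) \<le> (sz e + 2) ^ k"
    using fp_size[OF assms(1)] by blast
  obtain l where l: "\<And>e. sz (ys e) \<le> (sz e + 2) ^ l"
    using fp_size[OF assms(2)] by blast
  have "fp (\<lambda>e. fold (\<lambda>x a. x # a) (rev (xs e)) (ys e))"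
  proof (rule fp_fold[where B = "\<lambda>n. (n + 2) ^ k + (n + 2) ^ l"])
    show "sz (fold (\<lambda>x a. x # a) us (ys e)) \<le> (sz e + 2) ^ k + (sz e + 2) ^ l"
      if "rev (xs e) = us @ vs" for e us vs
    proof -
      have "fold (\<lambda>x a. x # a) us (ys e) = rev us @ ys e"
        by (induction us arbitrary: ys) auto
      moreover have "sz (rev us @ ys e) + 1 = sz us + sz (ys e)"
        using sz_append[of "rev us" "ys e"] by (simp add: sz_rev)
      moreover have "sz us \<le> sz (xs e)"
        using sz_prefix(1)[of us vs] that sz_rev by metis
      ultimately show ?thesis using k[of e] l[of e] by simp
    qed
  qed (intro assms fp_const fp_Cons fp_fst fp_snd fp_id fp_rev pbound_intros)+
  moreover have "fold (\<lambda>x a. x # a) (rev us) vs = us @ vs" for us vs :: "'x list"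
    by (induction us arbitrary: vs rule: rev_induct) auto
  ultimately show ?thesis by simp
qed

lemma fp_map:
  fixes g :: "'e::enc \<Rightarrow> 'x::enc \<Rightarrow> 'y::enc"
  assumes "fp xs" "fp (\<lambda>p. g (fst p) (snd p))"
  shows "fp (\<lambda>e. map (\<lambda>x. g e x) (xs e))"
proof -
  obtain k where k: "\<And>e. sz (xs e) \<le> (sz e + 2) ^ k"
    using fp_size[OF assms(1)] by blast
  obtain l where "\<And>p. sz (g (fst p) (snd p)) \<le> (sz p + 2) ^ l"
    using fp_size[OF assms(2)] by blast
  from this[of "(_, _)"] have l: "sz (g e x) \<le> (sz e + sz x + 3) ^ l" for e x
    by (simp add: numeral_3_eq_3)
  let ?M = "\<lambda>n. (n + (n + 2) ^ k + 3) ^ l"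
  have "fp (\<lambda>e. fold (\<lambda>x a. g e x # a) (xs e) [])"
  proof (rule fp_fold[where B = "\<lambda>n. (n + 2) ^ k * (?M n + 1) + 1"])
    show "sz (fold (\<lambda>x a. g e x # a) ys []) \<le> (sz e + 2) ^ k * (?M (sz e) + 1) + 1"
      if "xs e = ys @ zs" for e ys zs
    proof -
      have *: "fold (\<lambda>x a. g e x # a) us vs = rev (map (g e) us) @ vs" for us vs
        by (induction us arbitrary: vs) auto
      have "sz x \<le> (sz e + 2) ^ k" if "x \<in> set (xs e)" for x
        using sz_mem[OF that] k[of e] by simp
      then have "sz (g e x) \<le> ?M (sz e)" if "x \<in> set (xs e)" for x
        by (intro order_trans[OF l] power_mono) (use that in auto)
      then have "sz (map (g e) ys) \<le> length ys * (?M (sz e) + 1) + 1"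
        using sz_list_bound[of "map (g e) ys" "?M (sz e)"] that by auto
      also have "\<dots> \<le> (sz e + 2) ^ k * (?M (sz e) + 1) + 1"
        using length_le_sz[of "xs e"] k[of e] that by (intro add_mono mult_right_mono) auto
      finally show ?thesis by (simp add: * sz_rev)
    qed
    have "fp (\<lambda>p :: 'e \<times> 'x \<times> 'y list. (fst p, fst (snd p)))"
      by (intro fp_pair fp_fst fp_snd fp_id)
    from fp_comp[OF assms(2) this]
    show "fp (\<lambda>p. g (fst p) (fst (snd p)) # snd (snd p))"
      by (intro fp_Cons fp_snd fp_id) simp
  qed (intro assms fp_const pbound_intros)+
  then have "fp (\<lambda>e. rev (fold (\<lambda>x a. g e x # a) (xs e) []))"
    by (rule fp_rev)
  moreover have "fold (\<lambda>x a. g e x # a) us vs = rev (map (g e) us) @ vs" for us vs e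
    by (induction us arbitrary: vs) auto
  ultimately show ?thesis by simp
qed

lemma fp_filter:
  fixes P :: "'e::enc \<Rightarrow> 'x::enc \<Rightarrow> bool"
  assumes "fp xs" "fp (\<lambda>p. P (fst p) (snd p))"
  shows "fp (\<lambda>e. filter (\<lambda>x. P e x) (xs e))"
proof -
  obtain k where k: "\<And>e. sz (xs e) \<le> (sz e + 2) ^ k"
    using fp_size[OF assms(1)] by blast
  have *: "fold (\<lambda>x a. if P e x then x # a else a) us vs = rev (filter (P e) us) @ vs" for us vs e
    by (induction us arbitrary: vs) auto
  have szf: "sz (filter Q us) \<le> sz us" for Q and us :: "'x list"
    by (induction us) auto
  have "fp (\<lambda>e. fold (\<lambda>x a. if P e x then x # a else a) (xs e) [])"
  proof (rule fp_fold[where B = "\<lambda>n. (n + 2) ^ k"])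
    show "sz (fold (\<lambda>x a. if P e x then x # a else a) ys []) \<le> (sz e + 2) ^ k"
      if "xs e = ys @ zs" for e ys zs
      using szf[of "P e" ys] sz_prefix(1)[of ys zs] k[of e] that by (simp add: * sz_rev)
    have "fp (\<lambda>p :: 'e \<times> 'x \<times> 'x list. (fst p, fst (snd p)))"
      by (intro fp_pair fp_fst fp_snd fp_id)
    from fp_comp[OF assms(2) this]
    show "fp (\<lambda>p. if P (fst p) (fst (snd p)) then fst (snd p) # snd (snd p) else snd (snd p))"
      by (intro fp_if fp_Cons fp_fst fp_snd fp_id) simp
  qed (intro assms fp_const pbound_intros)+
  from fp_rev[OF this] show ?thesis by (simp add: *)
qed

lemma fp_concat:
  assumes "fp (xss :: 'e::enc \<Rightarrow> 'x::enc list list)"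
  shows "fp (\<lambda>e. concat (xss e))"
proof -
  obtain k where k: "\<And>e. sz (xss e) \<le> (sz e + 2) ^ k"
    using fp_size[OF assms(1)] by blast
  have *: "fold (\<lambda>x a. a @ x) us vs = vs @ concat us" for us and vs :: "'x list"
    by (induction us arbitrary: vs) auto
  have szc: "sz (concat us) \<le> sz us" for us :: "'x list list"
  proof (induction us)
    case (Cons u us)
    then show ?case using sz_append[of u "concat us"] by simp
  qed simp
  have "fp (\<lambda>e. fold (\<lambda>x a. a @ x) (xss e) [])"
  proof (rule fp_fold[where B = "\<lambda>n. (n + 2) ^ k"])
    show "sz (fold (\<lambda>x a. a @ x) ys []) \<le> (sz e + 2) ^ k" if "xss e = ys @ zs" for e ys zs
      using szc[of ys] sz_prefix(1)[of ys zs] k[of e] that by (simp add: *)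
  qed (intro assms fp_const fp_append fp_fst fp_snd fp_id pbound_intros)+
  then show ?thesis by (simp add: *)
qed

lemma fp_Ball:
  assumes "fp xs" "fp (\<lambda>p. P (fst p) (snd p))"
  shows "fp (\<lambda>e. \<forall>x \<in> set (xs e). P e x)"
proof -
  have "fp (\<lambda>e. filter (\<lambda>x. \<not> P e x) (xs e) = [])"
    by (intro fp_null fp_filter fp_not assms)
  then show ?thesis by (simp add: filter_empty_conv)
qed

lemma fp_Bex:
  assumes "fp xs" "fp (\<lambda>p. P (fst p) (snd p))"
  shows "fp (\<lambda>e. \<exists>x \<in> set (xs e). P e x)"
proof -
  have "fp (\<lambda>e. \<not> (\<forall>x \<in> set (xs e). \<not> P e x))"
    by (intro fp_Ball fp_not assms)
  then show ?thesis by simp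
qed

text \<open>A number and the list of that many units have equal trees; arithmetic thereby reduces to
  list operations.\<close>

lemma fp_units: "fp n \<Longrightarrow> fp (\<lambda>e. replicate (n e) ())"
proof (erule fp_comp[rotated], rule fp_coerce)
  show "enc (replicate m ()) = enc m" for m
    by (induction m) (auto simp: enc_unit_def)
qed

lemma fp_length:
  assumes "fp (xs :: 'e::enc \<Rightarrow> 'x::enc list)"
  shows "fp (\<lambda>e. length (xs e))"
proof -
  have "fp (length :: unit list \<Rightarrow> nat)"
  proof (rule fp_coerce)
    show "enc (length us) = enc us" for us :: "unit list"
      by (induction us) (auto simp: enc_unit_def)
  qed
  from fp_comp[OF this fp_map[OF assms fp_const[of "()"]]] show ?thesis by simp
qed

lemma fp_Suc: "fp n \<Longrightarrow> fp (\<lambda>e. Suc (n e))"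
  using fp_length[OF fp_Cons[OF fp_const[of "()"] fp_units]] by fastforce

lemma fp_add: "fp m \<Longrightarrow> fp n \<Longrightarrow> fp (\<lambda>e. m e + (n e :: nat))"
  using fp_length[OF fp_append[OF fp_units fp_units]] by fastforce

lemma fp_replicate: "fp n \<Longrightarrow> fp x \<Longrightarrow> fp (\<lambda>e. replicate (n e) (x e))"
  using fp_map[OF fp_units, of n "\<lambda>e _. x e"] fp_comp[OF _ fp_fst[OF fp_id], of x]
  by (simp add: map_replicate_const)

lemma fp_mult:
  assumes "fp m" "fp n"
  shows "fp (\<lambda>e. m e * (n e :: nat))"
proof -
  have "fp (\<lambda>e. length (concat (replicate (m e) (replicate (n e) ()))))"
    by (intro fp_length fp_concat fp_replicate fp_units fp_const assms)
  then show ?thesis by (simp add: length_concat sum_list_replicate)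
qed

lemma fp_drop:
  fixes xs :: "'e::enc \<Rightarrow> 'x::enc list"
  assumes "fp n" "fp xs"
  shows "fp (\<lambda>e. drop (n e) (xs e))"
proof -
  obtain k where k: "\<And>e. sz (xs e) \<le> (sz e + 2) ^ k"
    using fp_size[OF assms(2)] by blast
  have *: "fold (\<lambda>_. tl) us vs = drop (length us) vs" for us :: "unit list" and vs :: "'x list"
    by (induction us arbitrary: vs) (auto simp: drop_Suc)
  have "fp (\<lambda>e. fold (\<lambda>_. tl) (replicate (n e) ()) (xs e))"
  proof (rule fp_fold[where B = "\<lambda>n. (n + 2) ^ k"])
    show "sz (fold (\<lambda>_. tl) ys (xs e)) \<le> (sz e + 2) ^ k" for e and ys :: "unit list"
      using sz_prefix(2)[of "drop (length ys) (xs e)" "take (length ys) (xs e)"] k[of e]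
      by (simp add: *)
  qed (intro assms fp_units fp_tl fp_snd fp_id pbound_intros)+
  then show ?thesis by (rule fp_cong) (simp only: * length_replicate)
qed

lemma fp_diff: "fp m \<Longrightarrow> fp n \<Longrightarrow> fp (\<lambda>e. m e - (n e :: nat))"
  using fp_length[OF fp_drop[OF _ fp_units], of n m] by simp

lemma fp_take:
  assumes "fp n" "fp xs"
  shows "fp (\<lambda>e. take (n e) (xs e))"
proof -
  have "fp (\<lambda>e. rev (drop (length (xs e) - n e) (rev (xs e))))"
    by (intro fp_rev fp_drop fp_diff fp_length assms)
  then show ?thesis
  proof (rule fp_cong)
    show "rev (drop (length (xs e) - n e) (rev (xs e))) = take (n e) (xs e)" for e
      by (cases "n e \<le> length (xs e)") (auto simp: rev_drop)
  qed
qed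

lemma fp_le: "fp m \<Longrightarrow> fp n \<Longrightarrow> fp (\<lambda>e. m e \<le> (n e :: nat))"
  using fp_null[OF fp_units[OF fp_diff[of m n]]] by simp

lemma fp_less: "fp m \<Longrightarrow> fp n \<Longrightarrow> fp (\<lambda>e. m e < (n e :: nat))"
  using fp_le[OF fp_Suc, of m n] by (simp add: Suc_le_eq)

lemma fp_upt:
  assumes "fp m" "fp n"
  shows "fp (\<lambda>e. [m e..<n e])"
proof -
  obtain k where k: "\<And>e. sz (n e) \<le> (sz e + 2) ^ k"
    using fp_size[OF assms(2)] by blast
  let ?f = "\<lambda>_ a. a @ [length a]"
  have *: "fold ?f us [] = [0..<length us]" for us :: "unit list"
    by (induction us rule: rev_induct) auto
  have "fp (\<lambda>e. fold ?f (replicate (n e) ()) [])"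
  proof (rule fp_fold[where B = "\<lambda>n. (n + 2) ^ k * (2 * (n + 2) ^ k + 1 + 1) + 1"])
    show "sz (fold ?f ys []) \<le> (sz e + 2) ^ k * (2 * (sz e + 2) ^ k + 1 + 1) + 1"
      if "replicate (n e) () = ys @ zs" for e ys zs
    proof -
      have le: "length ys \<le> (sz e + 2) ^ k"
        using arg_cong[OF that, of length] k[of e] by (simp add: sz_nat)
      have "sz [0..<length ys] \<le> length ys * (2 * (sz e + 2) ^ k + 1 + 1) + 1"
        using sz_list_bound[of "[0..<length ys]" "2 * (sz e + 2) ^ k + 1"] le by (auto simp: sz_nat)
      also have "\<dots> \<le> (sz e + 2) ^ k * (2 * (sz e + 2) ^ k + 1 + 1) + 1"
        using le by (intro add_mono mult_right_mono) auto
      finally show ?thesis by (simp add: *)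
    qed
  qed (intro assms fp_units fp_const fp_append fp_Cons fp_length fp_snd fp_id pbound_intros)+
  from fp_drop[OF assms(1) this] show ?thesis
    by (rule fp_cong) (simp only: * length_replicate drop_upt add_0)
qed

text \<open>The accumulator consists of a flag and the unread rest of the second list; a mismatch
  clears both for good.\<close>

lemma fp_eq_bools:
  assumes "fp xs" "fp ys"
  shows "fp (\<lambda>e. xs e = (ys e :: bool list))"
proof -
  let ?f = "\<lambda>b a. if fst a \<and> snd a \<noteq> [] \<and> (if b then hd (snd a) else \<not> hd (snd a))
    then (True, tl (snd a)) else (False, [])"
  obtain k where k: "\<And>e. sz (ys e) \<le> (sz e + 2) ^ k"
    using fp_size[OF assms(2)] by blast
  have F: "fold ?f us (False, vs) = (False, if us = [] then vs else [])" for us vs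
    by (induction us arbitrary: vs) auto
  have eq: "fst (fold ?f us (True, vs)) \<and> snd (fold ?f us (True, vs)) = [] \<longleftrightarrow> us = vs" for us vs
  proof (induction us arbitrary: vs)
    case (Cons u us)
    then show ?case by (cases vs) (auto simp: F)
  qed auto
  have sz: "sz (fold ?f us (True, vs)) \<le> sz vs + 4" for us vs
  proof (induction us arbitrary: vs)
    case (Cons u us)
    have "sz (tl vs) \<le> sz vs" by (cases vs) auto
    then show ?case using Cons[of "tl vs"] by (auto simp: F)
  qed auto
  have "fp (\<lambda>e. fold ?f (xs e) (True, ys e))"
  proof (rule fp_fold[where B = "\<lambda>n. (n + 2) ^ k + 4"])
    show "sz (fold ?f us (True, ys e)) \<le> (sz e + 2) ^ k + 4" for e us
      using sz[of us "ys e"] k[of e] by linarith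
  qed (intro assms fp_pair fp_const fp_if fp_conj fp_not fp_null fp_hd fp_tl fp_fst fp_snd fp_id pbound_intros)+
  then have "fp (\<lambda>e. fst (fold ?f (xs e) (True, ys e)) \<and> snd (fold ?f (xs e) (True, ys e)) = [])"
    by (intro fp_conj fp_null fp_fst fp_snd)
  then show ?thesis by (simp add: eq)
qed

lemma fp_eq: "fp f \<Longrightarrow> fp g \<Longrightarrow> fp (\<lambda>e. f e = g e)"
  using fp_eq_bools[OF fp_comp[OF fp_code] fp_comp[OF fp_code], of f g] by (simp add: code_inject enc_inject)

lemma fp_member:
  assumes "fp x" "fp xs"
  shows "fp (\<lambda>e. x e \<in> set (xs e))"
proof -
  have "fp (\<lambda>e. \<exists>y \<in> set (xs e). y = x e)"
    by (intro fp_Bex fp_eq assms fp_comp[OF assms(1)] fp_fst fp_snd fp_id)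
  then show ?thesis by simp
qed

text \<open>The quotient by a constant is the number of positive multiples of \<open>c\<close> up to
  the dividend.\<close>

lemma fp_div:
  assumes "fp m" "c > 0"
  shows "fp (\<lambda>e. m e div (c :: nat))"
proof -
  have "fp (\<lambda>e. length (filter (\<lambda>k. Suc k * c \<le> m e) [0..<m e]))"
    by (intro fp_length fp_filter fp_upt fp_le fp_mult fp_Suc fp_const fp_comp[OF assms(1)] assms
        fp_fst fp_snd fp_id)
  moreover have "length (filter (\<lambda>k. Suc k * c \<le> n) [0..<n]) = n div c" for n
  proof -
    have *: "Suc k * c \<le> n \<longleftrightarrow> k < n div c" for k
      using assms(2) by (metis Suc_le_eq less_eq_div_iff_mult_less_eq)
    have "length (filter (\<lambda>k. Suc k * c \<le> n) [0..<n]) = card {k. k < n \<and> k < n div c}"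
      unfolding length_filter_conv_card *
      by (rule arg_cong[of _ _ card]) (auto intro: less_le_trans[OF _ div_le_dividend[of n c]])
    also have "{k. k < n \<and> k < n div c} = {..<n div c}"
      by (auto intro: less_le_trans[OF _ div_le_dividend[of n c]])
    finally show ?thesis by simp
  qed
  ultimately show ?thesis by simp
qed

lemma fp_mod:
  assumes "fp m" "c > 0"
  shows "fp (\<lambda>e. m e mod (c :: nat))"
proof -
  have "fp (\<lambda>e. m e - m e div c * c)"
    by (intro fp_diff fp_mult fp_div assms fp_const)
  then show ?thesis by (simp add: minus_div_mult_eq_mod)
qed

lemma fp_poly: "fp n \<Longrightarrow> fp (\<lambda>e. poly (p :: nat poly) (n e))"
  by (induction p) (auto intro!: fp_const fp_add fp_mult)

definition dedup :: "'a list \<Rightarrow> 'a list" where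
  "dedup xs = fold (\<lambda>x a. if x \<in> set a then a else x # a) xs []"

lemma dedup: "set (dedup xs) = set xs" "distinct (dedup xs)"
proof -
  have "set (fold (\<lambda>x a. if x \<in> set a then a else x # a) xs ys) = set xs \<union> set ys \<and>
      (distinct ys \<longrightarrow> distinct (fold (\<lambda>x a. if x \<in> set a then a else x # a) xs ys))" for ys :: "'a list"
    by (induction xs arbitrary: ys) auto
  from this[of "[]"] show "set (dedup xs) = set xs" "distinct (dedup xs)"
    by (simp_all add: dedup_def)
qed

lemma fp_dedup:
  fixes xs :: "'e::enc \<Rightarrow> 'x::enc list"
  assumes "fp xs"
  shows "fp (\<lambda>e. dedup (xs e))"
  unfolding dedup_def
proof -
  obtain k where k: "\<And>e. sz (xs e) \<le> (sz e + 2) ^ k"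
    using fp_size[OF assms] by blast
  let ?f = "\<lambda>x a. if x \<in> set a then a else x # a"
  have sz: "sz (fold ?f us vs) + 1 \<le> sz us + sz vs" for us vs :: "'x list"
  proof (induction us arbitrary: vs)
    case (Cons u us)
    show ?case using Cons.IH[of vs] Cons.IH[of "u # vs"] by (cases "u \<in> set vs") simp_all
  qed simp
  show "fp (\<lambda>e. fold ?f (xs e) [])"
  proof (rule fp_fold[where B = "\<lambda>n. (n + 2) ^ k"])
    show "sz (fold ?f ys []) \<le> (sz e + 2) ^ k" if "xs e = ys @ zs" for e ys zs
      using sz[of ys "[]"] sz_prefix(1)[of ys zs] k[of e] that by simp
  qed (intro assms fp_if fp_member fp_Cons fp_const fp_fst fp_snd fp_id pbound_intros)+
qed

lemmas fp_intros = fp_id fp_const fp_pair fp_fst fp_snd fp_if fp_not fp_conj fp_disj fp_imp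
  fp_null fp_hd fp_tl fp_Cons fp_rev fp_append fp_map fp_filter fp_concat fp_Ball fp_Bex
  fp_length fp_Suc fp_add fp_mult fp_diff fp_replicate fp_drop fp_take fp_le fp_less fp_upt
  fp_member fp_eq fp_dedup fp_poly

section \<open>Labelings by maximum from three labels\<close>

lemma max_color_eqI:
  assumes "simple_graph G" "w \<in> neighbors G v" "f w = m" "\<And>u. u \<in> neighbors G v \<Longrightarrow> f u \<le> m"
  shows "max_color G f v = m"
proof -
  have "finite (neighbors G v)"
    by (rule finite_subset[of _ "verts G"]) (use assms(1) in \<open>auto simp: neighbors_def simple_graph_def\<close>)
  then show ?thesis
    unfolding max_color_def using assms by (intro Max_eqI) auto
qed

text \<open>
  Label 3 goes to the vertices all of whose neighbours are in \<open>Z\<close>; a 2-colouring of the complement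
  with as few vertices of colour 2 as possible determines the other labels.
\<close>

lemma labeling3I:
  fixes G :: "'a graph"
  assumes G: "simple_graph G"
    and ind: "\<And>u v. adj G u v \<Longrightarrow> u \<in> Z \<Longrightarrow> v \<notin> Z"
    and wit: "\<And>z. z \<in> Z \<Longrightarrow> \<exists>w. adj G w z \<and> neighbors G w \<subseteq> Z"
    and col: "\<And>u v. adj G u v \<Longrightarrow> u \<notin> Z \<Longrightarrow> v \<notin> Z \<Longrightarrow> col u \<noteq> (col v :: bool)"
  shows "\<exists>f. labeling_by_max 3 G f"
proof -
  let ?P = "\<lambda>d :: 'a \<Rightarrow> bool. \<forall>u v. adj G u v \<longrightarrow> u \<notin> Z \<longrightarrow> v \<notin> Z \<longrightarrow> d u \<noteq> d v"
  obtain d where d: "?P d" and min: "\<And>e. ?P e \<Longrightarrow> card {v \<in> verts G. \<not> d v} \<le> card {v \<in> verts G. \<not> e v}"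
    using ex_has_least_nat[of ?P col "\<lambda>d. card {v \<in> verts G. \<not> d v}"] col by blast
  have fin: "finite (verts G)" and sym: "adj G u v \<Longrightarrow> adj G v u" for u v
    using G by (auto simp: simple_graph_def)
  have in_verts: "adj G u v \<Longrightarrow> u \<in> verts G \<and> v \<in> verts G" for u v
    using G by (auto simp: simple_graph_def)
  \<comment> \<open>If such a \<open>v\<close> saw no vertex with \<open>d\<close> outside
    \<open>Z\<close>, it could be switched to \<open>d\<close>, against minimality. So every vertex
    meant for colour 2 has a neighbour that can carry label 2.\<close>
  have nbr: "\<exists>u. adj G u v \<and> u \<notin> Z \<and> d u" if v: "v \<in> verts G" "v \<notin> Z" "\<not> d v" for v
  proof (rule ccontr)
    assume no: "\<not> (\<exists>u. adj G u v \<and> u \<notin> Z \<and> d u)"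
    then have no': "\<forall>u. adj G v u \<longrightarrow> u \<in> Z \<or> \<not> d u"
      using sym by blast
    have "?P (d(v := True))"
    proof (intro allI impI)
      fix a b assume ab: "adj G a b" "a \<notin> Z" "b \<notin> Z"
      then have "a \<noteq> b" using G by (auto simp: simple_graph_def)
      then show "(d(v := True)) a \<noteq> (d(v := True)) b"
        using d[rule_format, OF ab] no no' ab by (cases "a = v"; cases "b = v") auto
    qed
    then have "card {u \<in> verts G. \<not> d u} \<le> card {u \<in> verts G. \<not> (d(v := True)) u}"
      by (rule min)
    moreover have "card {u \<in> verts G. \<not> (d(v := True)) u} < card {u \<in> verts G. \<not> d u}"
      by (rule psubset_card_mono) (use fin v in auto)
    ultimately show False by simp
  qed
  \<comment> \<open>Labels are crossed with colours: a vertex outside \<open>Z\<close> with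
    \<open>d\<close> carries label 2 for its neighbours, while it sees only label 1 and so has
    colour 1.\<close>
  define f where "f v = (if neighbors G v \<subseteq> Z then 3 else if v \<notin> Z \<and> d v then 2 else 1 :: nat)" for v
  have f_le: "f v \<le> 2" if "u \<in> neighbors G v" "u \<notin> Z" for u v
    using that by (auto simp: f_def)
  have c3: "max_color G f z = 3" if z: "z \<in> Z" for z
  proof -
    obtain w where w: "adj G w z" "neighbors G w \<subseteq> Z" using wit[OF z] by blast
    show ?thesis
      by (rule max_color_eqI[OF G, of w]) (use w in \<open>auto simp: neighbors_def f_def\<close>)
  qed
  have c2: "max_color G f v = 2" if v: "v \<in> verts G" "v \<notin> Z" "\<not> d v" for v
  proof -
    obtain u where u: "adj G u v" "u \<notin> Z" "d u" using nbr[OF v] by blast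
    then have "f u = 2" using sym[OF u(1)] that by (auto simp: f_def neighbors_def)
    then show ?thesis
      by (intro max_color_eqI[OF G, of u]) (use u sym f_le[of v] that in \<open>auto simp: neighbors_def\<close>)
  qed
  have c1: "max_color G f v = 1" if "v \<notin> Z" "d v" "adj G u v" for u v
  proof -
    have 1: "f w = 1" if "adj G w v" for w
      using that sym[OF that] \<open>v \<notin> Z\<close> \<open>d v\<close> d by (auto simp: f_def neighbors_def)
    then show ?thesis
      by (intro max_color_eqI[OF G, of u]) (use that in \<open>auto simp: neighbors_def\<close>)
  qed
  have "max_color G f u \<noteq> max_color G f v" if uv: "adj G u v" for u v
  proof -
    note * = in_verts[OF uv] d[rule_format, OF uv] ind[OF uv] ind[OF sym[OF uv]]
    consider "u \<in> Z" "v \<notin> Z" | "u \<notin> Z" "v \<in> Z" | "u \<notin> Z" "v \<notin> Z" "d u" "\<not> d v" | "u \<notin> Z" "v \<notin> Z" "\<not> d u" "d v"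
      using * by blast
    then show ?thesis
    proof cases
      case 1
      then show ?thesis using c3[of u] c2[of v] c1[of v u] * uv by (cases "d v") auto
    next
      case 2
      then show ?thesis using c3[of v] c2[of u] c1[of u v] * sym[OF uv] by (cases "d u") auto
    next
      case 3
      then show ?thesis using c1[of u v] c2[of v] * sym[OF uv] by auto
    next
      case 4
      then show ?thesis using c1[of v u] c2[of u] * uv by auto
    qed
  qed
  then have "labeling_by_max 3 G f"
    by (auto simp: labeling_by_max_def f_def)
  then show ?thesis by blast
qed

lemma max_color_in:
  assumes "simple_graph G" "labeling_by_max k G f" "neighbors G v \<noteq> {}"
  obtains w where "adj G w v" "f w = max_color G f v" "max_color G f v \<in> {1..k}"
proof -
  have sub: "neighbors G v \<subseteq> verts G"
    using assms(1) by (auto simp: neighbors_def simple_graph_def)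
  then have "finite (neighbors G v)"
    using assms(1) finite_subset by (auto simp: simple_graph_def)
  then have "max_color G f v \<in> f ` neighbors G v"
    unfolding max_color_def using assms(3) by (intro Max_in) auto
  then obtain w where "w \<in> neighbors G v" "f w = max_color G f v" by auto
  moreover have "f w \<in> {1..k}"
    using assms(2) sub \<open>w \<in> neighbors G v\<close> by (auto simp: labeling_by_max_def)
  ultimately show thesis using that by (auto simp: neighbors_def)
qed

lemma label_le_max_color:
  assumes "simple_graph G" "adj G u v"
  shows "f u \<le> max_color G f v"
proof -
  have "finite (neighbors G v)"
    by (rule finite_subset[of _ "verts G"]) (use assms(1) in \<open>auto simp: neighbors_def simple_graph_def\<close>)
  then show ?thesis
    unfolding max_color_def using assms(2) by (intro Max_ge) (auto simp: neighbors_def)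
qed

text \<open>A vertex of colour 3 has a neighbour labelled 3, and every neighbour of a vertex
  labelled 3 has colour 3; this gives the witness. Colours 1 and 2 are the 2-colouring of the
  rest.\<close>

lemma labeling3D:
  assumes G: "simple_graph G" and f: "labeling_by_max 3 G f"
    and ne: "\<And>v. v \<in> verts G \<Longrightarrow> neighbors G v \<noteq> {}"
  obtains Z col where "Z \<subseteq> verts G" "\<And>u v. adj G u v \<Longrightarrow> u \<in> Z \<Longrightarrow> v \<notin> Z"
    "\<And>z. z \<in> Z \<Longrightarrow> \<exists>w. adj G w z \<and> neighbors G w \<subseteq> Z"
    "\<And>u v. adj G u v \<Longrightarrow> u \<notin> Z \<Longrightarrow> v \<notin> Z \<Longrightarrow> col u \<noteq> (col v :: bool)"
proof (rule that[of "{v \<in> verts G. max_color G f v = 3}" "\<lambda>v. max_color G f v = 2"])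
  have in_verts: "adj G u v \<Longrightarrow> u \<in> verts G \<and> v \<in> verts G \<and> adj G v u" for u v
    using G by (auto simp: simple_graph_def)
  have diff: "max_color G f u \<noteq> max_color G f v" if "adj G u v" for u v
    using that f by (auto simp: labeling_by_max_def)
  have range: "max_color G f v \<in> {1..3}" if "v \<in> verts G" for v
    using max_color_in[OF G f ne[OF that]] by metis
  let ?Z = "{v \<in> verts G. max_color G f v = 3}"
  show "v \<notin> ?Z" if "adj G u v" "u \<in> ?Z" for u v
    using diff[OF that(1)] that(2) by auto
  show "\<exists>w. adj G w z \<and> neighbors G w \<subseteq> ?Z" if z: "z \<in> ?Z" for z
  proof -
    have "neighbors G z \<noteq> {}" using ne z by blast
    then obtain w where w: "adj G w z" "f w = 3"
      by (rule max_color_in[OF G f]) (use z in auto)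
    have "u \<in> ?Z" if "u \<in> neighbors G w" for u
    proof -
      have "adj G w u" "u \<in> verts G" using that in_verts by (auto simp: neighbors_def)
      then show ?thesis
        using label_le_max_color[OF G, of w u f] w(2) range[of u] by auto
    qed
    then show ?thesis using w(1) by blast
  qed
  show "(max_color G f u = 2) \<noteq> (max_color G f v = 2)" if "adj G u v" "u \<notin> ?Z" "v \<notin> ?Z" for u v
    using diff[OF that(1)] that(2,3) in_verts[OF that(1)] range[of u] range[of v]
    by (auto simp: numeral_eq_Suc le_Suc_eq)
qed auto

subsection \<open>Completing a graph of maximum degree three\<close>

definition list_graph :: "'a list \<Rightarrow> ('a \<Rightarrow> 'a list) \<Rightarrow> 'a graph" where
  "list_graph vs nb = Graph (set vs) (\<lambda>u v. u \<in> set vs \<and> v \<in> set vs \<and> v \<in> set (nb u))"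

lemma list_graph_simps [simp]:
  "verts (list_graph vs nb) = set vs"
  "adj (list_graph vs nb) u v \<longleftrightarrow> u \<in> set vs \<and> v \<in> set vs \<and> v \<in> set (nb u)"
  by (simp_all add: list_graph_def)

text \<open>
  Two copies of the given graph share caps, one for each missing edge. A cap consists of
  \<open>Cap 0\<close>, which is joined to both copies, \<open>Cap 1\<close>, and a diamond whose two ends \<open>Cap 2\<close> and \<open>Cap 3\<close>
  are both joined to \<open>Cap 1\<close>. The diamond forces \<open>Cap 0\<close> to have colour 3, so a vertex next to a cap
  never has colour 3.
\<close>

datatype 'a cubic = Core bool 'a | Cap nat nat 'a

definition cap_adj :: "nat \<Rightarrow> nat list" where
  "cap_adj i = (if i = 1 then [0, 2, 3] else if i = 2 \<or> i = 3 then [1, 4, 5]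
     else if i = 4 then [2, 3, 5] else [2, 3, 4])"

fun cubic_nb :: "('a \<Rightarrow> 'a list) \<Rightarrow> 'a cubic \<Rightarrow> 'a cubic list" where
  "cubic_nb nb (Core c v) = map (Core c) (nb v) @ map (\<lambda>j. Cap 0 j v) [length (nb v)..<3]"
| "cubic_nb nb (Cap i j v) = (if i = 0 then [Core False v, Core True v, Cap 1 j v]
     else map (\<lambda>i'. Cap i' j v) (cap_adj i))"

definition cubic_verts :: "'a list \<Rightarrow> ('a \<Rightarrow> 'a list) \<Rightarrow> 'a cubic list" where
  "cubic_verts vs nb = map (Core False) vs @ map (Core True) vs @
     concat (map (\<lambda>v. concat (map (\<lambda>j. map (\<lambda>i. Cap i j v) [0..<6]) [length (nb v)..<3])) vs)"

lemma Core_in_cubic [simp]: "Core c v \<in> set (cubic_verts vs nb) \<longleftrightarrow> v \<in> set vs"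
  by (cases c) (auto simp: cubic_verts_def)

lemma Cap_in_cubic [simp]:
  "Cap i j v \<in> set (cubic_verts vs nb) \<longleftrightarrow> v \<in> set vs \<and> length (nb v) \<le> j \<and> j < 3 \<and> i < 6"
  by (auto simp: cubic_verts_def image_iff)

lemma less_6_cases: "(i :: nat) < 6 \<Longrightarrow> i = 0 \<or> i = 1 \<or> i = 2 \<or> i = 3 \<or> i = 4 \<or> i = 5"
  by linarith

locale subcubic =
  fixes vs :: "'a list" and nb :: "'a \<Rightarrow> 'a list"
  assumes distinct_vs: "distinct vs"
    and distinct_nb: "v \<in> set vs \<Longrightarrow> distinct (nb v)"
    and length_nb: "v \<in> set vs \<Longrightarrow> length (nb v) \<le> 3"
    and closed_nb: "v \<in> set vs \<Longrightarrow> u \<in> set (nb v) \<Longrightarrow> u \<in> set vs \<and> u \<noteq> v \<and> v \<in> set (nb u)"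
begin

abbreviation "cvs \<equiv> cubic_verts vs nb"
abbreviation "cnb \<equiv> cubic_nb nb"
abbreviation "G \<equiv> list_graph cvs cnb"

lemma distinct_cubic_verts: "distinct cvs"
proof -
  have "distinct (concat (map (\<lambda>v. concat (map (\<lambda>j. map (\<lambda>i. Cap i j v) [0..<6]) [length (nb v)..<3])) us))"
    if "distinct us" for us
    using that
  proof (induction us)
    case (Cons u us)
    have "distinct (concat (map (\<lambda>j. map (\<lambda>i. Cap i j u) [0..<6]) js))" if "distinct js" for js
      using that by (induction js) (auto simp: distinct_map inj_on_def)
    then show ?case using Cons by auto
  qed simp
  then show ?thesis
    using distinct_vs by (auto simp: cubic_verts_def distinct_map inj_on_def)
qed

lemma cubic_closed:
  assumes "x \<in> set cvs" "y \<in> set (cnb x)"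
  shows "y \<in> set cvs \<and> y \<noteq> x \<and> x \<in> set (cnb y)"
proof (cases x)
  case (Core c v)
  then show ?thesis using assms closed_nb[of v] by (auto simp: image_iff)
next
  case (Cap i j v)
  then have "i < 6" using assms by simp
  then show ?thesis using assms Cap
    by (elim less_6_cases[elim_format] disjE) (auto simp: cap_adj_def)
qed

lemma simple_G: "simple_graph G"
  unfolding simple_graph_def list_graph_simps using cubic_closed by blast

lemma neighbors_G: "x \<in> set cvs \<Longrightarrow> neighbors G x = set (cnb x)"
  unfolding neighbors_def list_graph_simps using cubic_closed by blast

lemma regular_G: "regular 3 G"
  unfolding regular_def
proof
  fix x assume "x \<in> verts G"
  then have x: "x \<in> set cvs" by simp
  have "distinct (cnb x) \<and> length (cnb x) = 3"
  proof (cases x)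
    case (Core c v)
    then show ?thesis using x distinct_nb[of v] length_nb[of v]
      by (auto simp: distinct_map inj_on_def)
  next
    case (Cap i j v)
    then have "i < 6" using x by simp
    then show ?thesis using Cap
      by (elim less_6_cases[elim_format] disjE) (auto simp: cap_adj_def)
  qed
  then show "card (neighbors G x) = 3"
    using neighbors_G[OF x] distinct_card by metis
qed

lemma colorable_G:
  assumes range: "\<And>v. v \<in> set vs \<Longrightarrow> c v \<in> {1..3::nat}"
    and proper: "\<And>u v. v \<in> set vs \<Longrightarrow> u \<in> set (nb v) \<Longrightarrow> c u \<noteq> c v"
  shows "colorable 3 G"
proof -
  define d where "d x = (case x of Core _ v \<Rightarrow> c v
    | Cap i j v \<Rightarrow> if i = 0 then (if c v = 1 then 2 else 1) else if i = 2 \<or> i = 3 then 1 else if i = 4 then 2 else 3)" for x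
  have "d x \<noteq> d y" if "adj G x y" for x y
  proof (cases x)
    case (Core e v)
    note x = this
    show ?thesis
    proof (cases y)
      case (Core e' u)
      then show ?thesis using that x proper[of v u] by (auto simp: d_def)
    qed (use that x in \<open>auto simp: d_def\<close>)
  next
    case (Cap i j v)
    then have "i < 6" using that by simp
    then show ?thesis using that Cap
      by (elim less_6_cases[elim_format] disjE) (auto simp: cap_adj_def d_def split: if_splits)
  qed
  moreover have "d x \<in> {1..3}" if "x \<in> verts G" for x
    using that range by (cases x) (auto simp: d_def)
  ultimately show ?thesis unfolding colorable_def by blast
qed

text \<open>The conditions on \<open>Z\<close> as they appear on the given graph once the caps are
  attached: a vertex of degree below 3 is next to a \<open>Cap 0\<close>, which always has colour 3,
  so it cannot belong to \<open>Z\<close>.\<close>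

definition good :: "'a set \<Rightarrow> ('a \<Rightarrow> bool) \<Rightarrow> bool" where
  "good Z col \<longleftrightarrow> Z \<subseteq> set vs \<and>
     (\<forall>v \<in> set vs. \<forall>u \<in> set (nb v). (v \<in> Z \<longrightarrow> u \<notin> Z) \<and> (u \<notin> Z \<longrightarrow> v \<notin> Z \<longrightarrow> col u \<noteq> col v)) \<and>
     (\<forall>z \<in> Z. length (nb z) = 3 \<and> (\<exists>w \<in> set (nb z). set (nb w) \<subseteq> Z))"

text \<open>Both copies receive \<open>Z\<close>, and every cap contributes \<open>Cap 0\<close>,
  \<open>Cap 2\<close> and \<open>Cap 3\<close>. These are exactly the neighbours of
  \<open>Cap 1\<close>, which thus is a witness for all three. Of the cap there remain
  \<open>Cap 1\<close>, with no neighbour outside, and the edge between \<open>Cap 4\<close> and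
  \<open>Cap 5\<close>.\<close>

lemma labeling_if_good:
  assumes "good Z col"
  shows "\<exists>f. labeling_by_max 3 G f"
proof -
  define Z' where "Z' = {x \<in> set cvs. case x of Core _ v \<Rightarrow> v \<in> Z | Cap i j v \<Rightarrow> i = 0 \<or> i = 2 \<or> i = 3}"
  define col' where "col' x = (case x of Core _ v \<Rightarrow> col v | Cap i j v \<Rightarrow> i = 4)" for x
  have Z: "Z \<subseteq> set vs" and ind: "\<And>u v. v \<in> set vs \<Longrightarrow> u \<in> set (nb v) \<Longrightarrow> v \<in> Z \<Longrightarrow> u \<notin> Z"
    and col: "\<And>u v. v \<in> set vs \<Longrightarrow> u \<in> set (nb v) \<Longrightarrow> v \<notin> Z \<Longrightarrow> u \<notin> Z \<Longrightarrow> col u \<noteq> col v"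
    and wit: "\<And>z. z \<in> Z \<Longrightarrow> length (nb z) = 3 \<and> (\<exists>w \<in> set (nb z). set (nb w) \<subseteq> Z)"
    using assms unfolding good_def by blast+
  show ?thesis
  proof (rule labeling3I[OF simple_G, of Z' col'])
    show "y \<notin> Z'" if "adj G x y" "x \<in> Z'" for x y
    proof (cases x)
      case (Core c v)
      then show ?thesis using that ind[of v] wit[of v] by (auto simp: Z'_def)
    next
      case (Cap i j v)
      then have "i < 6" using that by simp
      then show ?thesis using that Cap wit[of v]
        by (elim less_6_cases[elim_format] disjE) (auto simp: cap_adj_def Z'_def)
    qed
    show "\<exists>w. adj G w z \<and> neighbors G w \<subseteq> Z'" if "z \<in> Z'" for z
    proof (cases z)
      case (Core c v)
      then have v: "v \<in> Z" "v \<in> set vs" using that by (auto simp: Z'_def)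
      obtain w where w: "w \<in> set (nb v)" "set (nb w) \<subseteq> Z" using wit[OF v(1)] by blast
      have "w \<in> set vs" "v \<in> set (nb w)" using closed_nb[OF v(2) w(1)] by auto
      then show ?thesis
        using w(2) v Z by (intro exI[of _ "Core c w"]) (auto simp: Core neighbors_G Z'_def)
    next
      case (Cap i j v)
      then have "i < 6" "i = 0 \<or> i = 2 \<or> i = 3" using that by (auto simp: Z'_def)
      then show ?thesis using Cap that
        by (intro exI[of _ "Cap 1 j v"]) (auto simp: neighbors_G Z'_def cap_adj_def)
    qed
    show "col' x \<noteq> col' y" if "adj G x y" "x \<notin> Z'" "y \<notin> Z'" for x y
    proof (cases x)
      case (Core c v)
      then show ?thesis using that col[of v] by (auto simp: Z'_def col'_def)
    next
      case (Cap i j v)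
      then have "i < 6" using that by simp
      then show ?thesis using that Cap
        by (elim less_6_cases[elim_format] disjE) (auto simp: cap_adj_def Z'_def col'_def)
    qed
  qed
qed

lemma good_if_labeling:
  assumes "labeling_by_max 3 G f"
  shows "\<exists>Z col. good Z col"
proof -
  have ne: "neighbors G x \<noteq> {}" if "x \<in> verts G" for x
    using regular_G that by (auto simp: regular_def)
  obtain Z' col' where Z': "Z' \<subseteq> verts G"
    and ind': "\<And>x y. adj G x y \<Longrightarrow> x \<in> Z' \<Longrightarrow> y \<notin> Z'"
    and wit': "\<And>z. z \<in> Z' \<Longrightarrow> \<exists>w. adj G w z \<and> neighbors G w \<subseteq> Z'"
    and col': "\<And>x y. adj G x y \<Longrightarrow> x \<notin> Z' \<Longrightarrow> y \<notin> Z' \<Longrightarrow> col' x \<noteq> (col' y :: bool)"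
    by (rule labeling3D[OF simple_G assms ne]) blast+
  have ind: "y \<notin> Z'" if "x \<in> set cvs" "y \<in> set (cnb x)" "x \<in> Z'" for x y
    using ind'[of x y] cubic_closed[of x y] that by auto
  have wit: "\<exists>w \<in> set (cnb z). w \<in> set cvs \<and> set (cnb w) \<subseteq> Z'" if z: "z \<in> Z'" for z
  proof -
    obtain w where w: "adj G w z" "neighbors G w \<subseteq> Z'"
      using wit'[OF z] by blast
    then show ?thesis using neighbors_G[of w] cubic_closed[of w z] by auto
  qed
  have col: "col' x \<noteq> col' y" if "x \<in> set cvs" "y \<in> set (cnb x)" "x \<notin> Z'" "y \<notin> Z'" for x y
    using col'[of x y] cubic_closed[of x y] that by auto
  have cap: "Cap 0 j v \<in> Z'" if v: "v \<in> set vs" "length (nb v) \<le> j" "j < 3" for v j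
  proof -
    have in_cvs: "Cap i j v \<in> set cvs" if "i < 6" for i
      using v that by simp
    \<comment> \<open>Every neighbour of \<open>Cap 4\<close> has a further neighbour adjacent to
      \<open>Cap 4\<close>. With \<open>Cap 4\<close> in \<open>Z'\<close>, independence therefore
      leaves no witness; the same holds for \<open>Cap 5\<close>.\<close>
    have b: "Cap 4 j v \<notin> Z'"
    proof
      assume "Cap 4 j v \<in> Z'"
      with ind[of "Cap 4 j v"] wit[of "Cap 4 j v"] in_cvs show False
        by (auto simp: cap_adj_def)
    qed
    have c: "Cap 5 j v \<notin> Z'"
    proof
      assume "Cap 5 j v \<in> Z'"
      with ind[of "Cap 5 j v"] wit[of "Cap 5 j v"] in_cvs show False
        by (auto simp: cap_adj_def)
    qed
    \<comment> \<open>The triangle on \<open>Cap 2\<close>, \<open>Cap 4\<close>,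
      \<open>Cap 5\<close> has no proper 2-colouring, so \<open>Cap 2\<close> must be in
      \<open>Z'\<close>. Its witness cannot be \<open>Cap 4\<close> or \<open>Cap 5\<close>, which
      see each other, so it is \<open>Cap 1\<close>, which brings in \<open>Cap 0\<close>.\<close>
    have "Cap 2 j v \<in> Z'"
      using col[of "Cap 2 j v" "Cap 4 j v"] col[of "Cap 2 j v" "Cap 5 j v"] col[of "Cap 4 j v" "Cap 5 j v"]
        b c v by (auto simp: cap_adj_def)
    from wit[OF this] b c show ?thesis by (auto simp: cap_adj_def)
  qed
  define Z where "Z = {v \<in> set vs. Core False v \<in> Z'}"
  have "good Z (\<lambda>v. col' (Core False v))"
    unfolding good_def
  proof (intro conjI ballI)
    show "Z \<subseteq> set vs" by (auto simp: Z_def)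
    fix v u assume "v \<in> set vs" "u \<in> set (nb v)"
    then show "v \<in> Z \<longrightarrow> u \<notin> Z"
      and "u \<notin> Z \<longrightarrow> v \<notin> Z \<longrightarrow> col' (Core False u) \<noteq> col' (Core False v)"
      using ind[of "Core False v" "Core False u"] col[of "Core False v" "Core False u"] closed_nb[of v u]
      by (auto simp: Z_def)
  next
    fix z assume "z \<in> Z"
    then have z: "z \<in> set vs" "Core False z \<in> Z'" by (auto simp: Z_def)
    show len: "length (nb z) = 3"
    proof (rule ccontr)
      assume "length (nb z) \<noteq> 3"
      with length_nb[OF z(1)] have "Cap 0 2 z \<in> Z'" by (intro cap z) auto
      moreover have "Cap 0 2 z \<in> set (cnb (Core False z))"
        using \<open>length (nb z) \<noteq> 3\<close> length_nb[OF z(1)] by auto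
      ultimately show False using ind[of "Core False z" "Cap 0 2 z"] z by simp
    qed
    \<comment> \<open>With three neighbours of its own \<open>z\<close> touches no cap, so the
      witness is a core vertex.\<close>
    obtain x where "x \<in> set (cnb (Core False z))" "set (cnb x) \<subseteq> Z'"
      using wit[OF z(2)] by blast
    then obtain w where w: "w \<in> set (nb z)" "set (cnb (Core False w)) \<subseteq> Z'"
      using len by auto
    have "u \<in> Z" if "u \<in> set (nb w)" for u
      using w(2) closed_nb[OF z(1) w(1)] closed_nb[of w u] that by (auto simp: Z_def)
    with w(1) show "\<exists>w \<in> set (nb z). set (nb w) \<subseteq> Z" by blast
  qed
  then show ?thesis by blast
qed

end

subsection \<open>From 3-satisfiability to subcubic graphs\<close>

text \<open>
  \<open>ls\<close> lists the literals of a 3-CNF, three consecutive ones forming a clause. A triangle says that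
  exactly one of the nodes attached to it is true. The nodes \<open>Wire v n\<close> stand for \<open>v\<close> (\<open>n\<close> even) and
  its negation (\<open>n\<close> odd), linked by triangles \<open>Xor v n\<close> with one useless corner. Clause \<open>a \<or> b \<or> c\<close> is
  expressed by three triangles \<open>Row\<close> with auxiliary nodes \<open>p, q, r, s\<close>: exactly one of \<open>\<not> a, p, q\<close>,
  of \<open>b, q, r\<close> and of \<open>\<not> c, r, s\<close>.
\<close>

datatype 'v node = Wire 'v nat | Xor 'v nat nat | Row nat nat | Aux nat nat

definition el :: "'a list \<Rightarrow> nat \<Rightarrow> 'a" where
  "el xs n = hd (drop n xs)"

lemma el_nth: "n < length xs \<Longrightarrow> el xs n = xs ! n"
  by (simp add: el_def hd_drop_conv_nth)

text \<open>The parity of the wire node that feeds row \<open>k\<close>: it selects the value of the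
  literal in the middle row of a clause and the negated value in the two outer rows.\<close>

definition side :: "(bool \<times> 'v) list \<Rightarrow> nat \<Rightarrow> nat" where
  "side ls k = (if (k mod 3 = 1) = fst (el ls k) then 0 else 1)"

text \<open>Position \<open>k\<close> owns the wire nodes \<open>2 * k\<close> and
  \<open>2 * k + 1\<close> and uses the one of suitable parity. So a wire node meets at most two
  \<open>Xor\<close> triangles and one row, which keeps its degree at most 3.\<close>

definition tap :: "(bool \<times> 'v) list \<Rightarrow> 'v \<Rightarrow> nat \<Rightarrow> bool" where
  "tap ls v n \<longleftrightarrow> snd (el ls (n div 2)) = v \<and> n mod 2 = side ls (n div 2)"

definition others :: "nat \<Rightarrow> nat list" where
  "others s = filter (\<lambda>t. t \<noteq> s) [0, 1, 2]"

fun node_nb :: "(bool \<times> 'v) list \<Rightarrow> 'v node \<Rightarrow> 'v node list" where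
  "node_nb ls (Wire v n) =
     (if Suc n < 2 * length ls then [Xor v n 0] else []) @
     (if 0 < n then [Xor v (n - 1) 1] else []) @
     (if tap ls v n then [Row (n div 2) 0] else [])"
| "node_nb ls (Xor v n s) = map (\<lambda>t. Xor v n t) (others s) @
     (if s = 0 then [Wire v n] else if s = 1 then [Wire v (Suc n)] else [])"
| "node_nb ls (Row k s) = map (\<lambda>t. Row k t) (others s) @
     [if s = 0 then Wire (snd (el ls k)) (2 * k + side ls k)
      else if s = 1 then Aux (k div 3) (k mod 3) else Aux (k div 3) (Suc (k mod 3))]"
| "node_nb ls (Aux i r) =
     (if r < 3 then [Row (3 * i + r) 1] else []) @ (if 0 < r then [Row (3 * i + (r - 1)) 2] else [])"

definition node_verts :: "(bool \<times> 'v) list \<Rightarrow> 'v node list" where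
  "node_verts ls =
     concat (map (\<lambda>v. map (\<lambda>n. Wire v n) [0..<2 * length ls]) (dedup (map snd ls))) @
     concat (map (\<lambda>v. concat (map (\<lambda>n. map (\<lambda>s. Xor v n s) [0..<3]) [0..<2 * length ls - 1]))
       (dedup (map snd ls))) @
     concat (map (\<lambda>k. map (\<lambda>s. Row k s) [0..<3]) [0..<length ls]) @
     concat (map (\<lambda>i. map (\<lambda>r. Aux i r) [0..<4]) [0..<length ls div 3])"

definition lvars :: "(bool \<times> 'v) list \<Rightarrow> 'v set" where
  "lvars ls = snd ` set ls"

lemma lvars_el: "k < length ls \<Longrightarrow> snd (el ls k) \<in> lvars ls"
  by (simp add: lvars_def el_nth)

lemma node_verts_iff [simp]:
  "Wire v n \<in> set (node_verts ls) \<longleftrightarrow> v \<in> lvars ls \<and> n < 2 * length ls"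
  "Xor v n s \<in> set (node_verts ls) \<longleftrightarrow> v \<in> lvars ls \<and> Suc n < 2 * length ls \<and> s < 3"
  "Row k s \<in> set (node_verts ls) \<longleftrightarrow> k < length ls \<and> s < 3"
  "Aux i r \<in> set (node_verts ls) \<longleftrightarrow> i < length ls div 3 \<and> r < 4"
  by (auto simp: node_verts_def dedup image_iff lvars_def)

lemma distinct_concat_map:
  assumes "distinct xs" "\<And>x. x \<in> set xs \<Longrightarrow> distinct (f x)"
    "\<And>x y z. x \<in> set xs \<Longrightarrow> y \<in> set xs \<Longrightarrow> z \<in> set (f x) \<Longrightarrow> z \<in> set (f y) \<Longrightarrow> x = y"
  shows "distinct (concat (map f xs))"
  using assms
proof (induction xs)
  case (Cons x xs)
  have "distinct (concat (map f xs))"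
    by (rule Cons.IH) (use Cons.prems in auto)
  then show ?case using Cons.prems by (auto 4 4)
qed simp

lemma distinct_node_verts: "distinct (node_verts ls)"
  unfolding node_verts_def
  by (auto intro!: distinct_concat_map simp: dedup distinct_map inj_on_def)

lemma others_cases: "s < 3 \<Longrightarrow> (s = 0 \<and> others s = [1, 2]) \<or> (s = 1 \<and> others s = [0, 2]) \<or> (s = 2 \<and> others s = [0, 1])"
  by (auto simp: others_def)

lemma less_3_cases: "(s :: nat) < 3 \<Longrightarrow> s = 0 \<or> s = 1 \<or> s = 2"
  by linarith

lemma side_le: "side ls k \<le> 1"
  by (simp add: side_def)

lemma in_others: "s < 3 \<Longrightarrow> t \<in> set (others s) \<longleftrightarrow> t < 3 \<and> t \<noteq> s"
  by (auto simp: others_def)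

lemma tap_side: "snd (el ls k) = v \<Longrightarrow> tap ls v (2 * k + side ls k)"
  using side_le[of ls k] by (simp add: tap_def)

locale three_cnf =
  fixes ls :: "(bool \<times> 'v) list" and m :: nat
  assumes length_ls: "length ls = 3 * m"
begin

lemma node_closed:
  assumes "x \<in> set (node_verts ls)" "y \<in> set (node_nb ls x)"
  shows "y \<in> set (node_verts ls) \<and> y \<noteq> x \<and> x \<in> set (node_nb ls y)"
proof (cases x)
  case (Wire v n)
  have "2 * (n div 2) + side ls (n div 2) = n" if "tap ls v n"
    using that by (metis tap_def mult_div_mod_eq)
  then show ?thesis using assms Wire
    by (auto simp: others_def split: if_splits) (auto simp: tap_def)
next
  case (Xor v n s)
  then show ?thesis using assms others_cases[of s] by (auto simp: others_def split: if_splits)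
next
  case (Row k s)
  have k: "k < length ls" "s < 3" using assms Row by auto
  consider t where "t < 3" "t \<noteq> s" "y = Row k t"
    | "s = 0" "y = Wire (snd (el ls k)) (2 * k + side ls k)"
    | "s = 1" "y = Aux (k div 3) (k mod 3)" | "s = 2" "y = Aux (k div 3) (Suc (k mod 3))"
    using assms(2) k(2) by (auto simp: Row in_others split: if_splits)
  then show ?thesis
  proof cases
    case 1
    then show ?thesis using k by (auto simp: Row in_others)
  next
    case 2
    then show ?thesis
      using k side_le[of ls k] tap_side[of ls k "snd (el ls k)"] by (auto simp: Row lvars_el)
  next
    case 3
    then show ?thesis using k length_ls by (auto simp: Row)
  next
    case 4
    then show ?thesis using k length_ls by (auto simp: Row)
  qed
next
  case (Aux i r)
  then show ?thesis using assms length_ls by (cases r) (auto simp: others_def split: if_splits)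
qed

sublocale subcubic "node_verts ls" "node_nb ls"
proof
  fix x assume x: "x \<in> set (node_verts ls)"
  show "distinct (node_nb ls x)"
  proof (cases x)
    case (Xor v n s)
    then show ?thesis using x others_cases[of s] by auto
  next
    case (Row k s)
    then show ?thesis using x others_cases[of s] by auto
  qed auto
  show "length (node_nb ls x) \<le> 3"
  proof (cases x)
    case (Xor v n s)
    then show ?thesis using x others_cases[of s] by auto
  next
    case (Row k s)
    then show ?thesis using x others_cases[of s] by auto
  qed auto
qed (use distinct_node_verts node_closed in blast)+

text \<open>Corner \<open>s\<close> of a triangle gets colour \<open>s + 1\<close>. Wires touch only
  corners 0 and 1, which leaves colour 3, and auxiliary nodes touch only corners 1 and 2, which
  leaves colour 1.\<close>

lemma colorable3: "colorable 3 G"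
proof (rule colorable_G)
  let ?c = "\<lambda>x. case x of Wire v n \<Rightarrow> 3 | Xor v n s \<Rightarrow> Suc s | Row k s \<Rightarrow> Suc s | Aux i r \<Rightarrow> 1"
  show "?c x \<in> {1..3}" if "x \<in> set (node_verts ls)" for x
    by (cases x) (use that in auto)
  show "?c y \<noteq> ?c x" if "x \<in> set (node_verts ls)" "y \<in> set (node_nb ls x)" for x y
  proof (cases x)
    case (Xor v n s)
    then show ?thesis using that others_cases[of s] by (auto split: if_splits)
  next
    case (Row k s)
    then show ?thesis using that others_cases[of s] by (auto split: if_splits)
  qed (use that in \<open>auto split: if_splits\<close>)
qed

definition sat :: "('v \<Rightarrow> bool) \<Rightarrow> bool" where
  "sat \<alpha> \<longleftrightarrow> (\<forall>i < m. \<exists>r < 3. fst (ls ! (3 * i + r)) = \<alpha> (snd (ls ! (3 * i + r))))"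

lemma sat_if_good:
  assumes "good Z col"
  shows "\<exists>\<alpha>. sat \<alpha>"
proof -
  let ?nb = "\<lambda>x. set (node_nb ls x)"
  have Z: "Z \<subseteq> set (node_verts ls)"
    and ind: "\<And>x y. x \<in> set (node_verts ls) \<Longrightarrow> y \<in> ?nb x \<Longrightarrow> x \<in> Z \<Longrightarrow> y \<notin> Z"
    and col: "\<And>x y. x \<in> set (node_verts ls) \<Longrightarrow> y \<in> ?nb x \<Longrightarrow> x \<notin> Z \<Longrightarrow> y \<notin> Z \<Longrightarrow> col y \<noteq> col x"
    and wit: "\<And>z. z \<in> Z \<Longrightarrow> length (node_nb ls z) = 3 \<and> (\<exists>w \<in> ?nb z. ?nb w \<subseteq> Z)"
    using assms unfolding good_def by blast+
  define val where "val x \<longleftrightarrow> ?nb x \<subseteq> Z" for x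
  have triangle: "\<exists>s < 3. t s \<in> Z \<and> (\<forall>s' < 3. s' \<noteq> s \<longrightarrow> t s' \<notin> Z)"
    if t: "\<And>s. s < 3 \<Longrightarrow> t s \<in> set (node_verts ls)" "\<And>s s'. s < 3 \<Longrightarrow> s' < 3 \<Longrightarrow> s' \<noteq> s \<Longrightarrow> t s' \<in> ?nb (t s)"
    for t :: "nat \<Rightarrow> 'v node"
  proof -
    have "\<exists>s < 3. t s \<in> Z"
    proof (rule ccontr)
      assume "\<not> ?thesis"
      then show False
        using col[OF t(1)[of 0] t(2)[of 0 1]] col[OF t(1)[of 0] t(2)[of 0 2]] col[OF t(1)[of 1] t(2)[of 1 2]]
        by auto
    qed
    then obtain s where "s < 3" "t s \<in> Z" by blast
    then show ?thesis using ind[OF t(1) t(2)] by blast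
  qed
  \<comment> \<open>The witness of a corner in \<open>Z\<close> cannot be another corner
    \<open>t s'\<close>, as then the third corner would lie in \<open>Z\<close> next to
    \<open>t s\<close>. So it is the attached node \<open>w\<close>.\<close>
  have port: "t s \<in> Z \<longleftrightarrow> val w"
    if t: "\<And>s. s < 3 \<Longrightarrow> t s \<in> set (node_verts ls)" "\<And>s s'. s < 3 \<Longrightarrow> s' < 3 \<Longrightarrow> s' \<noteq> s \<Longrightarrow> t s' \<in> ?nb (t s)"
      and w: "s < 3" "?nb (t s) \<subseteq> t ` {s'. s' < 3 \<and> s' \<noteq> s} \<union> {w}" "t s \<in> ?nb w"
    for t :: "nat \<Rightarrow> 'v node" and s w
  proof
    assume ts: "t s \<in> Z"
    then obtain x where x: "x \<in> ?nb (t s)" "?nb x \<subseteq> Z" using wit by blast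
    have "x \<noteq> t s'" if s': "s' < 3" "s' \<noteq> s" for s'
    proof
      assume "x = t s'"
      have "\<exists>s'' < 3. s'' \<noteq> s \<and> s'' \<noteq> s'" by presburger
      then obtain s'' where s'': "s'' < 3" "s'' \<noteq> s" "s'' \<noteq> s'" by blast
      then have "t s'' \<in> Z" using t(2)[of s' s''] s' x \<open>x = t s'\<close> by auto
      with ts show False using ind[OF t(1)[OF w(1)] t(2)[OF w(1) s''(1,2)]] by blast
    qed
    then have "x = w" using x(1) w(2) by blast
    then show "val w" using x by (simp add: val_def)
  next
    assume "val w"
    then show "t s \<in> Z" using w(3) by (auto simp: val_def)
  qed
  have xor: "val (Wire v n) \<noteq> val (Wire v (Suc n))" if v: "v \<in> lvars ls" "Suc n < 2 * length ls" for v n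
  proof -
    have t: "Xor v n s \<in> set (node_verts ls)" "s' < 3 \<Longrightarrow> s' \<noteq> s \<Longrightarrow> Xor v n s' \<in> ?nb (Xor v n s)" if "s < 3" for s s'
      using v that by (auto simp: in_others)
    have 0: "Xor v n 0 \<in> Z \<longleftrightarrow> val (Wire v n)"
      by (rule port[of "Xor v n", OF t]) (use v in \<open>auto simp: in_others\<close>)
    have 1: "Xor v n 1 \<in> Z \<longleftrightarrow> val (Wire v (Suc n))"
      by (rule port[of "Xor v n", OF t]) (use v in \<open>auto simp: in_others\<close>)
    \<comment> \<open>The useless corner has degree 2, while \<open>good\<close> admits only
      vertices of degree 3 into \<open>Z\<close>.\<close>
    have 2: "Xor v n 2 \<notin> Z"
      using wit[of "Xor v n 2"] by (auto simp: others_def)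
    have "\<exists>s < 3. Xor v n s \<in> Z \<and> (\<forall>s' < 3. s' \<noteq> s \<longrightarrow> Xor v n s' \<notin> Z)"
      by (rule triangle) (fact t)+
    then obtain s where s: "s < 3" "Xor v n s \<in> Z" "\<forall>s' < 3. s' \<noteq> s \<longrightarrow> Xor v n s' \<notin> Z"
      by blast
    then have "s = 0 \<or> s = 1" using 2 by (cases "s = 2") auto
    then show ?thesis using s 0 1 by auto
  qed
  have wire: "val (Wire v n) \<longleftrightarrow> (val (Wire v 0) \<noteq> odd n)" if "v \<in> lvars ls" "n < 2 * length ls" for v n
    using that(2)
  proof (induction n)
    case (Suc n)
    then show ?case using xor[OF that(1), of n] by auto
  qed simp
  define y where "y k = val (Wire (snd (el ls k)) (2 * k + side ls k))" for k
  define a where "a i j = val (Aux i j)" for i j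
  have row: "(y k \<and> \<not> a (k div 3) (k mod 3) \<and> \<not> a (k div 3) (Suc (k mod 3))) \<or>
      (\<not> y k \<and> a (k div 3) (k mod 3) \<and> \<not> a (k div 3) (Suc (k mod 3))) \<or>
      (\<not> y k \<and> \<not> a (k div 3) (k mod 3) \<and> a (k div 3) (Suc (k mod 3)))" if k: "k < length ls" for k
  proof -
    have t: "Row k s \<in> set (node_verts ls)" "s' < 3 \<Longrightarrow> s' \<noteq> s \<Longrightarrow> Row k s' \<in> ?nb (Row k s)" if "s < 3" for s s'
      using k that by (auto simp: in_others)
    have *: "Row k s \<in> ?nb x" if "x \<in> ?nb (Row k s)" "s < 3" for x s
      using node_closed[of "Row k s" x] that k by simp
    have 0: "Row k 0 \<in> Z \<longleftrightarrow> y k" unfolding y_def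
      by (rule port[of "Row k", OF t]) (use *[of "Wire (snd (el ls k)) (2 * k + side ls k)" 0] in \<open>auto simp: in_others\<close>)
    have 1: "Row k 1 \<in> Z \<longleftrightarrow> a (k div 3) (k mod 3)" unfolding a_def
      by (rule port[of "Row k", OF t]) (use *[of "Aux (k div 3) (k mod 3)" 1] in \<open>auto simp: in_others\<close>)
    have 2: "Row k 2 \<in> Z \<longleftrightarrow> a (k div 3) (Suc (k mod 3))" unfolding a_def
      by (rule port[of "Row k", OF t]) (use *[of "Aux (k div 3) (Suc (k mod 3))" 2] in \<open>auto simp: in_others\<close>)
    have "\<exists>s < 3. Row k s \<in> Z \<and> (\<forall>s' < 3. s' \<noteq> s \<longrightarrow> Row k s' \<notin> Z)"
      by (rule triangle) (fact t)+
    then obtain s where s: "s < 3" "Row k s \<in> Z" "\<forall>s' < 3. s' \<noteq> s \<longrightarrow> Row k s' \<notin> Z"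
      by blast
    then have "s = 0 \<or> s = 1 \<or> s = 2" by linarith
    then show ?thesis using s 0 1 2 by (elim disjE) auto
  qed
  define \<alpha> where "\<alpha> v = val (Wire v 0)" for v
  have y: "y k \<longleftrightarrow> (k mod 3 = 1) = (fst (ls ! k) = \<alpha> (snd (ls ! k)))" if "k < length ls" for k
  proof -
    have "2 * k + side ls k < 2 * length ls" using that side_le[of ls k] by linarith
    then show ?thesis
      using wire[of "snd (ls ! k)" "2 * k + side ls k"] that lvars_el[OF that]
      by (auto simp: y_def \<alpha>_def el_nth side_def)
  qed
  have "sat \<alpha>"
    unfolding sat_def
  proof (intro allI impI)
    fix i assume i: "i < m"
    have k: "3 * i + r < length ls" if "r < 3" for r using i that length_ls by linarith
    have row': "(y (3 * i + r) \<and> \<not> a i r \<and> \<not> a i (Suc r)) \<or> (\<not> y (3 * i + r) \<and> a i r \<and> \<not> a i (Suc r)) \<or>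
        (\<not> y (3 * i + r) \<and> \<not> a i r \<and> a i (Suc r))" if "r < 3" for r
      using row[OF k[OF that]] that by simp
    have y': "y (3 * i + r) \<longleftrightarrow> (r = 1) = (fst (ls ! (3 * i + r)) = \<alpha> (snd (ls ! (3 * i + r))))" if "r < 3" for r
      using y[OF k[OF that]] that by simp
    show "\<exists>r < 3. fst (ls ! (3 * i + r)) = \<alpha> (snd (ls ! (3 * i + r)))"
    proof (rule ccontr)
      assume no: "\<not> ?thesis"
      have no': "\<not> fst (ls ! (3 * i + r)) = \<alpha> (snd (ls ! (3 * i + r)))" if "r < 3" for r
        using no that by blast
      \<comment> \<open>If no literal holds, the inputs of both outer rows are true and force all
        four auxiliary nodes to be false; the middle row is then left without a true node.\<close>
      have "y (3 * i + 0)" "\<not> y (3 * i + 1)" "y (3 * i + 2)"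
        using no'[of 0] no'[of 1] no'[of 2] y'[of 0] y'[of 1] y'[of 2] by simp_all
      then show False
        using row'[of 0] row'[of 1] row'[of 2] by (auto simp: numeral_2_eq_2)
    qed
  qed
  then show ?thesis by blast
qed

text \<open>For literal values \<open>a\<close>, \<open>b\<close>, \<open>c\<close> the auxiliary
  nodes become a and b, a and not b, neither a nor b, and finally c unless neither a nor b. The
  first two rows then hold always; the third fails only if all three literals are false.\<close>

lemma good_if_sat:
  assumes "sat \<alpha>"
  shows "\<exists>Z col. good Z col"
proof -
  define lit where "lit k \<longleftrightarrow> fst (el ls k) = \<alpha> (snd (el ls k))" for k
  define wv where "wv v n \<longleftrightarrow> (\<alpha> v \<noteq> odd n)" for v and n :: nat
  define y where "y k = wv (snd (el ls k)) (2 * k + side ls k)" for k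
  have y: "y k \<longleftrightarrow> (k mod 3 = 1) = lit k" for k
    by (auto simp: y_def wv_def side_def lit_def)
  define q where "q i \<longleftrightarrow> lit (3 * i) \<and> \<not> lit (3 * i + 1)" for i
  define r where "r i \<longleftrightarrow> \<not> lit (3 * i) \<and> \<not> lit (3 * i + 1)" for i
  define b where "b i j = (if j = 0 then lit (3 * i) \<and> lit (3 * i + 1) else if j = 1 then q i
    else if j = 2 then r i else lit (3 * i + 2) \<and> \<not> r i)" for i and j :: nat
  define tv where "tv k s = (if s = 0 then y k else if s = 1 then b (k div 3) (k mod 3)
    else b (k div 3) (Suc (k mod 3)))" for k and s :: nat
  have tv: "(tv k 0 \<and> \<not> tv k 1 \<and> \<not> tv k 2) \<or> (\<not> tv k 0 \<and> tv k 1 \<and> \<not> tv k 2) \<or> (\<not> tv k 0 \<and> \<not> tv k 1 \<and> tv k 2)"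
    if k: "k < length ls" for k
  proof -
    define i where "i = k div 3"
    have i: "i < m" using k length_ls unfolding i_def by linarith
    have sat3: "lit (3 * i) \<or> lit (3 * i + 1) \<or> lit (3 * i + 2)"
    proof -
      obtain j where j: "j < 3" "fst (ls ! (3 * i + j)) = \<alpha> (snd (ls ! (3 * i + j)))"
        using assms i unfolding sat_def by blast
      then have "lit (3 * i + j)" using i length_ls by (simp add: lit_def el_nth)
      moreover have "j = 0 \<or> j = 1 \<or> j = 2" using j(1) by linarith
      ultimately show ?thesis by auto
    qed
    have tv_eq: "tv k s = (if s = 0 then y k else if s = 1 then b i (k mod 3) else b i (Suc (k mod 3)))" for s
      by (simp add: tv_def i_def)
    consider "k = 3 * i" "k mod 3 = 0" | "k = 3 * i + 1" "k mod 3 = 1" | "k = 3 * i + 2" "k mod 3 = 2"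
    proof -
      have e: "k = 3 * i + k mod 3" unfolding i_def by presburger
      have "k mod 3 = 0 \<or> k mod 3 = 1 \<or> k mod 3 = 2" by presburger
      then show thesis
      proof (elim disjE)
        assume "k mod 3 = 0"
        then show thesis by (intro that(1)) (use e in arith)+
      next
        assume "k mod 3 = 1"
        then show thesis by (intro that(2)) (use e in arith)+
      next
        assume "k mod 3 = 2"
        then show thesis by (intro that(3)) (use e in arith)+
      qed
    qed
    then show ?thesis
    proof cases
      case 1
      then have "lit k = lit (3 * i)" by (rule_tac arg_cong)
      then show ?thesis using sat3 by (auto simp: tv_eq y 1(2) b_def q_def r_def)
    next
      case 2
      then have "lit k = lit (3 * i + 1)" by (rule_tac arg_cong)
      then show ?thesis using sat3 by (auto simp: tv_eq y 2(2) b_def q_def r_def)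
    next
      case 3
      then have "lit k = lit (3 * i + 2)" by (rule_tac arg_cong)
      then show ?thesis using sat3 by (auto simp: tv_eq y 3(2) b_def q_def r_def)
    qed
  qed
  define Z where "Z = {x \<in> set (node_verts ls). case x of Wire v n \<Rightarrow> False
    | Xor v n s \<Rightarrow> s < 2 \<and> wv v (n + s) | Row k s \<Rightarrow> tv k s | Aux i j \<Rightarrow> False}"
  have Z_simps: "Wire v n \<notin> Z" "Aux i j \<notin> Z"
    "Xor v n s \<in> Z \<longleftrightarrow> Xor v n s \<in> set (node_verts ls) \<and> s < 2 \<and> wv v (n + s)"
    "Row k s \<in> Z \<longleftrightarrow> Row k s \<in> set (node_verts ls) \<and> tv k s" for v n i j s k
    by (auto simp: Z_def)
  \<comment> \<open>The complement of \<open>Z\<close> is 2-coloured from the auxiliary nodes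
    outwards. Row corners 1 and 2 are opposite to their auxiliary nodes and hence to each other;
    corner 0 is opposite to whichever of them is not in \<open>Z\<close>. A tapped wire is opposite
    to its row corner, \<open>Xor\<close> corners 0 and 1 to their wires, and \<open>Xor\<close>
    corner 2 to the other corner outside \<open>Z\<close>.\<close>
  define cr where "cr k s = (if s = 1 then odd (k mod 3) else if s = 2 then even (k mod 3)
    else if tv k 2 then even (k mod 3) else odd (k mod 3))" for k and s :: nat
  define cw where "cw v n \<longleftrightarrow> \<not> (tap ls v n \<and> cr (n div 2) 0)" for v n
  define cx where "cx v n s = (if s = 0 then \<not> cw v n else if s = 1 then \<not> cw v (Suc n)
    else if wv v n then cw v (Suc n) else cw v n)" for v n and s :: nat
  define col where "col x = (case x of Wire v n \<Rightarrow> cw v n | Xor v n s \<Rightarrow> cx v n s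
    | Row k s \<Rightarrow> cr k s | Aux i j \<Rightarrow> even j)" for x
  have wv_Suc: "wv v (Suc n) \<longleftrightarrow> \<not> wv v n" for v n by (auto simp: wv_def)
  have nbW: "set (node_nb ls (Wire v n)) \<subseteq> Z" if "wv v n" "v \<in> lvars ls" "n < 2 * length ls" for v n
  proof -
    have "tv (n div 2) 0" if "tap ls v n"
    proof -
      have "2 * (n div 2) + side ls (n div 2) = n" using that by (metis tap_def mult_div_mod_eq)
      then show ?thesis using that \<open>wv v n\<close> by (simp add: tv_def y_def tap_def)
    qed
    then show ?thesis using that by (auto simp: Z_simps)
  qed
  have nbA: "set (node_nb ls (Aux i j)) \<subseteq> Z" if "b i j" "i < m" "j < 4" for i j
  proof -
    have "Suc (3 * i + l) div 3 = i" if "l < 2" for l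
      using that by presburger
    then show ?thesis using that length_ls by (cases j) (auto simp: Z_simps tv_def)
  qed
  have "good Z col"
    unfolding good_def
  proof (intro conjI ballI)
    show "Z \<subseteq> set (node_verts ls)" by (auto simp: Z_def)
    fix x x' assume x: "x \<in> set (node_verts ls)" "x' \<in> set (node_nb ls x)"
    show "x \<in> Z \<longrightarrow> x' \<notin> Z"
    proof (cases x)
      case (Xor v n s)
      then have "s < 3" using x by simp
      then show ?thesis using x Xor others_cases[of s] wv_Suc[of v n] by (auto simp: Z_simps split: if_splits)
    next
      case (Row k s)
      then have s: "s < 3" and k: "k < length ls" using x by simp_all
      from less_3_cases[OF s] show ?thesis
        by (elim disjE) (use x Row k tv[of k] in \<open>auto simp: others_def Z_simps\<close>)
    qed (auto simp: Z_simps)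
    show "x' \<notin> Z \<longrightarrow> x \<notin> Z \<longrightarrow> col x' \<noteq> col x"
    proof (cases x)
      case (Wire v n)
      then show ?thesis using x by (auto simp: col_def cx_def cw_def split: if_splits)
    next
      case (Xor v n s)
      then have "s < 3" using x by simp
      then show ?thesis using x Xor others_cases[of s] wv_Suc[of v n]
        by (auto simp: Z_simps col_def cx_def split: if_splits)
    next
      case (Row k s)
      then have s: "s < 3" and k: "k < length ls" using x by simp_all
      from less_3_cases[OF s] show ?thesis
        by (elim disjE) (use x Row k tv[of k] tap_side[of ls k] side_le[of ls k] in
          \<open>auto simp: others_def Z_simps col_def cr_def cw_def split: if_splits\<close>)
    next
      case (Aux i j)
      then show ?thesis using x by (cases j) (auto simp: col_def cr_def split: if_splits)
    qed
  next
    fix z assume z: "z \<in> Z"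
    show "length (node_nb ls z) = 3"
      using z others_cases by (cases z) (fastforce simp: Z_simps)+
    show "\<exists>w \<in> set (node_nb ls z). set (node_nb ls w) \<subseteq> Z"
    proof (cases z)
      case (Xor v n s)
      then have s: "s = 0 \<or> s = 1" "wv v (n + s)" "v \<in> lvars ls" "Suc n < 2 * length ls"
        using z by (auto simp: Z_simps)
      have "Wire v (n + s) \<in> set (node_nb ls z)" using s(1) by (auto simp: Xor)
      moreover have "set (node_nb ls (Wire v (n + s))) \<subseteq> Z" using s by (intro nbW) auto
      ultimately show ?thesis by blast
    next
      case (Row k s)
      then have s: "s < 3" "k < length ls" "tv k s" using z by (auto simp: Z_simps)
      have k: "2 * k + side ls k < 2 * length ls" "k div 3 < m"
        using s side_le[of ls k] length_ls by linarith+
      define w where "w = (if s = 0 then Wire (snd (el ls k)) (2 * k + side ls k)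
        else if s = 1 then Aux (k div 3) (k mod 3) else Aux (k div 3) (Suc (k mod 3)))"
      have "w \<in> set (node_nb ls z)" by (simp add: Row w_def)
      moreover have "set (node_nb ls w) \<subseteq> Z"
      proof -
        consider "s = 0" | "s = 1" | "s = 2" using less_3_cases[OF s(1)] by blast
        then show ?thesis
        proof cases
          case 1
          then have "wv (snd (el ls k)) (2 * k + side ls k)" using s(3) by (simp add: tv_def y_def)
          from nbW[OF this lvars_el[OF s(2)] k(1)] show ?thesis using 1 by (simp only: w_def if_P)
        next
          case 2
          then have "b (k div 3) (k mod 3)" using s(3) by (simp add: tv_def)
          from nbA[OF this k(2)] show ?thesis using 2 by (simp add: w_def del: node_nb.simps)
        next
          case 3
          then have "b (k div 3) (Suc (k mod 3))" using s(3) by (simp add: tv_def)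
          from nbA[OF this k(2)] show ?thesis using 3 by (simp add: w_def del: node_nb.simps)
        qed
      qed
      ultimately show ?thesis by blast
    qed (use z in \<open>auto simp: Z_simps\<close>)
  qed
  then show ?thesis by blast
qed

theorem labeling_iff_sat: "(\<exists>f. labeling_by_max 3 G f) \<longleftrightarrow> (\<exists>\<alpha>. sat \<alpha>)"
  using labeling_if_good good_if_labeling sat_if_good good_if_sat by blast

end

section \<open>Computations as satisfiability problems\<close>

text \<open>
  All clauses but those that leave the certificate open are Horn clauses which derive the facts
  about a configuration from those about the previous one. Hence every satisfying assignment makes
  all true facts about the run true, and it suffices to forbid the rejecting output. Cell \<open>i\<close> of a
  tape is addressed as \<open>N + i\<close>, where \<open>N\<close> is the number of steps. In \<open>St t s as\<close> the state \<open>s\<close> comes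
  with the symbols scanned on the first tapes, so that clauses of three literals suffice.
\<close>

datatype fact = St nat nat "nat list" | Hd nat nat nat | Ce nat nat nat nat | Sc nat nat nat | Ac nat nat nat nat

fun dir_num :: "dir \<Rightarrow> nat" where
  "dir_num Go_Left = 0" | "dir_num Stay = 1" | "dir_num Go_Right = 2"

definition imp2 :: "'v \<Rightarrow> 'v \<Rightarrow> 'v \<Rightarrow> (bool \<times> 'v) list" where
  "imp2 p q r = [(False, p), (False, q), (True, r)]"

text \<open>Repetition pads to exactly three literals, since the flattened list is cut into blocks
  of three.\<close>

definition unit_clause :: "'v \<Rightarrow> (bool \<times> 'v) list" where
  "unit_clause p = [(True, p), (True, p), (True, p)]"

text \<open>Idling in the halting state lets every run be described as one of exactly
  \<open>N\<close> steps.\<close>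

definition ntrans :: "tm \<Rightarrow> nat \<Rightarrow> nat list \<Rightarrow> nat \<times> (nat \<times> dir) list" where
  "ntrans M s as = (if s < states M then trans M s as else (s, map (\<lambda>a. (a, Stay)) as))"

definition table :: "tm \<Rightarrow> (nat \<times> nat list \<times> nat \<times> (nat \<times> nat) list) list" where
  "table M = concat (map (\<lambda>s. map (\<lambda>as. (s, as, fst (ntrans M s as),
       map (\<lambda>p. (fst p, dir_num (snd p))) (snd (ntrans M s as))))
     (List.n_lists (tapes M) [0..<symbols M])) [0..<Suc (states M)])"

text \<open>The \<open>q\<close> cells after \<open>pre\<close> are left open: each is blank or a
  bit, and a blank forces a blank to its right, so what they contain is a certificate of length at
  most \<open>q\<close> followed by blanks.\<close>

definition init_clauses :: "tm \<Rightarrow> bool list \<Rightarrow> nat \<Rightarrow> nat \<Rightarrow> (bool \<times> fact) list list" where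
  "init_clauses M pre q N =
     [unit_clause (St 0 0 [])] @
     map (\<lambda>j. unit_clause (Hd 0 j N)) [0..<tapes M] @
     concat (map (\<lambda>j. map (\<lambda>p. unit_clause (Ce 0 j p 0)) [0..<2 * N + 1]) [1..<tapes M]) @
     map (\<lambda>p. unit_clause (Ce 0 0 p 0)) [0..<N] @
     map (\<lambda>i. unit_clause (Ce 0 0 (N + i) (if el pre i then 2 else 1))) [0..<length pre] @
     map (\<lambda>i. [(True, Ce 0 0 (N + i) 0), (True, Ce 0 0 (N + i) 1), (True, Ce 0 0 (N + i) 2)])
       [length pre..<length pre + q] @
     map (\<lambda>i. imp2 (Ce 0 0 (N + i) 0) (Ce 0 0 (N + i) 0) (Ce 0 0 (N + Suc i) 0))
       [length pre..<length pre + q] @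
     map (\<lambda>p. unit_clause (Ce 0 0 p 0)) [N + length pre + q..<2 * N + 1]"

definition table_clauses :: "tm \<Rightarrow> nat \<Rightarrow> nat \<times> nat list \<times> nat \<times> (nat \<times> nat) list \<Rightarrow> (bool \<times> fact) list list" where
  "table_clauses M t e =
     map (\<lambda>i. imp2 (St t (fst e) (take i (fst (snd e)))) (Sc t i (el (fst (snd e)) i))
       (St t (fst e) (take (Suc i) (fst (snd e))))) [0..<tapes M] @
     [imp2 (St t (fst e) (fst (snd e))) (St t (fst e) (fst (snd e))) (St (Suc t) (fst (snd (snd e))) [])] @
     map (\<lambda>i. imp2 (St t (fst e) (fst (snd e))) (St t (fst e) (fst (snd e)))
       (Ac t i (fst (el (snd (snd (snd e))) i)) (snd (el (snd (snd (snd e))) i)))) [0..<tapes M]"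

text \<open>That a cell away from the head keeps its symbol is stated once for every other head
  position \<open>p'\<close>; so the clauses stay Horn and no negative fact has to be derived.
  Directions are numbered from 0, hence \<open>p + d - 1\<close>; its truncation at 0 does no harm,
  because before step \<open>N\<close> the head is still to the right of address 0.\<close>

definition tape_clauses :: "tm \<Rightarrow> nat \<Rightarrow> nat \<Rightarrow> nat \<Rightarrow> (bool \<times> fact) list list" where
  "tape_clauses M N t j = concat (map (\<lambda>p.
     map (\<lambda>a. imp2 (Hd t j p) (Ce t j p a) (Sc t j a)) [0..<symbols M] @
     concat (map (\<lambda>a. concat (map (\<lambda>d.
       [imp2 (Hd t j p) (Ac t j a d) (Ce (Suc t) j p a),
        imp2 (Hd t j p) (Ac t j a d) (Hd (Suc t) j (p + d - 1))]) [0, 1, 2])) [0..<symbols M]) @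
     concat (map (\<lambda>p'. map (\<lambda>a. imp2 (Hd t j p') (Ce t j p a) (Ce (Suc t) j p a)) [0..<symbols M])
       (filter (\<lambda>p'. p' \<noteq> p) [0..<2 * N + 1]))) [0..<2 * N + 1])"

text \<open>The last clause forbids symbol 1, the bit \<open>False\<close>, in cell 0 of the output
  tape after \<open>N\<close> steps.\<close>

definition run_clauses :: "tm \<Rightarrow> bool list \<Rightarrow> nat \<Rightarrow> nat \<Rightarrow> (bool \<times> fact) list list" where
  "run_clauses M pre q N = init_clauses M pre q N @
     concat (map (\<lambda>t. concat (map (\<lambda>e. table_clauses M t e) (table M)) @
       concat (map (\<lambda>j. tape_clauses M N t j) [0..<tapes M])) [0..<N]) @
     [[(False, Ce N (tapes M - 1) N 1), (False, Ce N (tapes M - 1) N 1), (False, Ce N (tapes M - 1) N 1)]]"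

definition satisfies :: "('v \<Rightarrow> bool) \<Rightarrow> (bool \<times> 'v) list list \<Rightarrow> bool" where
  "satisfies \<alpha> cs \<longleftrightarrow> (\<forall>c \<in> set cs. \<exists>l \<in> set c. fst l = \<alpha> (snd l))"

lemma satisfies_append [simp]: "satisfies \<alpha> (cs @ ds) \<longleftrightarrow> satisfies \<alpha> cs \<and> satisfies \<alpha> ds"
  by (auto simp: satisfies_def)

lemma satisfies_Cons [simp]:
  "satisfies \<alpha> (c # cs) \<longleftrightarrow> (\<exists>l \<in> set c. fst l = \<alpha> (snd l)) \<and> satisfies \<alpha> cs"
  "satisfies \<alpha> []"
  by (auto simp: satisfies_def)

lemma satisfies_concat: "satisfies \<alpha> (concat (map f xs)) \<longleftrightarrow> (\<forall>x \<in> set xs. satisfies \<alpha> (f x))"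
  by (auto simp: satisfies_def)

lemma satisfies_map: "satisfies \<alpha> (map f xs) \<longleftrightarrow> (\<forall>x \<in> set xs. \<exists>l \<in> set (f x). fst l = \<alpha> (snd l))"
  by (auto simp: satisfies_def)

lemma sat_imp2 [simp]: "(\<exists>l \<in> set (imp2 p q r). fst l = \<alpha> (snd l)) \<longleftrightarrow> (\<alpha> p \<longrightarrow> \<alpha> q \<longrightarrow> \<alpha> r)"
  by (auto simp: imp2_def)

lemma sat_unit_clause [simp]: "(\<exists>l \<in> set (unit_clause p). fst l = \<alpha> (snd l)) \<longleftrightarrow> \<alpha> p"
  by (auto simp: unit_clause_def)

lemmas sat_simps = satisfies_concat satisfies_map

section \<open>Clauses as closure conditions on the set of asserted facts\<close>

lemma init_clauses_iff:
  "satisfies \<alpha> (init_clauses M pre q N) \<longleftrightarrow>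
     \<alpha> (St 0 0 []) \<and> (\<forall>j < tapes M. \<alpha> (Hd 0 j N)) \<and>
     (\<forall>j \<in> {1..<tapes M}. \<forall>p \<le> 2 * N. \<alpha> (Ce 0 j p 0)) \<and> (\<forall>p < N. \<alpha> (Ce 0 0 p 0)) \<and>
     (\<forall>i < length pre. \<alpha> (Ce 0 0 (N + i) (if pre ! i then 2 else 1))) \<and>
     (\<forall>i \<in> {length pre..<length pre + q}.
        \<alpha> (Ce 0 0 (N + i) 0) \<or> \<alpha> (Ce 0 0 (N + i) 1) \<or> \<alpha> (Ce 0 0 (N + i) 2)) \<and>
     (\<forall>i \<in> {length pre..<length pre + q}. \<alpha> (Ce 0 0 (N + i) 0) \<longrightarrow> \<alpha> (Ce 0 0 (N + Suc i) 0)) \<and>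
     (\<forall>p \<in> {N + length pre + q..2 * N}. \<alpha> (Ce 0 0 p 0))"
  unfolding init_clauses_def by (simp add: sat_simps el_nth less_Suc_eq_le Ball_def del: upt_Suc)

lemma table_clauses_iff:
  "satisfies \<alpha> (table_clauses M t (s, as, s', acts)) \<longleftrightarrow>
     (\<forall>i < tapes M. \<alpha> (St t s (take i as)) \<longrightarrow> \<alpha> (Sc t i (el as i)) \<longrightarrow> \<alpha> (St t s (take (Suc i) as))) \<and>
     (\<alpha> (St t s as) \<longrightarrow> \<alpha> (St (Suc t) s' []) \<and> (\<forall>i < tapes M. \<alpha> (Ac t i (fst (el acts i)) (snd (el acts i)))))"
  unfolding table_clauses_def by (auto simp: sat_simps)

lemma tape_clauses_iff:
  "satisfies \<alpha> (tape_clauses M N t j) \<longleftrightarrow> (\<forall>p \<le> 2 * N. \<forall>a < symbols M.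
     (\<alpha> (Hd t j p) \<longrightarrow> \<alpha> (Ce t j p a) \<longrightarrow> \<alpha> (Sc t j a)) \<and>
     (\<forall>d < 3. \<alpha> (Hd t j p) \<longrightarrow> \<alpha> (Ac t j a d) \<longrightarrow> \<alpha> (Ce (Suc t) j p a) \<and> \<alpha> (Hd (Suc t) j (p + d - 1))) \<and>
     (\<forall>p' \<le> 2 * N. p' \<noteq> p \<longrightarrow> \<alpha> (Hd t j p') \<longrightarrow> \<alpha> (Ce t j p a) \<longrightarrow> \<alpha> (Ce (Suc t) j p a)))"
proof -
  have 3: "(\<forall>d < 3. P d) \<longleftrightarrow> P 0 \<and> P 1 \<and> P 2" for P :: "nat \<Rightarrow> bool"
    by (auto dest!: less_3_cases)
  show ?thesis
    unfolding tape_clauses_def 3 by (auto simp: sat_simps less_Suc_eq_le simp del: upt_Suc)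
qed

lemma ntrans_wf:
  assumes "wf_tm M" "s \<le> states M" "length as = tapes M" "set as \<subseteq> {..<symbols M}"
  shows "fst (ntrans M s as) \<le> states M" "length (snd (ntrans M s as)) = tapes M"
    "j < tapes M \<Longrightarrow> fst (snd (ntrans M s as) ! j) < symbols M"
proof -
  have "fst (ntrans M s as) \<le> states M \<and> length (snd (ntrans M s as)) = tapes M \<and>
      fst ` set (snd (ntrans M s as)) \<subseteq> {..<symbols M}"
  proof (cases "s < states M")
    case True
    have "case trans M s as of (s', acts) \<Rightarrow>
        s' \<le> states M \<and> length acts = tapes M \<and> fst ` set acts \<subseteq> {..<symbols M}"
      using assms(1)[unfolded wf_tm_def, THEN conjunct2, THEN conjunct2, rule_format, OF True, of as] assms(3,4)
      by simp
    then show ?thesis using True by (cases "trans M s as") (simp add: ntrans_def)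
  next
    case False
    then show ?thesis using assms by (auto simp: ntrans_def)
  qed
  then show "fst (ntrans M s as) \<le> states M" "length (snd (ntrans M s as)) = tapes M"
    "j < tapes M \<Longrightarrow> fst (snd (ntrans M s as) ! j) < symbols M"
    by (auto simp: image_subset_iff)
qed

lemma step_ntrans:
  assumes "s \<le> states M"
  shows "step M (s, ts) = (fst (ntrans M s (map scan ts)), map2 act (snd (ntrans M s (map scan ts))) ts)"
proof -
  have sc: "map (\<lambda>(c, h). c h) ts = map scan ts"
    by (auto simp: scan_def)
  show ?thesis
  proof (cases "s < states M")
    case True
    then show ?thesis by (auto simp: ntrans_def sc split: prod.split)
  next
    case False
    have "map2 act (map (\<lambda>a. (a, Stay)) (map scan ts)) ts = ts"
      by (induction ts) auto
    with False show ?thesis using assms by (simp add: ntrans_def)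
  qed
qed

section \<open>The actual run and the assignment read off it\<close>

locale run =
  fixes M :: tm and y :: "bool list"
  assumes wf: "wf_tm M"
begin

abbreviation "k \<equiv> tapes M"

definition st :: "nat \<Rightarrow> nat" where
  "st t = fst ((step M ^^ t) (initial M y))"

definition tp :: "nat \<Rightarrow> nat \<Rightarrow> tape" where
  "tp t j = snd ((step M ^^ t) (initial M y)) ! j"

definition scans :: "nat \<Rightarrow> nat list" where
  "scans t = map (\<lambda>j. scan (tp t j)) [0..<k]"

definition acts :: "nat \<Rightarrow> (nat \<times> dir) list" where
  "acts t = snd (ntrans M (st t) (scans t))"

lemma k_pos: "k \<ge> 1" and symbols_ge: "symbols M \<ge> 3"
  using wf by (auto simp: wf_tm_def)

text \<open>A single induction yields all of these facts: the step after \<open>t\<close> can be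
  described only once the configuration at \<open>t\<close> is known to have \<open>k\<close> tapes
  and legal symbols. The bound on the head shows that a window of radius \<open>N\<close> is wide
  enough for \<open>N\<close> steps.\<close>

lemma invariant:
  "(step M ^^ t) (initial M y) = (st t, map (tp t) [0..<k]) \<and> st t \<le> states M \<and>
   (\<forall>j < k. (\<forall>i. fst (tp t j) i < symbols M) \<and> \<bar>snd (tp t j)\<bar> \<le> int t)" (is "?I t")
  and st_Suc: "st (Suc t) = fst (ntrans M (st t) (scans t))"
  and tp_Suc: "j < k \<Longrightarrow> tp (Suc t) j = act (acts t ! j) (tp t j)"
  and acts_wf: "length (acts t) = k" "j < k \<Longrightarrow> fst (acts t ! j) < symbols M"
proof -
  have *: "st (Suc t) = fst (ntrans M (st t) (scans t)) \<and> (\<forall>j < k. tp (Suc t) j = act (acts t ! j) (tp t j)) \<and>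
      length (acts t) = k \<and> (\<forall>j < k. fst (acts t ! j) < symbols M) \<and> ?I (Suc t)" if I: "?I t" for t
  proof -
    have sc: "map scan (map (tp t) [0..<k]) = scans t" by (simp add: scans_def)
    have s: "set (scans t) \<subseteq> {..<symbols M}" "length (scans t) = k"
      using I by (auto simp: scans_def scan_def)
    note w = ntrans_wf[OF wf _ s(2,1), of "st t"]
    have "(step M ^^ Suc t) (initial M y) = step M (st t, map (tp t) [0..<k])"
      using I by simp
    also have "\<dots> = (fst (ntrans M (st t) (scans t)), map2 act (acts t) (map (tp t) [0..<k]))"
      using I step_ntrans[of "st t" M "map (tp t) [0..<k]"] unfolding sc by (simp add: acts_def)
    finally have st: "(step M ^^ Suc t) (initial M y) = \<dots>" .
    have l: "length (acts t) = k" and sy: "\<And>j. j < k \<Longrightarrow> fst (acts t ! j) < symbols M"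
      using w I by (simp_all add: acts_def)
    have 1: "st (Suc t) = fst (ntrans M (st t) (scans t))"
      unfolding st_def[of "Suc t"] st by simp
    have 2: "tp (Suc t) j = act (acts t ! j) (tp t j)" if "j < k" for j
      unfolding tp_def[of "Suc t"] st using that l by simp
    have "map2 act (acts t) (map (tp t) [0..<k]) = map (tp (Suc t)) [0..<k]"
      by (rule nth_equalityI) (use l 2 in auto)
    moreover have "(\<forall>i. fst (tp (Suc t) j) i < symbols M) \<and> \<bar>snd (tp (Suc t) j)\<bar> \<le> int (Suc t)" if "j < k" for j
    proof -
      obtain c h a d where ch: "tp t j = (c, h)" "acts t ! j = (a, d)" by (metis surj_pair)
      have "a < symbols M" "\<forall>i. c i < symbols M" "\<bar>h\<bar> \<le> int t"
        using sy[OF that] I that ch by auto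
      then show ?thesis using 2[OF that] ch by (cases d) auto
    qed
    ultimately show ?thesis using 1 2 l sy w(1) I st by auto
  qed
  have 0: "?I 0"
  proof (intro conjI allI impI)
    have snd: "snd (initial M y) = (cells y, 0) # replicate (k - 1) (\<lambda>_. 0, 0)"
      by (simp add: initial_def)
    have "map (tp 0) [0..<k] = snd (initial M y)"
      by (rule nth_equalityI) (use k_pos in \<open>auto simp: tp_def snd\<close>)
    then show "(step M ^^ 0) (initial M y) = (st 0, map (tp 0) [0..<k])"
      by (simp add: st_def)
    show "st 0 \<le> states M" by (simp add: st_def initial_def)
    fix j assume "j < k"
    then have "tp 0 j = (cells y, 0) \<or> tp 0 j = (\<lambda>_. 0, 0)"
      by (cases j) (auto simp: tp_def snd)
    then show "fst (tp 0 j) i < symbols M" "\<bar>snd (tp 0 j)\<bar> \<le> int 0" for i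
      using symbols_ge by (auto simp: cells_def)
  qed
  show I: "?I t"
    by (induction t) (use 0 * in blast)+
  show "st (Suc t) = fst (ntrans M (st t) (scans t))" "j < k \<Longrightarrow> tp (Suc t) j = act (acts t ! j) (tp t j)"
    "length (acts t) = k" "j < k \<Longrightarrow> fst (acts t ! j) < symbols M"
    using *[OF I] by blast+
qed

lemma scans_wf: "length (scans t) = k" "set (scans t) \<subseteq> {..<symbols M}" "st t \<le> states M"
  using invariant[of t] by (auto simp: scans_def scan_def)

lemma tp_0: "tp 0 0 = (cells y, 0)" "0 < j \<Longrightarrow> j < k \<Longrightarrow> tp 0 j = (\<lambda>_. 0, 0)"
  by (simp_all add: tp_def initial_def nth_Cons')

lemma head_bound: "j < k \<Longrightarrow> \<bar>snd (tp t j)\<bar> \<le> int t"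
  and cell_bound: "j < k \<Longrightarrow> fst (tp t j) i < symbols M"
  using invariant[of t] by auto

lemma table_entry:
  "(st t, scans t, st (Suc t), map (\<lambda>p. (fst p, dir_num (snd p))) (acts t)) \<in> set (table M)"
  unfolding table_def using scans_wf[of t]
  by (auto simp: set_n_lists st_Suc acts_def intro!: bexI[of _ "st t"] image_eqI[of _ _ "scans t"])

text \<open>A halted configuration is a fixed point of \<open>step\<close>, so the output is still
  there after exactly \<open>N\<close> steps.\<close>

lemma final:
  assumes "computes_in_time M f p" "p (length y) \<le> N"
  shows "fst (tp N (k - 1)) = cells (f y)"
proof -
  obtain t where t: "t \<le> p (length y)" "case (step M ^^ t) (initial M y) of (s, ts) \<Rightarrow>
      s = states M \<and> fst (last ts) = cells (f y)"
    using assms(1)[unfolded computes_in_time_def, THEN spec, of y] by (elim exE conjE)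
  obtain ts where ts: "(step M ^^ t) (initial M y) = (states M, ts)" "fst (last ts) = cells (f y)"
    using t(2) by (cases "(step M ^^ t) (initial M y)") simp
  have "(step M ^^ n) (states M, ts) = (states M, ts)" for n
    by (induction n) auto
  then have "(step M ^^ (N - t + t)) (initial M y) = (states M, ts)"
    by (simp only: funpow_add o_apply ts)
  then have "(step M ^^ N) (initial M y) = (states M, ts)"
    using t(1) assms(2) by simp
  then have "last ts = tp N (k - 1)"
    using invariant[of N] k_pos by (auto simp: last_map)
  with ts show ?thesis by simp
qed

definition holds :: "nat \<Rightarrow> fact \<Rightarrow> bool" where
  "holds N v = (case v of
     St t s as \<Rightarrow> s = st t \<and> as = take (length as) (scans t)
   | Hd t j p \<Rightarrow> snd (tp t j) = int p - int N
   | Ce t j p a \<Rightarrow> a = fst (tp t j) (int p - int N)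
   | Sc t j a \<Rightarrow> a = scan (tp t j)
   | Ac t j a d \<Rightarrow> a = fst (acts t ! j) \<and> d = dir_num (snd (acts t ! j)))"

lemma satisfies_tables: "satisfies (holds N) (table_clauses M t e)" if e: "e \<in> set (table M)"
proof -
  obtain s as where as: "length as = k" "s \<le> states M"
    "e = (s, as, fst (ntrans M s as), map (\<lambda>p. (fst p, dir_num (snd p))) (snd (ntrans M s as)))"
    using e unfolding table_def by (auto simp: set_n_lists less_Suc_eq_le simp del: upt_Suc)
  have 1: "take (Suc i) as = take (Suc i) (scans t)"
    if "i < k" "take i as = take i (scans t)" "el as i = scan (tp t i)" for i
    using that as(1) scans_wf(1)[of t] by (simp add: take_Suc_conv_app_nth el_nth) (simp add: scans_def)
  have 2: "el (map (\<lambda>p. (fst p, dir_num (snd p))) (acts t)) i = (fst (acts t ! i), dir_num (snd (acts t ! i)))"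
    if "i < k" for i
    using that acts_wf(1)[of t] by (simp add: el_nth)
  show ?thesis
    unfolding as(3) table_clauses_iff using as(1) 1 2 scans_wf(1)[of t]
    by (auto simp: holds_def st_Suc acts_def)
qed

lemma satisfies_tapes: "satisfies (holds N) (tape_clauses M N t j)" if "t < N" "j < k"
proof -
  obtain c h a d where ch: "tp t j = (c, h)" "acts t ! j = (a, d)" by (metis surj_pair)
  have "\<bar>h\<bar> \<le> int t" using head_bound[OF that(2), of t] ch by simp
  have "move d (int p - int N) = int (p + dir_num d - 1) - int N" if "h = int p - int N" for p
    using that \<open>\<bar>h\<bar> \<le> int t\<close> \<open>t < N\<close> by (cases d) auto
  then show ?thesis
    unfolding tape_clauses_iff using ch tp_Suc[OF that(2), of t] by (auto simp: holds_def scan_def)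
qed

end

text \<open>The assignment that asserts precisely the true facts obeys every rule, and since the
  answer is \<open>[True]\<close> the one forbidden fact is false.\<close>

lemma satisfies_run:
  assumes M: "wf_tm M" "computes_in_time M f p" and u: "length u \<le> q"
    and N: "p (length (pre @ u)) \<le> N"
    and f: "f (pre @ u) = [True]"
  shows "satisfies (run.holds M (pre @ u) N) (run_clauses M pre q N)"
proof -
  interpret run M "pre @ u" by unfold_locales (rule M)
  have "satisfies (holds N) (init_clauses M pre q N)"
    unfolding init_clauses_iff
  proof (intro conjI)
    show "holds N (St 0 0 [])" by (simp add: holds_def st_def initial_def)
    show "\<forall>j < k. holds N (Hd 0 j N)"
      using tp_0 by (auto simp: holds_def) (metis not_gr_zero snd_conv)
    show "\<forall>j \<in> {1..<k}. \<forall>p \<le> 2 * N. holds N (Ce 0 j p 0)"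
      using tp_0(2) by (auto simp: holds_def)
    show "\<forall>p < N. holds N (Ce 0 0 p 0)"
      by (auto simp: holds_def tp_0 cells_def)
    show "\<forall>i < length pre. holds N (Ce 0 0 (N + i) (if pre ! i then 2 else 1))"
      by (auto simp: holds_def tp_0 cells_def nth_append)
    show "\<forall>i \<in> {length pre..<length pre + q}. holds N (Ce 0 0 (N + i) 0) \<or> holds N (Ce 0 0 (N + i) 1) \<or> holds N (Ce 0 0 (N + i) 2)"
      by (auto simp: holds_def tp_0 cells_def)
    show "\<forall>i \<in> {length pre..<length pre + q}. holds N (Ce 0 0 (N + i) 0) \<longrightarrow> holds N (Ce 0 0 (N + Suc i) 0)"
      by (auto simp: holds_def tp_0 cells_def)
    show "\<forall>p \<in> {N + length pre + q..2 * N}. holds N (Ce 0 0 p 0)"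
      using u by (auto simp: holds_def tp_0 cells_def)
  qed
  moreover have "\<not> holds N (Ce N (k - 1) N 1)"
    using final[OF M(2) N] f by (simp add: holds_def cells_def)
  ultimately show ?thesis
    unfolding run_clauses_def using satisfies_tables satisfies_tapes by (auto simp: sat_simps)
qed

text \<open>An assignment may assert several symbols for one cell. The certificate ends at the first
  cell asserted blank, or after \<open>q\<close> cells; before that each cell is asserted 1 or 2,
  and reading it as \<open>True\<close> exactly if 2 is asserted makes the chosen symbol an asserted
  one.\<close>

lemma certificate_of_satisfying:
  assumes sat: "satisfies \<alpha> (init_clauses M pre q N)" and N: "length pre + q \<le> N"
  obtains u where "length u \<le> q" "\<And>p. p \<le> 2 * N \<Longrightarrow> \<alpha> (Ce 0 0 p (cells (pre @ u) (int p - int N)))"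
proof -
  define l where "l = (LEAST l. l = q \<or> \<alpha> (Ce 0 0 (N + length pre + l) 0))"
  have l: "l = q \<or> \<alpha> (Ce 0 0 (N + length pre + l) 0)"
    unfolding l_def by (rule LeastI[of _ q]) simp
  have l_le: "l \<le> q" unfolding l_def by (rule Least_le) simp
  have before: "\<not> \<alpha> (Ce 0 0 (N + length pre + i) 0)" if "i < l" for i
    using not_less_Least[of i "\<lambda>l. l = q \<or> \<alpha> (Ce 0 0 (N + length pre + l) 0)"] that
    unfolding l_def by blast
  define u where "u = map (\<lambda>i. \<alpha> (Ce 0 0 (N + length pre + i) 2)) [0..<l]"
  have s: "\<And>p. p < N \<Longrightarrow> \<alpha> (Ce 0 0 p 0)"
    "\<And>i. i < length pre \<Longrightarrow> \<alpha> (Ce 0 0 (N + i) (if pre ! i then 2 else 1))"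
    "\<And>i. length pre \<le> i \<Longrightarrow> i < length pre + q \<Longrightarrow>
       \<alpha> (Ce 0 0 (N + i) 0) \<or> \<alpha> (Ce 0 0 (N + i) 1) \<or> \<alpha> (Ce 0 0 (N + i) 2)"
    "\<And>i. length pre \<le> i \<Longrightarrow> i < length pre + q \<Longrightarrow> \<alpha> (Ce 0 0 (N + i) 0) \<Longrightarrow> \<alpha> (Ce 0 0 (N + Suc i) 0)"
    "\<And>p. N + length pre + q \<le> p \<Longrightarrow> p \<le> 2 * N \<Longrightarrow> \<alpha> (Ce 0 0 p 0)"
    using sat unfolding init_clauses_iff by auto
  have "\<alpha> (Ce 0 0 (N + length pre + l) 0)"
    using l s(5)[of "N + length pre + q"] N by auto
  have after: "\<alpha> (Ce 0 0 (N + length pre + (l + i)) 0)" if "l + i \<le> q" for i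
    using that
  proof (induction i)
    case 0
    then show ?case using \<open>\<alpha> (Ce 0 0 (N + length pre + l) 0)\<close> by simp
  next
    case (Suc i)
    then show ?case using s(4)[of "length pre + (l + i)"] by (simp add: add.assoc)
  qed
  show thesis
  proof (rule that[of u])
    show "length u \<le> q" using l_le by (simp add: u_def)
    fix p assume p: "p \<le> 2 * N"
    consider "p < N" | "N \<le> p" "p < N + length pre" | "N + length pre \<le> p" "p < N + length pre + l"
      | "N + length pre + l \<le> p" "p \<le> N + length pre + q" | "N + length pre + q < p"
      by linarith
    then show "\<alpha> (Ce 0 0 p (cells (pre @ u) (int p - int N)))"
    proof cases
      case 1
      then show ?thesis using s(1) by (simp add: cells_def)
    next
      case 2
      obtain i where i: "p = N + i" using le_Suc_ex[OF 2(1)] by blast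
      with 2(2) have "i < length pre" by linarith
      with i show ?thesis using s(2)[of i] by (simp add: cells_def nth_append)
    next
      case 3
      obtain i where i: "p = N + length pre + i" using le_Suc_ex[OF 3(1)] by blast
      with 3(2) have "i < l" by linarith
      note 3 = i this
      have "\<alpha> (Ce 0 0 p 1) \<or> \<alpha> (Ce 0 0 p 2)"
        using 3 s(3)[of "length pre + i"] before[of i] l_le by (simp add: add.assoc)
      moreover have "cells (pre @ u) (int p - int N) = (if u ! i then 2 else 1)"
        using 3 by (simp add: cells_def nth_append u_def nat_int_add)
      ultimately show ?thesis using 3 by (auto simp: u_def)
    next
      case 4
      obtain i where i: "p = N + length pre + l + i" using le_Suc_ex[OF 4(1)] by blast
      with 4(2) have "l + i \<le> q" by linarith
      with i show ?thesis using after[of i] by (simp add: cells_def u_def add.assoc)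
    next
      case 5
      then show ?thesis using s(5) p l_le by (simp add: cells_def u_def)
    qed
  qed
qed

text \<open>By induction on time every true fact of the run on the extracted certificate is
  asserted; false ones may be asserted as well. The certificate may be shorter than
  \<open>q\<close>, and \<open>mono p\<close> keeps its running time within
  \<open>N\<close>.\<close>

lemma accepted_of_satisfying:
  assumes M: "wf_tm M" "computes_in_time M (\<lambda>x. [x \<in> R]) p" "mono p"
    and N: "p (length pre + q) \<le> N" "length pre + q \<le> N"
    and sat: "satisfies \<alpha> (run_clauses M pre q N)"
  obtains u where "length u \<le> q" "pre @ u \<in> R"
proof -
  have sat_init: "satisfies \<alpha> (init_clauses M pre q N)"
    and tables: "\<And>t e. t < N \<Longrightarrow> e \<in> set (table M) \<Longrightarrow> satisfies \<alpha> (table_clauses M t e)"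
    and tps: "\<And>t j. t < N \<Longrightarrow> j < tapes M \<Longrightarrow> satisfies \<alpha> (tape_clauses M N t j)"
    and acc: "\<not> \<alpha> (Ce N (tapes M - 1) N 1)"
    using sat unfolding run_clauses_def by (auto simp: sat_simps)
  obtain u where u: "length u \<le> q" "\<And>p. p \<le> 2 * N \<Longrightarrow> \<alpha> (Ce 0 0 p (cells (pre @ u) (int p - int N)))"
    using certificate_of_satisfying[OF sat_init N(2)] by blast
  interpret run M "pre @ u" by unfold_locales (rule M)
  have main: "\<alpha> (St t (st t) []) \<and> (\<forall>j < k. \<alpha> (Hd t j (nat (snd (tp t j) + int N))) \<and>
      (\<forall>p \<le> 2 * N. \<alpha> (Ce t j p (fst (tp t j) (int p - int N)))))" if "t \<le> N" for t
    using that
  proof (induction t)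
    case 0
    have "\<alpha> (Hd 0 j (nat (snd (tp 0 j) + int N)))" "p \<le> 2 * N \<Longrightarrow> \<alpha> (Ce 0 j p (fst (tp 0 j) (int p - int N)))"
      if "j < k" for j p
      using sat_init[unfolded init_clauses_iff] u(2)[of p] that tp_0 by (cases "j = 0"; simp)+
    then show ?case using sat_init[unfolded init_clauses_iff] by (simp add: st_def initial_def)
  next
    case (Suc t)
    then have t: "t < N" and St: "\<alpha> (St t (st t) [])"
      and Hd: "\<And>j. j < k \<Longrightarrow> \<alpha> (Hd t j (nat (snd (tp t j) + int N)))"
      and Ce: "\<And>j p. j < k \<Longrightarrow> p \<le> 2 * N \<Longrightarrow> \<alpha> (Ce t j p (fst (tp t j) (int p - int N)))"
      by auto
    have pos: "nat (snd (tp t j) + int N) \<le> 2 * N" "int (nat (snd (tp t j) + int N)) - int N = snd (tp t j)"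
      "0 < nat (snd (tp t j) + int N)" if "j < k" for j
      using head_bound[OF that, of t] t by auto
    have tape: "(\<forall>p \<le> 2 * N. \<forall>a < symbols M.
       (\<alpha> (Hd t j p) \<longrightarrow> \<alpha> (Ce t j p a) \<longrightarrow> \<alpha> (Sc t j a)) \<and>
       (\<forall>d < 3. \<alpha> (Hd t j p) \<longrightarrow> \<alpha> (Ac t j a d) \<longrightarrow> \<alpha> (Ce (Suc t) j p a) \<and> \<alpha> (Hd (Suc t) j (p + d - 1))) \<and>
       (\<forall>p' \<le> 2 * N. p' \<noteq> p \<longrightarrow> \<alpha> (Hd t j p') \<longrightarrow> \<alpha> (Ce t j p a) \<longrightarrow> \<alpha> (Ce (Suc t) j p a)))"
      if "j < k" for j
      using tps[OF t that] unfolding tape_clauses_iff .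
    have Sc: "\<alpha> (Sc t j (scan (tp t j)))" if "j < k" for j
      using tape[OF that] Hd[OF that] Ce[OF that pos(1)[OF that]] pos[OF that] cell_bound[OF that]
      by (auto simp: scan_def)
    note tab = tables[OF t table_entry[of t], unfolded table_clauses_iff]
    have "\<alpha> (St t (st t) (take i (scans t)))" if "i \<le> k" for i
      using that
    proof (induction i)
      case (Suc i)
      then show ?case using tab Sc[of i] scans_wf(1)[of t] by (auto simp: el_nth scans_def)
    qed (simp add: St)
    from this[of k] have full: "\<alpha> (St t (st t) (scans t))"
      using scans_wf(1)[of t] by simp
    have St': "\<alpha> (St (Suc t) (st (Suc t)) [])" using tab full by blast
    have Ac: "\<alpha> (Ac t j (fst (acts t ! j)) (dir_num (snd (acts t ! j))))" if "j < k" for j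
      using tab full that acts_wf(1)[of t] by (auto simp: el_nth)
    have "\<alpha> (Hd (Suc t) j (nat (snd (tp (Suc t) j) + int N))) \<and>
        (\<forall>p \<le> 2 * N. \<alpha> (Ce (Suc t) j p (fst (tp (Suc t) j) (int p - int N))))" if j: "j < k" for j
    proof -
      obtain c h a d where ch: "tp t j = (c, h)" "acts t ! j = (a, d)" by (metis surj_pair)
      let ?p = "nat (h + int N)"
      have p: "?p \<le> 2 * N" "int ?p - int N = h" "0 < ?p" using pos[OF j] ch by auto
      have a: "a < symbols M" using acts_wf(2)[OF j, of t] ch by simp
      have "dir_num d < 3" by (cases d) auto
      then have new: "\<alpha> (Ce (Suc t) j ?p a)" "\<alpha> (Hd (Suc t) j (?p + dir_num d - 1))"
        using tape[OF j] p(1) a Hd[OF j] Ac[OF j] ch by auto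
      have "nat (snd (tp (Suc t) j) + int N) = ?p + dir_num d - 1"
        using p tp_Suc[OF j, of t] ch by (cases d) auto
      moreover have "\<alpha> (Ce (Suc t) j r (fst (tp (Suc t) j) (int r - int N)))" if r: "r \<le> 2 * N" for r
      proof (cases "r = ?p")
        case True
        then show ?thesis using new(1) p tp_Suc[OF j, of t] ch by auto
      next
        case False
        then have "int r - int N \<noteq> h" by auto
        then have "fst (tp (Suc t) j) (int r - int N) = c (int r - int N)"
          using tp_Suc[OF j, of t] ch by auto
        moreover have "\<alpha> (Ce t j r (c (int r - int N)))" "c (int r - int N) < symbols M"
          using Ce[OF j r] cell_bound[OF j, of t] ch by auto
        ultimately show ?thesis
          using tape[OF j] r False p(1) Hd[OF j] ch by auto
      qed
      ultimately show ?thesis using new(2) by simp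
    qed
    with St' show ?case by blast
  qed
  \<comment> \<open>Address \<open>N\<close> is cell 0 of the output tape. Its true content is
    asserted, and in a rejecting run this would be the symbol 1 that the last clause
    excludes.\<close>
  have "k - 1 < k" using k_pos by simp
  with main[of N] have "\<alpha> (Ce N (k - 1) N (fst (tp N (k - 1)) 0))"
    by (metis (no_types, lifting) diff_self le_add2 mult_2 order_refl)
  moreover have "p (length (pre @ u)) \<le> N"
    using N(1) monoD[OF M(3), of "length (pre @ u)" "length pre + q"] u(1) by simp
  ultimately have "pre @ u \<in> R"
    using acc final[OF M(2)] by (auto simp: cells_def split: if_splits)
  then show thesis using that u(1) by blast
qed

section \<open>The reduction in polynomial time\<close>

lemma fp_el: "fp xs \<Longrightarrow> fp n \<Longrightarrow> fp (\<lambda>e. el (xs e) (n e))"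
  unfolding el_def by (intro fp_intros)

instantiation fact :: enc
begin
fun fact_tuple :: "fact \<Rightarrow> nat \<times> nat list" where
  "fact_tuple (St t s as) = (0, t # s # as)"
| "fact_tuple (Hd t j p) = (1, [t, j, p])"
| "fact_tuple (Ce t j p a) = (2, [t, j, p, a])"
| "fact_tuple (Sc t j a) = (3, [t, j, a])"
| "fact_tuple (Ac t j a d) = (4, [t, j, a, d])"
definition "enc (v :: fact) = enc (fact_tuple v)"
instance
proof
  show "enc x = enc y \<longleftrightarrow> x = y" for x y :: fact
    by (cases x; cases y) (auto simp: enc_fact_def enc_inject simp del: enc_prod.simps)
qed
end

lemma fp_fact_constructors:
  "fp t \<Longrightarrow> fp s \<Longrightarrow> fp as \<Longrightarrow> fp (\<lambda>e. St (t e) (s e) (as e))"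
  "fp t \<Longrightarrow> fp j \<Longrightarrow> fp p \<Longrightarrow> fp (\<lambda>e. Hd (t e) (j e) (p e))"
  "fp t \<Longrightarrow> fp j \<Longrightarrow> fp p \<Longrightarrow> fp a \<Longrightarrow> fp (\<lambda>e. Ce (t e) (j e) (p e) (a e))"
  "fp t \<Longrightarrow> fp j \<Longrightarrow> fp a \<Longrightarrow> fp (\<lambda>e. Sc (t e) (j e) (a e))"
  "fp t \<Longrightarrow> fp j \<Longrightarrow> fp a \<Longrightarrow> fp d \<Longrightarrow> fp (\<lambda>e. Ac (t e) (j e) (a e) (d e))"
proof -
  show "fp (\<lambda>e. St (t e) (s e) (as e))" if "fp t" "fp s" "fp as"
    by (rule fp_enc_cong[of "\<lambda>e. (0 :: nat, t e # s e # as e)"])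
      (simp_all add: enc_fact_def fp_pair fp_const fp_Cons that del: enc_prod.simps)
  show "fp (\<lambda>e. Hd (t e) (j e) (p e))" if "fp t" "fp j" "fp p"
    by (rule fp_enc_cong[of "\<lambda>e. (1 :: nat, [t e, j e, p e])"])
      (simp_all add: enc_fact_def fp_pair fp_const fp_Cons that del: enc_prod.simps)
  show "fp (\<lambda>e. Ce (t e) (j e) (p e) (a e))" if "fp t" "fp j" "fp p" "fp a"
    by (rule fp_enc_cong[of "\<lambda>e. (2 :: nat, [t e, j e, p e, a e])"])
      (simp_all add: enc_fact_def fp_pair fp_const fp_Cons that del: enc_prod.simps)
  show "fp (\<lambda>e. Sc (t e) (j e) (a e))" if "fp t" "fp j" "fp a"
    by (rule fp_enc_cong[of "\<lambda>e. (3 :: nat, [t e, j e, a e])"])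
      (simp_all add: enc_fact_def fp_pair fp_const fp_Cons that del: enc_prod.simps)
  show "fp (\<lambda>e. Ac (t e) (j e) (a e) (d e))" if "fp t" "fp j" "fp a" "fp d"
    by (rule fp_enc_cong[of "\<lambda>e. (4 :: nat, [t e, j e, a e, d e])"])
      (simp_all add: enc_fact_def fp_pair fp_const fp_Cons that del: enc_prod.simps)
qed

text \<open>\<open>M\<close> is fixed, so its transition table, although given by an arbitrary
  function, is a constant list.\<close>

lemma fp_run_clauses: "fp (\<lambda>e. run_clauses M (fst e) (fst (snd e)) (snd (snd e)))"
  unfolding run_clauses_def init_clauses_def table_clauses_def tape_clauses_def imp2_def unit_clause_def
  by (intro fp_intros fp_el fp_fact_constructors)

instantiation node :: (enc) enc
begin
fun node_tuple :: "'a node \<Rightarrow> nat \<times> 'a list \<times> nat \<times> nat" where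
  "node_tuple (Wire v n) = (0, [v], n, 0)"
| "node_tuple (Xor v n s) = (1, [v], n, s)"
| "node_tuple (Row k s) = (2, [], k, s)"
| "node_tuple (Aux i r) = (3, [], i, r)"
definition "enc (v :: 'a node) = enc (node_tuple v)"
instance
proof
  show "enc x = enc y \<longleftrightarrow> x = y" for x y :: "'a node"
    by (cases x; cases y) (auto simp: enc_node_def enc_inject simp del: enc_prod.simps)
qed
end

lemma fp_node_tuple: "fp x \<Longrightarrow> fp (\<lambda>e. node_tuple (x e))"
  by (erule fp_enc_cong) (simp add: enc_node_def)

lemma fp_node_constructors:
  "fp v \<Longrightarrow> fp n \<Longrightarrow> fp (\<lambda>e. Wire (v e) (n e))"
  "fp v \<Longrightarrow> fp n \<Longrightarrow> fp s \<Longrightarrow> fp (\<lambda>e. Xor (v e) (n e) (s e))"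
  "fp n \<Longrightarrow> fp s \<Longrightarrow> fp (\<lambda>e. Row (n e) (s e) :: 'a::enc node)"
  "fp n \<Longrightarrow> fp s \<Longrightarrow> fp (\<lambda>e. Aux (n e) (s e) :: 'a::enc node)"
proof -
  show "fp (\<lambda>e. Wire (v e) (n e))" if "fp v" "fp n"
    by (rule fp_enc_cong[of "\<lambda>e. (0 :: nat, [v e], n e, 0 :: nat)"])
      (simp_all add: enc_node_def fp_pair fp_const fp_Cons that del: enc_prod.simps)
  show "fp (\<lambda>e. Xor (v e) (n e) (s e))" if "fp v" "fp n" "fp s"
    by (rule fp_enc_cong[of "\<lambda>e. (1 :: nat, [v e], n e, s e)"])
      (simp_all add: enc_node_def fp_pair fp_const fp_Cons that del: enc_prod.simps)
  show "fp (\<lambda>e. Row (n e) (s e) :: 'a::enc node)" if "fp n" "fp s"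
    by (rule fp_enc_cong[of "\<lambda>e. (2 :: nat, [] :: 'a list, n e, s e)"])
      (simp_all add: enc_node_def fp_pair fp_const fp_Cons that del: enc_prod.simps)
  show "fp (\<lambda>e. Aux (n e) (s e) :: 'a::enc node)" if "fp n" "fp s"
    by (rule fp_enc_cong[of "\<lambda>e. (3 :: nat, [] :: 'a list, n e, s e)"])
      (simp_all add: enc_node_def fp_pair fp_const fp_Cons that del: enc_prod.simps)
qed

text \<open>Pattern matching is replaced by tests on the components of \<open>node_tuple\<close>,
  for which the closure rules of \<open>fp\<close> apply. For rows and auxiliary nodes
  \<open>v\<close> is the default \<open>hd []\<close> and is never inspected.\<close>

definition node_nb' :: "(bool \<times> 'v) list \<Rightarrow> nat \<Rightarrow> 'v \<Rightarrow> nat \<Rightarrow> nat \<Rightarrow> 'v node list" where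
  "node_nb' ls tag v n s = (if tag = 0 then
     (if Suc n < 2 * length ls then [Xor v n 0] else []) @
     (if 0 < n then [Xor v (n - 1) 1] else []) @
     (if tap ls v n then [Row (n div 2) 0] else [])
   else if tag = 1 then map (\<lambda>t. Xor v n t) (others s) @
     (if s = 0 then [Wire v n] else if s = 1 then [Wire v (Suc n)] else [])
   else if tag = 2 then map (\<lambda>t. Row n t) (others s) @
     [if s = 0 then Wire (snd (el ls n)) (2 * n + side ls n)
      else if s = 1 then Aux (n div 3) (n mod 3) else Aux (n div 3) (Suc (n mod 3))]
   else (if s < 3 then [Row (3 * n + s) 1] else []) @ (if 0 < s then [Row (3 * n + (s - 1)) 2] else []))"

lemma node_nb_eq: "node_nb ls x = node_nb' ls (fst (node_tuple x)) (hd (fst (snd (node_tuple x))))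
    (fst (snd (snd (node_tuple x)))) (snd (snd (snd (node_tuple x))))"
  by (cases x) (simp_all add: node_nb'_def)

lemma fp_node_nb: "fp (\<lambda>e. node_nb (fst e) (snd e))"
  unfolding node_nb_eq node_nb'_def tap_def side_def others_def
  by (intro fp_intros fp_el fp_node_constructors fp_node_tuple fp_div fp_mod) auto

lemma fp_node_verts: "fp node_verts"
  unfolding node_verts_def[abs_def]
  by (intro fp_intros fp_node_constructors fp_div) auto

instantiation cubic :: (enc) enc
begin
fun cubic_tuple :: "'a cubic \<Rightarrow> bool \<times> bool \<times> (nat \<times> nat) \<times> 'a" where
  "cubic_tuple (Core c v) = (True, c, (0, 0), v)"
| "cubic_tuple (Cap i j v) = (False, False, (i, j), v)"
definition "enc (v :: 'a cubic) = enc (cubic_tuple v)"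
instance
proof
  show "enc x = enc y \<longleftrightarrow> x = y" for x y :: "'a cubic"
    by (cases x; cases y) (auto simp: enc_cubic_def enc_inject simp del: enc_prod.simps)
qed
end

lemma fp_cubic_tuple: "fp x \<Longrightarrow> fp (\<lambda>e. cubic_tuple (x e))"
  by (erule fp_enc_cong) (simp add: enc_cubic_def)

lemma fp_cubic_constructors:
  "fp c \<Longrightarrow> fp v \<Longrightarrow> fp (\<lambda>e. Core (c e) (v e))"
  "fp i \<Longrightarrow> fp j \<Longrightarrow> fp v \<Longrightarrow> fp (\<lambda>e. Cap (i e) (j e) (v e))"
proof -
  show "fp (\<lambda>e. Core (c e) (v e))" if "fp c" "fp v"
    by (rule fp_enc_cong[of "\<lambda>e. (True, c e, (0 :: nat, 0 :: nat), v e)"])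
      (simp_all add: enc_cubic_def fp_pair fp_const that del: enc_prod.simps)
  show "fp (\<lambda>e. Cap (i e) (j e) (v e))" if "fp i" "fp j" "fp v"
    by (rule fp_enc_cong[of "\<lambda>e. (False, False, (i e, j e), v e)"])
      (simp_all add: enc_cubic_def fp_pair fp_const that del: enc_prod.simps)
qed

definition cubic_nb' :: "('a \<Rightarrow> 'a list) \<Rightarrow> bool \<Rightarrow> bool \<Rightarrow> nat \<Rightarrow> nat \<Rightarrow> 'a \<Rightarrow> 'a cubic list" where
  "cubic_nb' nb core c i j v = (if core then map (\<lambda>u. Core c u) (nb v) @ map (\<lambda>j. Cap 0 j v) [length (nb v)..<3]
     else if i = 0 then [Core False v, Core True v, Cap 1 j v] else map (\<lambda>i'. Cap i' j v) (cap_adj i))"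

lemma cubic_nb_eq: "cubic_nb nb x = cubic_nb' nb (fst (cubic_tuple x)) (fst (snd (cubic_tuple x)))
    (fst (fst (snd (snd (cubic_tuple x))))) (snd (fst (snd (snd (cubic_tuple x))))) (snd (snd (snd (cubic_tuple x))))"
  by (cases x) (simp_all add: cubic_nb'_def)

definition matrix :: "(bool \<times> 'v) list \<Rightarrow> bool list list" where
  "matrix ls = (let vs = cubic_verts (node_verts ls) (node_nb ls) in
     map (\<lambda>x. map (\<lambda>y. y \<in> set (cubic_nb (node_nb ls) x)) vs) vs)"

lemma fp_node_nb2: "fp ls \<Longrightarrow> fp x \<Longrightarrow> fp (\<lambda>e. node_nb (ls e) (x e))"
  by (rule fp_comp2[OF fp_node_nb])

lemma fp_cubic_nb: "fp ls \<Longrightarrow> fp x \<Longrightarrow> fp (\<lambda>e. cubic_nb (node_nb (ls e)) (x e))"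
proof (rule fp_comp2[of "\<lambda>ls x. cubic_nb (node_nb ls) x"])
  show "fp (\<lambda>p. cubic_nb (node_nb (fst p)) (snd p))"
    unfolding cubic_nb_eq cubic_nb'_def cap_adj_def
    by (intro fp_intros fp_cubic_constructors fp_cubic_tuple fp_node_nb2)
qed

lemma fp_cubic_verts: "fp (\<lambda>ls. cubic_verts (node_verts ls) (node_nb ls))"
  unfolding cubic_verts_def
  by (intro fp_intros fp_cubic_constructors fp_node_nb2 fp_comp[OF fp_node_verts])

lemma fp_matrix: "fp matrix"
  unfolding matrix_def[abs_def] Let_def
  by (intro fp_intros fp_cubic_nb fp_comp[OF fp_cubic_verts])

lemma concat_nth:
  assumes "\<forall>r \<in> set rs. length r = n" "i < length rs" "j < n"
  shows "concat rs ! (i * n + j) = rs ! i ! j"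
  using assms
proof (induction rs arbitrary: i)
  case (Cons r rs)
  then show ?case by (cases i) (auto simp: nth_append)
qed simp

lemma length_concat3: "\<forall>c \<in> set cs. length c = 3 \<Longrightarrow> length (concat cs) = 3 * length cs"
  by (induction cs) auto

lemma sat_concat:
  assumes "\<forall>c \<in> set cs. length c = 3"
  shows "three_cnf.sat (concat cs) (length cs) \<alpha> \<longleftrightarrow> satisfies \<alpha> cs"
proof -
  interpret three_cnf "concat cs" "length cs"
    by unfold_locales (rule length_concat3[OF assms])
  have "(\<exists>r < 3. fst (concat cs ! (3 * i + r)) = \<alpha> (snd (concat cs ! (3 * i + r)))) \<longleftrightarrow>
      (\<exists>l \<in> set (cs ! i). fst l = \<alpha> (snd l))" if "i < length cs" for i
  proof -
    have "length (cs ! i) = 3" using assms that by simp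
    then have "(\<exists>l \<in> set (cs ! i). fst l = \<alpha> (snd l)) \<longleftrightarrow> (\<exists>r < 3. fst (cs ! i ! r) = \<alpha> (snd (cs ! i ! r)))"
      using all_set_conv_all_nth[of "cs ! i" "\<lambda>l. fst l \<noteq> \<alpha> (snd l)"] by auto
    then show ?thesis using concat_nth[OF assms that] by (auto simp: mult.commute)
  qed
  then show ?thesis
    unfolding sat_def satisfies_def all_set_conv_all_nth by simp
qed

lemma length_run_clauses: "c \<in> set (run_clauses M pre q N) \<Longrightarrow> length c = 3"
  unfolding run_clauses_def init_clauses_def table_clauses_def tape_clauses_def imp2_def unit_clause_def
  by auto

lemma pair_append: "pair x u = pair x [] @ u"
  by (simp add: pair_def)

lemma length_pair: "length (pair x u) = 2 * length x + 2 + length u"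
proof -
  have "length (concat (map (\<lambda>b. [b, b]) x)) = 2 * length x"
    by (induction x) auto
  then show ?thesis by (simp add: pair_def)
qed

lemma fp_pair_fun: "fp x \<Longrightarrow> fp u \<Longrightarrow> fp (\<lambda>e. pair (x e) (u e))"
  by (rule fp_comp2[of pair]) (unfold pair_def, intro fp_intros)

lemma NP_to_3SAT:
  assumes "L \<in> class_NP"
  obtains F :: "bool list \<Rightarrow> (bool \<times> fact) list list" where "fp F" "\<And>x c. c \<in> set (F x) \<Longrightarrow> length c = 3"
    "\<And>x. x \<in> L \<longleftrightarrow> (\<exists>\<alpha>. satisfies \<alpha> (F x))"
proof -
  obtain R and q :: "nat poly" where R: "R \<in> class_P"
    and L: "\<And>x. x \<in> L \<longleftrightarrow> (\<exists>u. length u \<le> poly q (length x) \<and> pair x u \<in> R)"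
    using assms unfolding class_NP_def by blast
  obtain M and p :: "nat poly" where M: "wf_tm M" "computes_in_time M (\<lambda>x. [x \<in> R]) (poly p)"
    using R unfolding class_P_def polytime_def by blast
  define l where "l x = length (pair x []) + poly q (length x)" for x
  \<comment> \<open>\<open>l x\<close> is the greatest length of an input with certificate. Adding
    it to the time bound makes the window of radius \<open>N\<close> contain the whole
    input.\<close>
  define F where "F x = run_clauses M (pair x []) (poly q (length x)) (poly p (l x) + l x)" for x
  have mono: "mono (poly p)"
    by (rule monoI) (rule poly_mono_nat)
  show thesis
  proof (rule that[of F])
    have "fp (\<lambda>x. (pair x [], poly q (length x), poly p (l x) + l x))"
      unfolding l_def by (intro fp_intros fp_pair_fun)
    from fp_comp[OF fp_run_clauses this] show "fp F" by (simp add: F_def[abs_def])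
    show "length c = 3" if "c \<in> set (F x)" for x c
      using that unfolding F_def by (rule length_run_clauses)
    show "x \<in> L \<longleftrightarrow> (\<exists>\<alpha>. satisfies \<alpha> (F x))" for x
    proof
      assume "x \<in> L"
      then obtain u where u: "length u \<le> poly q (length x)" "pair x u \<in> R" using L by blast
      have "poly p (length (pair x [] @ u)) \<le> poly p (l x) + l x"
        using poly_mono_nat[of "length (pair x [] @ u)" "l x" p] u(1) by (simp add: l_def)
      from satisfies_run[OF M u(1) this] u(2) pair_append[of x u]
      show "\<exists>\<alpha>. satisfies \<alpha> (F x)" unfolding F_def by auto
    next
      assume "\<exists>\<alpha>. satisfies \<alpha> (F x)"
      then obtain \<alpha> where "satisfies \<alpha> (F x)" by blast
      then obtain u where "length u \<le> poly q (length x)" "pair x [] @ u \<in> R"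
        unfolding F_def by (rule accepted_of_satisfying[OF M mono, rotated 2]) (auto simp: l_def)
      then show "x \<in> L" using L pair_append[of x u] by auto
    qed
  qed
qed

section \<open>Adjacency matrices\<close>

definition mat_graph :: "bool list list \<Rightarrow> nat graph" where
  "mat_graph A = Graph {..<length A} (\<lambda>i j. i < length A \<and> j < length A \<and> A ! i ! j)"

lemma mat_graph_simps [simp]:
  "verts (mat_graph A) = {..<length A}"
  "adj (mat_graph A) i j \<longleftrightarrow> i < length A \<and> j < length A \<and> A ! i ! j"
  by (simp_all add: mat_graph_def)

definition square :: "bool list list \<Rightarrow> bool" where
  "square A \<longleftrightarrow> (\<forall>r \<in> set A. length r = length A)"

definition mat_code :: "bool list list \<Rightarrow> bool list" where
  "mat_code A = replicate (length A) True @ [False] @ concat A"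

lemma fp_mat_code: "fp A \<Longrightarrow> fp (\<lambda>e. mat_code (A e))"
  unfolding mat_code_def by (intro fp_intros)

lemma encode_mat_graph:
  assumes "square A"
  shows "encode (mat_graph A) = mat_code A"
proof -
  have "map (\<lambda>i. map (\<lambda>j. adj (mat_graph A) i j) [0..<length A]) [0..<length A] = A"
    by (intro nth_equalityI) (use assms in \<open>auto simp: square_def intro!: nth_equalityI\<close>)
  then show ?thesis by (simp add: encode_def mat_code_def Let_def)
qed

subsection \<open>Isomorphic graphs\<close>

definition graph_iso :: "('a \<Rightarrow> 'b) \<Rightarrow> 'a graph \<Rightarrow> 'b graph \<Rightarrow> bool" where
  "graph_iso \<phi> G H \<longleftrightarrow> simple_graph G \<and> simple_graph H \<and> bij_betw \<phi> (verts G) (verts H) \<and>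
     (\<forall>u \<in> verts G. \<forall>v \<in> verts G. adj G u v \<longleftrightarrow> adj H (\<phi> u) (\<phi> v))"

lemma simple_adj:
  assumes "simple_graph G" "adj G u v"
  shows "u \<in> verts G" "v \<in> verts G" "u \<noteq> v" "adj G v u"
  using assms unfolding simple_graph_def by blast+

lemma graph_isoD:
  assumes "graph_iso \<phi> G H"
  shows "simple_graph G" "simple_graph H" "inj_on \<phi> (verts G)" "\<phi> ` verts G = verts H"
    "u \<in> verts G \<Longrightarrow> v \<in> verts G \<Longrightarrow> adj G u v \<longleftrightarrow> adj H (\<phi> u) (\<phi> v)"
  using assms unfolding graph_iso_def bij_betw_def by blast+

lemma graph_iso_sym:
  assumes "graph_iso \<phi> G H"
  shows "graph_iso (inv_into (verts G) \<phi>) H G"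
proof -
  note iso = graph_isoD[OF assms]
  have bij: "bij_betw (inv_into (verts G) \<phi>) (verts H) (verts G)"
    by (rule bij_betw_inv_into) (use iso in \<open>simp add: bij_betw_def\<close>)
  have "inv_into (verts G) \<phi> w \<in> verts G" "\<phi> (inv_into (verts G) \<phi> w) = w" if "w \<in> verts H" for w
    using that unfolding iso(4)[symmetric] by (rule inv_into_into, rule f_inv_into_f)
  then have "adj H u v \<longleftrightarrow> adj G (inv_into (verts G) \<phi> u) (inv_into (verts G) \<phi> v)"
    if "u \<in> verts H" "v \<in> verts H" for u v
    using that iso(5)[of "inv_into (verts G) \<phi> u" "inv_into (verts G) \<phi> v"] by simp
  with bij iso(1,2) show ?thesis unfolding graph_iso_def by blast
qed

lemma iso_neighbors:
  assumes "graph_iso \<phi> G H" "v \<in> verts G"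
  shows "neighbors H (\<phi> v) = \<phi> ` neighbors G v"
proof -
  note iso = graph_isoD[OF assms(1)]
  show ?thesis
  proof (intro equalityI subsetI)
    fix w assume "w \<in> neighbors H (\<phi> v)"
    then have w: "adj H w (\<phi> v)" by (simp add: neighbors_def)
    then obtain u where u: "u \<in> verts G" "w = \<phi> u"
      using simple_adj(1)[OF iso(2) w] iso(4) by blast
    then show "w \<in> \<phi> ` neighbors G v" using w iso(5)[OF u(1) assms(2)] by (simp add: neighbors_def)
  next
    fix w assume "w \<in> \<phi> ` neighbors G v"
    then obtain u where u: "adj G u v" "w = \<phi> u" by (auto simp: neighbors_def)
    then show "w \<in> neighbors H (\<phi> v)"
      using iso(5)[OF simple_adj(1)[OF iso(1) u(1)] assms(2)] by (simp add: neighbors_def)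
  qed
qed

lemma iso_regular:
  assumes "graph_iso \<phi> G H" "regular d H"
  shows "regular d G"
  unfolding regular_def
proof
  fix v assume v: "v \<in> verts G"
  note iso = graph_isoD[OF assms(1)]
  have "neighbors G v \<subseteq> verts G"
    using simple_adj(1)[OF iso(1)] by (auto simp: neighbors_def)
  then have "card (\<phi> ` neighbors G v) = card (neighbors G v)"
    by (intro card_image inj_on_subset[OF iso(3)])
  moreover have "\<phi> v \<in> verts H" using iso(4) v by blast
  then have "card (neighbors H (\<phi> v)) = d" using assms(2) by (simp add: regular_def)
  ultimately show "card (neighbors G v) = d"
    using iso_neighbors[OF assms(1) v] by simp
qed

lemma iso_colorable:
  assumes "graph_iso \<phi> G H" "colorable k H"
  shows "colorable k G"
proof -
  note iso = graph_isoD[OF assms(1)]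
  obtain c where c: "\<forall>v \<in> verts H. c v \<in> {1..k}" "\<forall>u v. adj H u v \<longrightarrow> c u \<noteq> c v"
    using assms(2) unfolding colorable_def by blast
  have "c (\<phi> v) \<in> {1..k}" if "v \<in> verts G" for v
    using c(1) iso(4) that by blast
  moreover have "c (\<phi> u) \<noteq> c (\<phi> v)" if "adj G u v" for u v
    using c(2) iso(5)[OF simple_adj(1,2)[OF iso(1) that]] that by blast
  ultimately show ?thesis
    unfolding colorable_def by (intro exI[of _ "\<lambda>v. c (\<phi> v)"]) blast
qed

lemma iso_labeling:
  assumes "graph_iso \<phi> G H" "labeling_by_max k H f"
  shows "labeling_by_max k G (\<lambda>v. f (\<phi> v))"
proof -
  note iso = graph_isoD[OF assms(1)]
  have color: "max_color G (\<lambda>v. f (\<phi> v)) v = max_color H f (\<phi> v)" if "v \<in> verts G" for v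
    unfolding max_color_def iso_neighbors[OF assms(1) that] by (simp add: image_image)
  have "f (\<phi> v) \<in> {1..k}" if "v \<in> verts G" for v
    using assms(2) iso(4) that unfolding labeling_by_max_def by blast
  moreover have "max_color G (\<lambda>v. f (\<phi> v)) u \<noteq> max_color G (\<lambda>v. f (\<phi> v)) v" if "adj G u v" for u v
    using assms(2) color simple_adj(1,2)[OF iso(1) that] iso(5)[OF simple_adj(1,2)[OF iso(1) that]] that
    unfolding labeling_by_max_def by simp
  ultimately show ?thesis
    unfolding labeling_by_max_def by blast
qed

lemma iso_labeling_iff:
  assumes "graph_iso \<phi> G H"
  shows "(\<exists>f. labeling_by_max k G f) \<longleftrightarrow> (\<exists>f. labeling_by_max k H f)"
  using iso_labeling[OF assms] iso_labeling[OF graph_iso_sym[OF assms]] by blast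

text \<open>Gadget vertices are structured data; their positions in \<open>vs\<close> serve as the
  numbers that an encoded input requires.\<close>

lemma mat_graph_iso:
  assumes "distinct vs" "simple_graph (list_graph vs nb)"
    and A: "A = map (\<lambda>x. map (\<lambda>y. y \<in> set (nb x)) vs) vs"
  shows "graph_iso (\<lambda>i. vs ! i) (mat_graph A) (list_graph vs nb)"
proof -
  have adj: "adj (mat_graph A) i j \<longleftrightarrow> i < length vs \<and> j < length vs \<and> adj (list_graph vs nb) (vs ! i) (vs ! j)" for i j
    by (auto simp: A)
  have "simple_graph (mat_graph A)"
    unfolding simple_graph_def adj using assms(2) by (auto simp: A simple_graph_def)
  moreover have "bij_betw (\<lambda>i. vs ! i) (verts (mat_graph A)) (verts (list_graph vs nb))"
    using assms(1) by (intro bij_betw_nth) (auto simp: A)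
  ultimately show ?thesis
    unfolding graph_iso_def using assms(2) adj by (auto simp: A)
qed

lemma matrix_props:
  fixes ls :: "(bool \<times> 'v) list"
  assumes "length ls = 3 * m"
  shows "square (matrix ls)" "simple_graph (mat_graph (matrix ls))" "regular 3 (mat_graph (matrix ls))"
    "colorable 3 (mat_graph (matrix ls))"
    "(\<exists>f. labeling_by_max 3 (mat_graph (matrix ls)) f) \<longleftrightarrow> (\<exists>\<alpha>. three_cnf.sat ls m \<alpha>)"
proof -
  interpret three_cnf ls m by unfold_locales (rule assms)
  have iso: "graph_iso (\<lambda>i. cvs ! i) (mat_graph (matrix ls)) G"
    by (rule mat_graph_iso[OF distinct_cubic_verts simple_G]) (simp add: matrix_def Let_def)
  show "square (matrix ls)" by (auto simp: square_def matrix_def Let_def)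
  show "simple_graph (mat_graph (matrix ls))" using iso by (simp add: graph_iso_def)
  show "regular 3 (mat_graph (matrix ls))" by (rule iso_regular[OF iso regular_G])
  show "colorable 3 (mat_graph (matrix ls))" by (rule iso_colorable[OF iso colorable3])
  show "(\<exists>f. labeling_by_max 3 (mat_graph (matrix ls)) f) \<longleftrightarrow> (\<exists>\<alpha>. sat \<alpha>)"
    using iso_labeling_iff[OF iso] labeling_iff_sat by simp
qed

subsection \<open>From \<open>k\<close> to \<open>k + 1\<close> labels\<close>

text \<open>
  A vertex \<open>n\<close> joined to all old vertices and to a new vertex \<open>n + 1\<close>: its colour is the largest label,
  and no old edge can use that label.
\<close>

definition lift :: "bool list list \<Rightarrow> bool list list" where
  "lift A = map (\<lambda>r. r @ [True, False]) A @
     [replicate (length A) True @ [False, True], replicate (length A) False @ [True, False]]"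

lemma fp_lift: "fp A \<Longrightarrow> fp (\<lambda>e. lift (A e))"
  by (rule fp_comp[of lift]) (unfold lift_def[abs_def], intro fp_intros)

lemma square_lift: "square A \<Longrightarrow> square (lift A)"
  by (auto simp: square_def lift_def)

lemma length_lift: "length (lift A) = Suc (Suc (length A))"
  by (simp add: lift_def)

lemma adj_lift:
  assumes "square A"
  shows "adj (mat_graph (lift A)) i j \<longleftrightarrow> adj (mat_graph A) i j \<or> (i < length A \<and> j = length A) \<or>
    (i = length A \<and> j < length A) \<or> (i = length A \<and> j = Suc (length A)) \<or> (i = Suc (length A) \<and> j = length A)"
proof -
  consider "i < length A" | "i = length A" | "i = Suc (length A)" | "i \<ge> Suc (Suc (length A))" by linarith
  then show ?thesis
  proof cases
    case 1
    then have "lift A ! i = A ! i @ [True, False]" "length (A ! i) = length A"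
      using assms by (auto simp: lift_def nth_append square_def)
    then show ?thesis using 1 by (auto simp: length_lift nth_append nth_Cons')
  next
    case 2
    then have "lift A ! i = replicate (length A) True @ [False, True]"
      by (simp add: lift_def nth_append)
    then show ?thesis using 2 by (auto simp: length_lift nth_append nth_Cons')
  next
    case 3
    then have "lift A ! i = replicate (length A) False @ [True, False]"
      by (simp add: lift_def nth_append)
    then show ?thesis using 3 by (auto simp: length_lift nth_append nth_Cons')
  next
    case 4
    then show ?thesis by (auto simp: length_lift)
  qed
qed

lemma simple_lift:
  assumes "square A" "simple_graph (mat_graph A)"
  shows "simple_graph (mat_graph (lift A))"
  using assms(2) unfolding simple_graph_def adj_lift[OF assms(1)] by (auto simp: length_lift)

lemma colorable_lift:
  assumes "square A" "simple_graph (mat_graph A)" "colorable k (mat_graph A)" "k \<ge> 1"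
  shows "colorable (Suc k) (mat_graph (lift A))"
proof -
  obtain c where c: "\<forall>v < length A. c v \<in> {1..k}" "\<forall>u v. adj (mat_graph A) u v \<longrightarrow> c u \<noteq> c v"
    using assms(3) by (auto simp: colorable_def)
  define d where "d v = (if v < length A then c v else if v = length A then Suc k else 1)" for v
  have "d u \<noteq> d v" if "adj (mat_graph (lift A)) u v" for u v
    using that c assms(4) unfolding adj_lift[OF assms(1)] by (force simp: d_def)
  moreover have "d v \<in> {1..Suc k}" if "v \<in> verts (mat_graph (lift A))" for v
    using c by (auto simp: d_def)
  ultimately show ?thesis unfolding colorable_def by blast
qed

text \<open>The hub gets label 1, which changes no maximum over a nonempty set of old labels, and
  the pendant vertex gets the new label. So the hub has colour \<open>Suc k\<close>, the pendant
  vertex colour 1, and old vertices stay at most \<open>k\<close>.\<close>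

lemma labeling_lift:
  assumes sq: "square A" and G: "simple_graph (mat_graph A)" and k: "k \<ge> 1"
    and f: "labeling_by_max k (mat_graph A) f"
  shows "\<exists>f. labeling_by_max (Suc k) (mat_graph (lift A)) f"
proof -
  let ?n = "length A" and ?G = "mat_graph A" and ?H = "mat_graph (lift A)"
  note H = simple_lift[OF sq G] and adj = adj_lift[OF sq]
  define h where "h v = (if v < ?n then f v else if v = ?n then 1 else Suc k)" for v
  have fr: "1 \<le> f v" "f v \<le> k" if "v < ?n" for v
    using f that by (auto simp: labeling_by_max_def)
  have n: "max_color ?H h ?n = Suc k"
  proof (rule max_color_eqI[OF H])
    show "Suc ?n \<in> neighbors ?H ?n" unfolding neighbors_def adj by simp
    show "h u \<le> Suc k" if "u \<in> neighbors ?H ?n" for u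
      using fr(2)[of u] by (auto simp: h_def)
  qed (simp add: h_def)
  have Sn: "max_color ?H h (Suc ?n) = 1"
  proof (rule max_color_eqI[OF H])
    show "?n \<in> neighbors ?H (Suc ?n)" unfolding neighbors_def adj by simp
    show "h u \<le> 1" if "u \<in> neighbors ?H (Suc ?n)" for u
      using that unfolding neighbors_def adj by (auto simp: h_def)
  qed (simp add: h_def)
  have old: "max_color ?H h v \<le> k" "neighbors ?G v \<noteq> {} \<Longrightarrow> max_color ?H h v = max_color ?G f v" if v: "v < ?n" for v
  proof -
    have nb: "neighbors ?H v = insert ?n (neighbors ?G v)"
      using v unfolding neighbors_def adj by auto
    have lt: "u < ?n" if "u \<in> neighbors ?G v" for u
      using that by (simp add: neighbors_def)
    show *: "max_color ?H h v = max_color ?G f v" if ne: "neighbors ?G v \<noteq> {}"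
    proof -
      obtain w where w: "adj ?G w v" "f w = max_color ?G f v" "max_color ?G f v \<in> {1..k}"
        using max_color_in[OF G f ne] by blast
      show ?thesis
      proof (rule max_color_eqI[OF H])
        show "w \<in> neighbors ?H v" using w(1) unfolding nb by (simp add: neighbors_def)
        show "h w = max_color ?G f v" using w by (simp add: h_def)
        show "h u \<le> max_color ?G f v" if "u \<in> neighbors ?H v" for u
        proof (cases "u = ?n")
          case False
          then have "adj ?G u v" using that unfolding nb by (simp add: neighbors_def)
          then show ?thesis using label_le_max_color[OF G, of u v f] by (simp add: h_def)
        qed (use w(3) in \<open>simp add: h_def\<close>)
      qed
    qed
    show "max_color ?H h v \<le> k"
    proof (cases "neighbors ?G v = {}")
      case True
      have "max_color ?H h v = 1"
        by (rule max_color_eqI[OF H, of ?n]) (auto simp: nb True h_def)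
      then show ?thesis using k by simp
    next
      case False
      then show ?thesis using * max_color_in[OF G f False] by (metis atLeastAtMost_iff)
    qed
  qed
  have "max_color ?H h u \<noteq> max_color ?H h v" if "adj ?H u v" for u v
    using that unfolding adj
  proof (elim disjE)
    assume uv: "adj ?G u v"
    then have vu: "adj ?G v u" using G by (auto simp: simple_graph_def)
    have "u < ?n" "v < ?n" using uv by auto
    moreover have "neighbors ?G u \<noteq> {}" "neighbors ?G v \<noteq> {}"
      using uv vu by (auto simp: neighbors_def)
    moreover have "max_color ?G f u \<noteq> max_color ?G f v"
      using f uv by (auto simp: labeling_by_max_def)
    ultimately show ?thesis using old(2)[of u] old(2)[of v] by simp
  next
    assume "u < ?n \<and> v = ?n"
    then show ?thesis using old(1)[of u] n by auto
  next
    assume "u = ?n \<and> v < ?n"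
    then show ?thesis using old(1)[of v] n by auto
  next
    assume "u = ?n \<and> v = Suc ?n"
    then show ?thesis using n Sn k by auto
  next
    assume "u = Suc ?n \<and> v = ?n"
    then show ?thesis using n Sn k by auto
  qed
  moreover have "h v \<in> {1..Suc k}" if "v \<in> verts ?H" for v
    using fr[of v] by (auto simp: h_def)
  ultimately show ?thesis unfolding labeling_by_max_def by blast
qed

text \<open>Every old vertex sees the label of the hub, so taking the maximum with it in each old
  label preserves the colours. No label \<open>Suc k\<close> can occur there: at an old vertex with
  a neighbour it would give that neighbour and the hub the same colour, at the hub it would do so to
  two adjacent old vertices. Isolated vertices are relabelled 1, as nothing bounds their
  labels.\<close>

lemma labeling_unlift:
  assumes sq: "square A" and G: "simple_graph (mat_graph A)" and k: "k \<ge> 1"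
    and h: "labeling_by_max (Suc k) (mat_graph (lift A)) h"
  shows "\<exists>f. labeling_by_max k (mat_graph A) f"
proof -
  let ?n = "length A" and ?G = "mat_graph A" and ?H = "mat_graph (lift A)"
  note H = simple_lift[OF sq G] and adj = adj_lift[OF sq]
  let ?c = "max_color ?H h"
  define f where "f v = (if neighbors ?G v = {} then 1 else max (h ?n) (h v))" for v
  have diff: "?c u \<noteq> ?c v" if "adj ?H u v" for u v
    using h that by (auto simp: labeling_by_max_def)
  have le: "h u \<le> ?c v" if "adj ?H u v" for u v
    using label_le_max_color[OF H that] .
  have c_le: "?c v \<le> Suc k" if "adj ?H u v" for u v
    using max_color_in[OF H h, of v] that by (metis atLeastAtMost_iff empty_iff mem_Collect_eq neighbors_def)
  have sym: "adj ?G v u" if "adj ?G u v" for u v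
    using G that by (auto simp: simple_graph_def)
  have range: "f v \<in> {1..k}" if v: "v < ?n" for v
  proof (cases "neighbors ?G v = {}")
    case True
    then show ?thesis using k by (simp add: f_def)
  next
    case False
    then obtain u where u: "adj ?G u v" by (auto simp: neighbors_def)
    have e: "adj ?H u v" "adj ?H v u" "adj ?H u ?n" "adj ?H ?n u" "adj ?H v ?n" "adj ?H ?n v"
      using u sym[OF u] unfolding adj by auto
    have "h v \<noteq> Suc k"
    proof
      assume "h v = Suc k"
      then have "?c u = Suc k" "?c ?n = Suc k"
        using le[OF e(2)] le[OF e(5)] c_le[OF e(2)] c_le[OF e(5)] by auto
      then show False using diff[OF e(3)] by simp
    qed
    moreover have "h ?n \<noteq> Suc k"
    proof
      assume "h ?n = Suc k"
      then have "?c u = Suc k" "?c v = Suc k"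
        using le[OF e(4)] le[OF e(6)] c_le[OF e(4)] c_le[OF e(6)] by auto
      then show False using diff[OF e(1)] by simp
    qed
    moreover have "h v \<in> {1..Suc k}" "h ?n \<in> {1..Suc k}"
      using h v by (auto simp: labeling_by_max_def length_lift)
    ultimately show ?thesis using False by (auto simp: f_def)
  qed
  have color: "max_color ?G f v = ?c v" if uv: "adj ?G u v" for u v
  proof -
    have v: "v < ?n" using uv by simp
    have nb: "neighbors ?H v = insert ?n (neighbors ?G v)"
      using v unfolding neighbors_def adj by auto
    have fw: "f w = max (h ?n) (h w)" if "adj ?G w v" for w
      using sym[OF that] by (auto simp: f_def neighbors_def)
    have n_le: "h ?n \<le> ?c v" using le[of ?n v] nb by (auto simp: neighbors_def)
    have w_le: "h w \<le> ?c v" if "adj ?G w v" for w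
      using le[of w v] that unfolding adj by blast
    obtain w where w: "adj ?H w v" "h w = ?c v"
      using max_color_in[OF H h, of v] nb by auto
    show ?thesis
    proof (rule max_color_eqI[OF G])
      let ?w = "if w = ?n then u else w"
      have "adj ?G ?w v" using w(1) uv nb by (auto simp: neighbors_def)
      then show "?w \<in> neighbors ?G v" by (simp add: neighbors_def)
      show "f ?w = ?c v"
        using fw[OF \<open>adj ?G ?w v\<close>] w_le[OF \<open>adj ?G ?w v\<close>] n_le w(2) by (auto simp: max_def)
      show "f x \<le> ?c v" if "x \<in> neighbors ?G v" for x
        using that fw[of x] w_le[of x] n_le by (auto simp: neighbors_def)
    qed
  qed
  have "labeling_by_max k ?G f"
    unfolding labeling_by_max_def using range color diff sym adj by (metis lessThan_iff mat_graph_simps(1))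
  then show ?thesis by blast
qed

lemma lift_iterate:
  assumes "square A" "simple_graph (mat_graph A)" "colorable 3 (mat_graph A)"
  shows "square ((lift ^^ m) A) \<and> simple_graph (mat_graph ((lift ^^ m) A)) \<and>
    colorable (3 + m) (mat_graph ((lift ^^ m) A)) \<and>
    ((\<exists>f. labeling_by_max (3 + m) (mat_graph ((lift ^^ m) A)) f) \<longleftrightarrow> (\<exists>f. labeling_by_max 3 (mat_graph A) f))"
proof (induction m)
  case (Suc m)
  let ?A = "(lift ^^ m) A"
  have "(\<exists>f. labeling_by_max (Suc (3 + m)) (mat_graph (lift ?A)) f) \<longleftrightarrow> (\<exists>f. labeling_by_max (3 + m) (mat_graph ?A) f)"
    using labeling_lift[of ?A "3 + m"] labeling_unlift[of ?A "3 + m"] Suc by auto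
  then show ?case
    using Suc square_lift[of ?A] simple_lift[of ?A] colorable_lift[of ?A "3 + m"] by simp
qed (use assms in simp)

text \<open>The number \<open>m\<close> of rounds is a constant, so repeated composition remains
  polynomial.\<close>

lemma fp_lift_iterate: "fp A \<Longrightarrow> fp (\<lambda>e. (lift ^^ m) (A e))"
  by (induction m) (simp_all add: fp_lift)

text \<open>The code determines the matrix: the unary prefix gives its dimension, and rows of known
  length can be recovered from their concatenation.\<close>

lemma mat_code_in_language:
  assumes "square A" "simple_graph (mat_graph A)"
  shows "mat_code A \<in> graph_language Q \<longleftrightarrow> Q (mat_graph A)"
proof
  have inp: "input_graph (mat_graph A)" using assms by (auto simp: input_graph_def)
  show "Q (mat_graph A) \<Longrightarrow> mat_code A \<in> graph_language Q"
    using inp encode_mat_graph[OF assms(1)] by (auto simp: graph_language_def intro!: exI[of _ "mat_graph A"])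
  assume "mat_code A \<in> graph_language Q"
  then obtain G where G: "mat_code A = encode G" "input_graph G" "Q G"
    by (auto simp: graph_language_def)
  obtain n where n: "verts G = {..<n}" and simple: "simple_graph G"
    using G(2) by (auto simp: input_graph_def)
  define B where "B = map (\<lambda>i. map (\<lambda>j. adj G i j) [0..<n]) [0..<n]"
  have "square B" "length B = n" by (auto simp: B_def square_def)
  have GB: "G = mat_graph B"
  proof (cases G)
    case (Graph V E)
    moreover have "E = (\<lambda>i j. i < n \<and> j < n \<and> B ! i ! j)"
      using simple n Graph by (auto simp: B_def simple_graph_def fun_eq_iff)
    ultimately show ?thesis using n \<open>length B = n\<close> by (simp add: mat_graph_def)
  qed
  have "mat_code A = mat_code B" using G(1) encode_mat_graph[OF \<open>square B\<close>] GB by simp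
  moreover have unary: "length A' = length B' \<and> concat A' = concat B'" if "mat_code A' = mat_code B'" for A' B'
  proof -
    have "takeWhile id (mat_code C) = replicate (length C) True" for C
      by (simp add: mat_code_def takeWhile_append)
    then have "length A' = length B'" using that by (metis length_replicate)
    then show ?thesis using that by (simp add: mat_code_def)
  qed
  ultimately have "length A = length B" "concat A = concat B" by blast+
  moreover have "length a = length b" if "(a, b) \<in> set (zip A B)" for a b
    using set_zip_leftD[OF that] set_zip_rightD[OF that] assms(1) \<open>square B\<close> \<open>length A = length B\<close>
    by (simp add: square_def)
  ultimately have "A = B" by (intro concat_injective) auto
  then show "Q (mat_graph A)" using G(3) GB by simp
qed

lemma NP_hard_labeling:
  assumes "L \<in> class_NP"
  obtains F where "fp F" "\<And>x. square (F x)" "\<And>x. simple_graph (mat_graph (F x))"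
    "\<And>x. regular 3 (mat_graph (F x))" "\<And>x. colorable 3 (mat_graph (F x))"
    "\<And>x. x \<in> L \<longleftrightarrow> (\<exists>f. labeling_by_max 3 (mat_graph (F x)) f)"
proof -
  obtain F :: "bool list \<Rightarrow> (bool \<times> fact) list list" where F: "fp F"
    and len: "\<And>x c. c \<in> set (F x) \<Longrightarrow> length c = 3" and L: "\<And>x. x \<in> L \<longleftrightarrow> (\<exists>\<alpha>. satisfies \<alpha> (F x))"
    using NP_to_3SAT[OF assms] by blast
  have len3: "length (concat (F x)) = 3 * length (F x)" for x
    using len length_concat3 by blast
  show thesis
  proof (rule that[of "\<lambda>x. matrix (concat (F x))"])
    show "fp (\<lambda>x. matrix (concat (F x)))"
      by (intro fp_comp[OF fp_matrix] fp_concat F)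
    show "x \<in> L \<longleftrightarrow> (\<exists>f. labeling_by_max 3 (mat_graph (matrix (concat (F x)))) f)" for x
      using L[of x] matrix_props(5)[OF len3[of x]] sat_concat[of "F x"] len by simp
  qed (rule matrix_props[OF len3])+
qed

section \<open>Deciding properties of encoded graphs\<close>

definition xadj :: "bool list \<Rightarrow> nat \<Rightarrow> nat \<Rightarrow> nat \<Rightarrow> bool" where
  "xadj x n i j = el x (Suc n + (i * n + j))"

definition xgraph :: "bool list \<Rightarrow> nat \<Rightarrow> nat graph" where
  "xgraph x n = Graph {..<n} (\<lambda>i j. i < n \<and> j < n \<and> xadj x n i j)"

lemma xgraph_simps [simp]:
  "verts (xgraph x n) = {..<n}" "adj (xgraph x n) i j \<longleftrightarrow> i < n \<and> j < n \<and> xadj x n i j"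
  by (simp_all add: xgraph_def)

text \<open>Writing the entries read by \<open>xadj\<close> back in the prescribed format and
  comparing with \<open>x\<close> rejects every malformed string, including those too short, where
  \<open>xadj\<close> reads past the end.\<close>

definition encodes :: "bool list \<Rightarrow> nat \<Rightarrow> bool" where
  "encodes x n \<longleftrightarrow>
     x = replicate n True @ [False] @ concat (map (\<lambda>i. map (\<lambda>j. xadj x n i j) [0..<n]) [0..<n]) \<and>
     (\<forall>i \<in> set [0..<n]. \<forall>j \<in> set [0..<n]. xadj x n i j = xadj x n j i \<and> (i = j \<longrightarrow> \<not> xadj x n i j))"

lemma encodes_length: "encodes x n \<Longrightarrow> n \<le> length x"
  unfolding encodes_def by (metis length_append length_replicate le_add1)

lemma encodes_simple: "encodes x n \<Longrightarrow> simple_graph (xgraph x n)"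
  by (auto simp: encodes_def simple_graph_def)

lemma encodes_encode:
  assumes "encodes x n"
  shows "encode (xgraph x n) = x"
proof -
  have rows: "map (\<lambda>i. map (\<lambda>j. adj (xgraph x n) i j) [0..<n]) [0..<n] = map (\<lambda>i. map (\<lambda>j. xadj x n i j) [0..<n]) [0..<n]"
    by auto
  show ?thesis
    unfolding encode_def Let_def xgraph_simps(1) card_lessThan rows
    by (rule assms[unfolded encodes_def, THEN conjunct1, symmetric])
qed

lemma encodes_input_graph:
  assumes "input_graph G"
  obtains n where "encodes (encode G) n" "xgraph (encode G) n = G"
proof -
  obtain n where n: "verts G = {..<n}" and simple: "simple_graph G"
    using assms by (auto simp: input_graph_def)
  let ?R = "map (\<lambda>i. map (\<lambda>j. adj G i j) [0..<n]) [0..<n]"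
  have enc: "encode G = replicate n True @ [False] @ concat ?R"
    using n by (simp add: encode_def Let_def)
  have adj: "xadj (encode G) n i j = adj G i j" if "i < n" "j < n" for i j
  proof -
    have "xadj (encode G) n i j = hd (drop (i * n + j) (concat ?R))"
      unfolding xadj_def el_def enc by simp
    also have "length (concat ?R) = n * n"
      by (simp add: length_concat o_def sum_list_triv)
    then have "hd (drop (i * n + j) (concat ?R)) = concat ?R ! (i * n + j)"
    proof (intro hd_drop_conv_nth)
      have "i * n + j < Suc i * n" using that by simp
      also have "\<dots> \<le> n * n" using that by (intro mult_right_mono) auto
      finally show "i * n + j < length (concat ?R)" using \<open>length (concat ?R) = n * n\<close> by simp
    qed
    also have "\<dots> = adj G i j"
      using concat_nth[of ?R n i j] that by simp
    finally show ?thesis .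
  qed
  have R: "map (\<lambda>i. map (\<lambda>j. xadj (encode G) n i j) [0..<n]) [0..<n] = ?R"
    using adj by simp
  have sym: "adj G i j = adj G j i" and irr: "\<not> adj G i i" for i j
    using simple_adj(3,4)[OF simple] by blast+
  have "encodes (encode G) n"
    unfolding encodes_def R
  proof (intro conjI ballI impI)
    show "encode G = replicate n True @ [False] @ concat ?R" by (rule enc)
  qed (use adj sym irr in auto)
  moreover have "xgraph (encode G) n = G"
  proof (cases G)
    case (Graph V E)
    have "E = (\<lambda>i j. i < n \<and> j < n \<and> xadj (encode G) n i j)"
      using adj simple_adj(1,2)[OF simple] n Graph by (auto simp: fun_eq_iff)
    then show ?thesis using Graph n by (simp add: xgraph_def)
  qed
  ultimately show thesis using that by blast
qed

lemma graph_language_iff: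
  "x \<in> graph_language Q \<longleftrightarrow> (\<exists>n \<in> set [0..<Suc (length x)]. encodes x n \<and> Q (xgraph x n))"
proof
  assume "x \<in> graph_language Q"
  then obtain G where G: "x = encode G" "input_graph G" "Q G"
    by (auto simp: graph_language_def)
  then obtain n where "encodes x n" "xgraph x n = G"
    using encodes_input_graph by metis
  then show "\<exists>n \<in> set [0..<Suc (length x)]. encodes x n \<and> Q (xgraph x n)"
    using G(3) encodes_length[of x n] by (intro bexI[of _ n]) (auto simp del: upt_Suc)
next
  assume "\<exists>n \<in> set [0..<Suc (length x)]. encodes x n \<and> Q (xgraph x n)"
  then obtain n where "encodes x n" "Q (xgraph x n)" by blast
  then show "x \<in> graph_language Q"
    using encodes_encode[of x n] encodes_simple[of x n]
    by (auto simp: graph_language_def input_graph_def intro!: exI[of _ "xgraph x n"])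
qed

lemma fp_xadj: "fp x \<Longrightarrow> fp n \<Longrightarrow> fp i \<Longrightarrow> fp j \<Longrightarrow> fp (\<lambda>e. xadj (x e) (n e) (i e) (j e))"
  unfolding xadj_def by (intro fp_intros fp_el)

lemma fp_encodes: "fp (\<lambda>e. encodes (fst e) (snd e))"
  unfolding encodes_def by (intro fp_intros fp_xadj)

lemma graph_language_class_P:
  assumes "fp (\<lambda>e. D (fst e) (snd e))" "\<And>x n. encodes x n \<Longrightarrow> Q (xgraph x n) \<longleftrightarrow> D x n"
  shows "graph_language Q \<in> class_P"
proof -
  have "fp (\<lambda>x. [\<exists>n \<in> set [0..<Suc (length x)]. encodes x n \<and> D x n])"
    by (intro fp_intros fp_comp2[OF fp_encodes] fp_comp2[OF assms(1)])
  moreover have "x \<in> graph_language Q \<longleftrightarrow> (\<exists>n \<in> set [0..<Suc (length x)]. encodes x n \<and> D x n)" for x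
    unfolding graph_language_iff using assms(2) by blast
  ultimately show ?thesis
    unfolding class_P_def by (auto intro: polytime_fp)
qed

section \<open>Inputs paired with certificates\<close>

lemma pair_decode:
  "map (\<lambda>j. el (pair x u) (2 * j)) [0..<length x] = x" "drop (2 * length x + 2) (pair x u) = u"
proof -
  have "el (pair x u) (2 * j) = x ! j" if "j < length x" for j
    using that
  proof (induction x arbitrary: j)
    case (Cons b x)
    then show ?case by (cases j) (auto simp: el_def pair_def)
  qed simp
  then show "map (\<lambda>j. el (pair x u) (2 * j)) [0..<length x] = x"
    by (intro nth_equalityI) auto
  show "drop (2 * length x + 2) (pair x u) = u"
    by (induction x) (auto simp: pair_def)
qed

lemma pair_inject: "pair x u = pair y v \<longleftrightarrow> x = y \<and> u = v"
proof
  show "pair x u = pair y v \<Longrightarrow> x = y \<and> u = v"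
  proof (induction x arbitrary: y)
    case Nil
    then show ?case by (cases y) (auto simp: pair_def)
  next
    case (Cons b x)
    then show ?case by (cases y) (auto simp: pair_def)
  qed
qed simp

text \<open>To undo \<open>pair\<close> the verifier tries all lengths \<open>i\<close> for the
  input part and pairs the two pieces again as a check; injectivity of \<open>pair\<close> makes a
  successful split the right one.\<close>

lemma graph_language_class_NP:
  fixes p :: "nat poly" and D :: "bool list \<Rightarrow> nat \<Rightarrow> bool list \<Rightarrow> bool"
  assumes "fp (\<lambda>e. D (fst e) (fst (snd e)) (snd (snd e)))"
    and D: "\<And>x n. encodes x n \<Longrightarrow> Q (xgraph x n) \<longleftrightarrow> (\<exists>u. length u \<le> poly p (length x) \<and> D x n u)"
  shows "graph_language Q \<in> class_NP"
proof -
  define ok where "ok x u \<longleftrightarrow> (\<exists>n \<in> set [0..<Suc (length x)]. encodes x n \<and> D x n u)" for x u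
  define R where "R = {y. \<exists>i \<in> set [0..<Suc (length y)].
    pair (map (\<lambda>j. el y (2 * j)) [0..<i]) (drop (2 * i + 2) y) = y \<and>
    ok (map (\<lambda>j. el y (2 * j)) [0..<i]) (drop (2 * i + 2) y)}"
  have D2: "fp (\<lambda>e. D (x e) (n e) (u e))" if "fp x" "fp n" "fp u" for x n u
    using fp_comp[OF assms(1) fp_pair[OF that(1) fp_pair[OF that(2,3)]]] by simp
  have ok: "fp (\<lambda>e. ok (fst e) (snd e))"
    unfolding ok_def by (intro fp_intros fp_comp2[OF fp_encodes] D2)
  have "fp (\<lambda>y. [y \<in> R])"
    unfolding R_def mem_Collect_eq by (intro fp_intros fp_pair_fun fp_el fp_comp2[OF ok])
  then have "R \<in> class_P"
    unfolding class_P_def by (auto intro: polytime_fp)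
  moreover have R: "pair x u \<in> R \<longleftrightarrow> ok x u" for x u
  proof
    assume "ok x u"
    then show "pair x u \<in> R"
      unfolding R_def mem_Collect_eq
      by (intro bexI[of _ "length x"]) (simp_all only: pair_decode, auto simp: length_pair)
  next
    assume "pair x u \<in> R"
    then show "ok x u" unfolding R_def by (auto simp: pair_inject simp del: upt_Suc)
  qed
  moreover have "x \<in> graph_language Q \<longleftrightarrow> (\<exists>u. length u \<le> poly p (length x) \<and> pair x u \<in> R)" for x
    unfolding graph_language_iff R ok_def using D by blast
  ultimately show ?thesis
    unfolding class_NP_def by blast
qed

subsection \<open>Labelings and colourings as certificates\<close>

text \<open>Block \<open>v\<close> of \<open>k\<close> bits holds the label of \<open>v\<close> in unary, so every bit string is a labeling.\<close>

definition lab :: "nat \<Rightarrow> bool list \<Rightarrow> nat \<Rightarrow> nat" where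
  "lab k u v = Suc (length (filter (\<lambda>i. v * k + i < length u \<and> el u (v * k + i)) [0..<k - 1]))"

lemma lab_range: "k \<ge> 1 \<Longrightarrow> lab k u v \<in> {1..k}"
  using length_filter_le[of "\<lambda>i. v * k + i < length u \<and> el u (v * k + i)" "[0..<k - 1]"]
  by (auto simp: lab_def)

lemma length_filter_upt: "length (filter (\<lambda>i. i < m) [0..<n]) = min m n"
  by (induction n) auto

text \<open>An arbitrary tail \<open>w\<close> is allowed so that a second block of bits, encoding a
  colouring, can follow the labeling in one certificate.\<close>

lemma lab_exists:
  fixes f :: "nat \<Rightarrow> nat"
  assumes "\<And>v. v < n \<Longrightarrow> f v \<in> {1..k}"
  obtains u where "length u = n * k" "\<And>v w. v < n \<Longrightarrow> lab k (u @ w) v = f v"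
proof
  let ?R = "map (\<lambda>v. map (\<lambda>i. i < f v - 1) [0..<k]) [0..<n]"
  show len: "length (concat ?R) = n * k"
    by (simp add: length_concat o_def sum_list_triv)
  fix v w assume v: "v < n"
  have "v * k + i < n * k" if "i < k" for i
  proof -
    have "v * k + i < Suc v * k" using that by simp
    also have "\<dots> \<le> n * k" using v by (intro mult_right_mono) auto
    finally show ?thesis .
  qed
  moreover have "concat ?R ! (v * k + i) = (i < f v - 1)" if "i < k" for i
    using concat_nth[of ?R k v i] that v by simp
  ultimately have "filter (\<lambda>i. v * k + i < length (concat ?R @ w) \<and> el (concat ?R @ w) (v * k + i)) [0..<k - 1] =
      filter (\<lambda>i. i < f v - 1) [0..<k - 1]"
    using len by (intro filter_cong) (auto simp: el_nth nth_append trans_less_add1)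
  then show "lab k (concat ?R @ w) v = f v"
    using assms[OF v] by (auto simp: lab_def length_filter_upt)
qed

lemma fp_lab: "fp u \<Longrightarrow> fp v \<Longrightarrow> fp (\<lambda>e. lab k (u e) (v e))"
  by (rule fp_comp2[of "lab k"]) (unfold lab_def, intro fp_intros fp_el)

text \<open>The maximum as a relation, attained and an upper bound, uses only quantifiers over lists
  and is therefore decidable by the closure rules of \<open>fp\<close>.\<close>

definition is_max :: "bool list \<Rightarrow> nat \<Rightarrow> nat \<Rightarrow> bool list \<Rightarrow> nat \<Rightarrow> nat \<Rightarrow> bool" where
  "is_max x n k u v m \<longleftrightarrow> (\<exists>w \<in> set [0..<n]. xadj x n w v \<and> lab k u w = m) \<and>
     (\<forall>w \<in> set [0..<n]. xadj x n w v \<longrightarrow> lab k u w \<le> m)"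

definition lab_ok :: "bool list \<Rightarrow> nat \<Rightarrow> nat \<Rightarrow> bool list \<Rightarrow> bool" where
  "lab_ok x n k u \<longleftrightarrow> (\<forall>i \<in> set [0..<n]. \<forall>j \<in> set [0..<n]. xadj x n i j \<longrightarrow>
     \<not> (\<exists>m \<in> set [0..<Suc k]. is_max x n k u i m \<and> is_max x n k u j m))"

lemma fp_lab_ok: "fp x \<Longrightarrow> fp n \<Longrightarrow> fp u \<Longrightarrow> fp (\<lambda>e. lab_ok (x e) (n e) k (u e))"
proof -
  have "fp (\<lambda>e. lab_ok (fst e) (fst (snd e)) k (snd (snd e)))"
    unfolding lab_ok_def is_max_def by (intro fp_intros fp_xadj fp_lab)
  then show "fp x \<Longrightarrow> fp n \<Longrightarrow> fp u \<Longrightarrow> fp (\<lambda>e. lab_ok (x e) (n e) k (u e))"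
    using fp_comp[OF _ fp_pair[OF _ fp_pair]] by fastforce
qed

lemma lab_ok_iff:
  assumes x: "encodes x n" and k: "k \<ge> 1"
  shows "lab_ok x n k u \<longleftrightarrow> labeling_by_max k (xgraph x n) (lab k u)"
proof -
  let ?G = "xgraph x n"
  note G = encodes_simple[OF x]
  have max: "is_max x n k u v m \<longleftrightarrow> max_color ?G (lab k u) v = m" if uv: "adj ?G w v" for w v m
  proof
    assume m: "is_max x n k u v m"
    then obtain z where z: "z < n" "xadj x n z v" "lab k u z = m" by (auto simp: is_max_def)
    show "max_color ?G (lab k u) v = m"
      by (rule max_color_eqI[OF G, of z]) (use m z uv in \<open>auto simp: neighbors_def is_max_def\<close>)
  next
    assume m: "max_color ?G (lab k u) v = m"
    have ne: "neighbors ?G v \<noteq> {}" "finite (neighbors ?G v)"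
      using uv by (auto simp: neighbors_def)
    then have "max_color ?G (lab k u) v \<in> lab k u ` neighbors ?G v"
      unfolding max_color_def by (intro Max_in) auto
    then show "is_max x n k u v m"
      using m label_le_max_color[OF G, of _ v "lab k u"] uv by (auto simp: is_max_def neighbors_def)
  qed
  have mk: "max_color ?G (lab k u) v < Suc k" if "adj ?G w v" for w v
  proof -
    have "is_max x n k u v (max_color ?G (lab k u) v)" using max[OF that] by simp
    then obtain z where "lab k u z = max_color ?G (lab k u) v" by (auto simp: is_max_def)
    then show ?thesis using lab_range[OF k, of u z] by auto
  qed
  have sym: "adj ?G v w" if "adj ?G w v" for v w
    using simple_adj(4)[OF G that] .
  have "lab_ok x n k u \<longleftrightarrow> (\<forall>i j. adj ?G i j \<longrightarrow> \<not> (\<exists>m < Suc k. is_max x n k u i m \<and> is_max x n k u j m))"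
    unfolding lab_ok_def by (auto simp del: upt_Suc)
  also have "\<dots> \<longleftrightarrow> (\<forall>i j. adj ?G i j \<longrightarrow> max_color ?G (lab k u) i \<noteq> max_color ?G (lab k u) j)"
    using max mk sym by metis
  finally show ?thesis
    unfolding labeling_by_max_def using lab_range[OF k] by blast
qed

lemma max_color_cong: "(\<And>v. v \<in> neighbors G w \<Longrightarrow> f v = g v) \<Longrightarrow> max_color G f w = max_color G g w"
  unfolding max_color_def by (metis image_cong)

lemma labeling_cong:
  assumes "simple_graph G" "labeling_by_max k G f" "\<And>v. v \<in> verts G \<Longrightarrow> g v = f v"
  shows "labeling_by_max k G g"
proof -
  have "max_color G g w = max_color G f w" for w
    using assms(3) simple_adj(1)[OF assms(1)] by (intro max_color_cong) (auto simp: neighbors_def)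
  then show ?thesis using assms(2,3) by (simp add: labeling_by_max_def)
qed

lemma regular3_NP:
  "graph_language (\<lambda>G. regular 3 G \<and> (\<exists>f. labeling_by_max 3 G f)) \<in> class_NP"
proof (rule graph_language_class_NP[where p = "[:0, 3:]" and
    D = "\<lambda>x n u. (\<forall>i \<in> set [0..<n]. length (filter (\<lambda>j. xadj x n j i) [0..<n]) = 3) \<and> lab_ok x n 3 u"])
  show "fp (\<lambda>e. (\<forall>i \<in> set [0..<fst (snd e)]. length (filter (\<lambda>j. xadj (fst e) (fst (snd e)) j i) [0..<fst (snd e)]) = 3) \<and>
      lab_ok (fst e) (fst (snd e)) 3 (snd (snd e)))"
    by (intro fp_intros fp_xadj fp_lab_ok)
  fix x n assume x: "encodes x n"
  let ?G = "xgraph x n"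
  have "card (neighbors ?G i) = length (filter (\<lambda>j. xadj x n j i) [0..<n])" if "i < n" for i
  proof -
    have "neighbors ?G i = set (filter (\<lambda>j. xadj x n j i) [0..<n])"
      using that by (auto simp: neighbors_def)
    then show ?thesis by (metis distinct_card distinct_filter distinct_upt)
  qed
  then have reg: "regular 3 ?G \<longleftrightarrow> (\<forall>i \<in> set [0..<n]. length (filter (\<lambda>j. xadj x n j i) [0..<n]) = 3)"
    by (auto simp: regular_def)
  have "(\<exists>f. labeling_by_max 3 ?G f) \<longleftrightarrow> (\<exists>u. length u \<le> poly [:0, 3:] (length x) \<and> lab_ok x n 3 u)"
  proof
    assume "\<exists>f. labeling_by_max 3 ?G f"
    then obtain f where f: "labeling_by_max 3 ?G f" by blast
    then have "\<And>v. v < n \<Longrightarrow> f v \<in> {1..3}" by (auto simp: labeling_by_max_def)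
    then obtain u where u: "length u = n * 3" "\<And>v w. v < n \<Longrightarrow> lab 3 (u @ w) v = f v"
      using lab_exists[of n f 3] by blast
    have "labeling_by_max 3 ?G (lab 3 u)"
      using u(2)[of _ "[]"] by (intro labeling_cong[OF encodes_simple[OF x] f]) simp
    then have "lab_ok x n 3 u" using lab_ok_iff[OF x] by simp
    then show "\<exists>u. length u \<le> poly [:0, 3:] (length x) \<and> lab_ok x n 3 u"
      using u(1) encodes_length[OF x] by (intro exI[of _ u]) simp
  next
    assume "\<exists>u. length u \<le> poly [:0, 3:] (length x) \<and> lab_ok x n 3 u"
    then show "\<exists>f. labeling_by_max 3 ?G f" using lab_ok_iff[OF x, of 3] by auto
  qed
  with reg show "regular 3 ?G \<and> (\<exists>f. labeling_by_max 3 ?G f) \<longleftrightarrow> (\<exists>u. length u \<le> poly [:0, 3:] (length x) \<and>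
      (\<forall>i \<in> set [0..<n]. length (filter (\<lambda>j. xadj x n j i) [0..<n]) = 3) \<and> lab_ok x n 3 u)"
    by blast
qed

text \<open>The first \<open>n * k\<close> bits of the certificate are a labeling, the rest a
  colouring that proves the instance legal; each takes \<open>k\<close> bits per vertex, hence the
  factor \<open>2 * k\<close>.\<close>

lemma colorable_NP:
  assumes k: "k \<ge> 1"
  shows "graph_language (\<lambda>G. colorable k G \<and> (\<exists>f. labeling_by_max k G f)) \<in> class_NP"
proof (rule graph_language_class_NP[where p = "[:0, 2 * k:]" and
    D = "\<lambda>x n u. (\<forall>i \<in> set [0..<n]. \<forall>j \<in> set [0..<n]. xadj x n i j \<longrightarrow>
      lab k (drop (n * k) u) i \<noteq> lab k (drop (n * k) u) j) \<and> lab_ok x n k u"])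
  show "fp (\<lambda>e. (\<forall>i \<in> set [0..<fst (snd e)]. \<forall>j \<in> set [0..<fst (snd e)]. xadj (fst e) (fst (snd e)) i j \<longrightarrow>
      lab k (drop (fst (snd e) * k) (snd (snd e))) i \<noteq> lab k (drop (fst (snd e) * k) (snd (snd e))) j) \<and>
      lab_ok (fst e) (fst (snd e)) k (snd (snd e)))"
    by (intro fp_intros fp_xadj fp_lab_ok fp_lab)
  fix x n assume x: "encodes x n"
  let ?G = "xgraph x n"
  let ?D = "\<lambda>u. (\<forall>i \<in> set [0..<n]. \<forall>j \<in> set [0..<n]. xadj x n i j \<longrightarrow>
      lab k (drop (n * k) u) i \<noteq> lab k (drop (n * k) u) j) \<and> lab_ok x n k u"
  show "colorable k ?G \<and> (\<exists>f. labeling_by_max k ?G f) \<longleftrightarrow> (\<exists>u. length u \<le> poly [:0, 2 * k:] (length x) \<and> ?D u)"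
  proof
    assume "colorable k ?G \<and> (\<exists>f. labeling_by_max k ?G f)"
    then obtain c f where c: "\<forall>v \<in> verts ?G. c v \<in> {1..k}" "\<forall>u v. adj ?G u v \<longrightarrow> c u \<noteq> c v"
      and f: "labeling_by_max k ?G f"
      unfolding colorable_def by blast
    have "\<And>v. v < n \<Longrightarrow> f v \<in> {1..k}" using f by (auto simp: labeling_by_max_def)
    then obtain u where u: "length u = n * k" "\<And>v w. v < n \<Longrightarrow> lab k (u @ w) v = f v"
      using lab_exists[of n f k] by blast
    have "\<And>v. v < n \<Longrightarrow> c v \<in> {1..k}" using c by simp
    then obtain w where w: "length w = n * k" "\<And>v w'. v < n \<Longrightarrow> lab k (w @ w') v = c v"
      using lab_exists[of n c k] by blast
    have "labeling_by_max k ?G (lab k (u @ w))"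
      using u(2)[of _ w] by (intro labeling_cong[OF encodes_simple[OF x] f]) simp
    then have "lab_ok x n k (u @ w)" using lab_ok_iff[OF x k] by simp
    moreover have "lab k (drop (n * k) (u @ w)) i = c i" if "i < n" for i
      using u(1) w(2)[of i "[]"] that by simp
    ultimately have "?D (u @ w)" using c(2) by auto
    moreover have "length (u @ w) \<le> poly [:0, 2 * k:] (length x)"
    proof -
      have "length (u @ w) = 2 * (n * k)" using u(1) w(1) by simp
      also have "\<dots> \<le> 2 * (length x * k)"
        by (intro mult_le_mono2 mult_le_mono1 encodes_length[OF x])
      finally show ?thesis by (simp add: ac_simps)
    qed
    ultimately show "\<exists>u. length u \<le> poly [:0, 2 * k:] (length x) \<and> ?D u" by blast
  next
    assume "\<exists>u. length u \<le> poly [:0, 2 * k:] (length x) \<and> ?D u"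
    then obtain u where u: "?D u" by blast
    then have "colorable k ?G"
      unfolding colorable_def using lab_range[OF k]
      by (intro exI[of _ "lab k (drop (n * k) u)"]) auto
    moreover have "labeling_by_max k ?G (lab k u)" using u lab_ok_iff[OF x k] by simp
    ultimately show "colorable k ?G \<and> (\<exists>f. labeling_by_max k ?G f)" by blast
  qed
qed

subsection \<open>Triangular-structured vertices\<close>

text \<open>
  A vertex that violates one of the two conditions with respect to \<open>S\<close> lies in no TSV contained
  in \<open>S\<close>. Hence removing violating vertices from the full vertex set until nothing changes yields
  the largest TSV.
\<close>

definition tsv_ok :: "bool list \<Rightarrow> nat \<Rightarrow> nat list \<Rightarrow> nat \<Rightarrow> bool" where
  "tsv_ok x n S v \<longleftrightarrow> (\<exists>a \<in> set S. \<exists>b \<in> set S. xadj x n v a \<and> xadj x n a b \<and> xadj x n b v) \<and>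
     (\<forall>w \<in> set [0..<n]. w \<notin> set S \<and> xadj x n v w \<longrightarrow> (\<exists>z \<in> set S. xadj x n z v \<and> xadj x n z w))"

definition prune :: "bool list \<Rightarrow> nat \<Rightarrow> nat list \<Rightarrow> nat list" where
  "prune x n S = filter (\<lambda>v. tsv_ok x n S v) S"

definition tsv_core :: "bool list \<Rightarrow> nat \<Rightarrow> nat list" where
  "tsv_core x n = fold (\<lambda>_. prune x n) [0..<n] [0..<n]"

lemma sz_filter: "sz (filter P xs) \<le> sz xs"
  by (induction xs) auto

lemma fp_tsv_core: "fp (\<lambda>e. tsv_core (fst e) (snd e))"
proof -
  have upt: "fp (\<lambda>e :: bool list \<times> nat. [0..<snd e])" by (intro fp_intros)
  obtain k where k: "\<And>e :: bool list \<times> nat. sz [0..<snd e] \<le> (sz e + 2) ^ k"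
    using fp_size[OF upt] by blast
  have sz: "sz (fold (\<lambda>_. prune x n) us S) \<le> sz S" for x n S and us :: "nat list"
  proof (induction us arbitrary: S)
    case (Cons u us)
    have "sz (prune x n S) \<le> sz S" unfolding prune_def by (rule sz_filter)
    then show ?case using Cons[of "prune x n S"] by simp
  qed simp
  show ?thesis unfolding tsv_core_def
  proof (rule fp_fold[OF upt upt])
    show "fp (\<lambda>p :: (bool list \<times> nat) \<times> nat \<times> nat list. prune (fst (fst p)) (snd (fst p)) (snd (snd p)))"
      unfolding prune_def tsv_ok_def by (intro fp_intros fp_xadj)
    show "pbound (\<lambda>n. (n + 2) ^ k)" by (intro pbound_intros)
    show "sz (fold (\<lambda>_. prune (fst e) (snd e)) ys [0..<snd e]) \<le> (sz e + 2) ^ k" for e and ys :: "nat list"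
      using sz[of "fst e" "snd e" ys "[0..<snd e]"] k[of e] by linarith
  qed
qed

lemma tsv_core_iff:
  assumes x: "encodes x n"
  shows "(\<exists>S. S \<noteq> {} \<and> TSV (xgraph x n) S) \<longleftrightarrow> tsv_core x n \<noteq> []"
proof -
  let ?G = "xgraph x n"
  note G = encodes_simple[OF x]
  define S where "S i = fold (\<lambda>_. prune x n) [0..<i] [0..<n]" for i
  have S0: "S 0 = [0..<n]" and S_Suc: "S (Suc i) = prune x n (S i)" for i
    by (simp_all add: S_def)
  have S_core: "tsv_core x n = S n" by (simp add: S_def tsv_core_def)
  have sub: "set (S i) \<subseteq> {..<n}" for i
    by (induction i) (auto simp: S0 S_Suc prune_def)
  \<comment> \<open>Every round that is not yet stable removes a vertex. After \<open>n\<close>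
    rounds the first alternative leaves an empty list, which is stable too.\<close>
  have len: "length (S i) + i \<le> n \<or> prune x n (S i) = S i" for i
  proof (induction i)
    case (Suc i)
    show ?case
    proof (cases "prune x n (S i) = S i")
      case False
      then obtain v where "v \<in> set (S i)" "\<not> tsv_ok x n (S i) v"
        by (auto simp: prune_def filter_id_conv)
      then have "length (prune x n (S i)) < length (S i)"
        unfolding prune_def by (rule length_filter_less)
      then show ?thesis using Suc False by (simp add: S_Suc)
    qed (simp add: S_Suc)
  qed (simp add: S0)
  have stable: "prune x n (S n) = S n"
    using len[of n] by (auto simp: prune_def)
  have core: "TSV ?G (set (S n))"
  proof -
    have ok: "tsv_ok x n (S n) v" if "v \<in> set (S n)" for v
      using stable that unfolding prune_def by (metis filter_id_conv)
    show ?thesis unfolding TSV_def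
    proof (intro conjI ballI impI)
      show "set (S n) \<subseteq> verts ?G" using sub by simp
      fix v assume v: "v \<in> set (S n)"
      then obtain a b where ab: "a \<in> set (S n)" "b \<in> set (S n)" "xadj x n v a" "xadj x n a b" "xadj x n b v"
        using ok[OF v] by (auto simp: tsv_ok_def)
      have "v < n" "a < n" "b < n" using v ab sub[of n] by auto
      then show "\<exists>a \<in> set (S n). \<exists>b \<in> set (S n). adj ?G v a \<and> adj ?G a b \<and> adj ?G b v"
        using ab by auto
    next
      fix v w assume v: "v \<in> set (S n)" and w: "w \<in> verts ?G - set (S n)" "adj ?G v w"
      then obtain z where z: "z \<in> set (S n)" "xadj x n z v" "xadj x n z w"
        using ok[OF v] by (auto simp: tsv_ok_def)
      then show "\<exists>z \<in> set (S n). adj ?G z v \<and> adj ?G z w"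
        using w sub[of n] by (intro bexI[of _ z]) auto
    qed
  qed
  \<comment> \<open>A vertex outside \<open>S i\<close> is also outside \<open>X\<close>, so the
    condition on \<open>X\<close> supplies the required common neighbour in \<open>X\<close>, which
    lies in \<open>S i\<close>; the triangle through \<open>v\<close> is kept for the same
    reason.\<close>
  have largest: "X \<subseteq> set (S i)" if X: "TSV ?G X" for X i
  proof (induction i)
    case 0
    then show ?case using X by (auto simp: TSV_def S0)
  next
    case (Suc i)
    show ?case
    proof
      fix v assume v: "v \<in> X"
      obtain a b where ab: "a \<in> X" "b \<in> X" "adj ?G v a" "adj ?G a b" "adj ?G b v"
        using X v unfolding TSV_def by blast
      have "\<exists>z \<in> set (S i). xadj x n z v \<and> xadj x n z w" if w: "w < n" "w \<notin> set (S i)" "xadj x n v w" for w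
      proof -
        have "v < n" using v X by (auto simp: TSV_def)
        then have "adj ?G v w" "w \<in> verts ?G - X" using w Suc by auto
        then obtain z where "z \<in> X" "adj ?G z v" "adj ?G z w"
          using X v unfolding TSV_def by blast
        then show ?thesis using Suc by auto
      qed
      then have "tsv_ok x n (S i) v"
        using ab Suc unfolding tsv_ok_def by auto
      then show "v \<in> set (S (Suc i))" using v Suc by (auto simp: S_Suc prune_def)
    qed
  qed
  show ?thesis
    unfolding S_core using core largest[of _ n] by (metis set_empty subset_empty)
qed

lemma TSV_class_P: "graph_language (\<lambda>G. \<exists>S. S \<noteq> {} \<and> TSV G S) \<in> class_P"
  by (rule graph_language_class_P[where D = "\<lambda>x n. tsv_core x n \<noteq> []"])
    (use tsv_core_iff fp_not[OF fp_null[OF fp_tsv_core]] in auto)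

theorem theorem8:
  shows "NP_complete
           (graph_language (regular 3))
           (graph_language (\<lambda>G. regular 3 G \<and> (\<exists>f. labeling_by_max 3 G f))) \<and>
         (\<forall>k \<ge> 3. NP_complete
           (graph_language (colorable k))
           (graph_language (\<lambda>G. colorable k G \<and> (\<exists>f. labeling_by_max k G f)))) \<and>
         graph_language (\<lambda>G. \<exists>S. S \<noteq> {} \<and> TSV G S) \<in> class_P"
proof (intro conjI allI impI)
  show "NP_complete (graph_language (regular 3)) (graph_language (\<lambda>G. regular 3 G \<and> (\<exists>f. labeling_by_max 3 G f)))"
    unfolding NP_complete_def
  proof (intro conjI ballI)
    fix L assume "L \<in> class_NP"
    then obtain F where F: "fp F" "\<And>x. square (F x)" "\<And>x. simple_graph (mat_graph (F x))"
      "\<And>x. regular 3 (mat_graph (F x))" "\<And>x. x \<in> L \<longleftrightarrow> (\<exists>f. labeling_by_max 3 (mat_graph (F x)) f)"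
      using NP_hard_labeling by metis
    show "\<exists>f. polytime f \<and> (\<forall>x. f x \<in> graph_language (regular 3)) \<and>
        (\<forall>x. x \<in> L \<longleftrightarrow> f x \<in> graph_language (\<lambda>G. regular 3 G \<and> (\<exists>f. labeling_by_max 3 G f)))"
      by (intro exI[of _ "\<lambda>x. mat_code (F x)"])
        (simp add: polytime_fp fp_mat_code F mat_code_in_language)
  qed (rule regular3_NP)
  show "NP_complete (graph_language (colorable k)) (graph_language (\<lambda>G. colorable k G \<and> (\<exists>f. labeling_by_max k G f)))"
    if k: "k \<ge> 3" for k
    unfolding NP_complete_def
  proof (intro conjI ballI)
    fix L assume "L \<in> class_NP"
    then obtain F where F: "fp F" "\<And>x. square (F x)" "\<And>x. simple_graph (mat_graph (F x))"
      "\<And>x. colorable 3 (mat_graph (F x))" "\<And>x. x \<in> L \<longleftrightarrow> (\<exists>f. labeling_by_max 3 (mat_graph (F x)) f)"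
      using NP_hard_labeling by metis
    \<comment> \<open>The cubic graph settles three labels, and each lift adds one label and one
      colour.\<close>
    let ?A = "\<lambda>x. (lift ^^ (k - 3)) (F x)"
    have A: "square (?A x)" "simple_graph (mat_graph (?A x))" "colorable k (mat_graph (?A x))"
      "(\<exists>f. labeling_by_max k (mat_graph (?A x)) f) \<longleftrightarrow> x \<in> L" for x
      using lift_iterate[OF F(2,3,4), of "k - 3" x] F(5)[of x] k by auto
    show "\<exists>f. polytime f \<and> (\<forall>x. f x \<in> graph_language (colorable k)) \<and>
        (\<forall>x. x \<in> L \<longleftrightarrow> f x \<in> graph_language (\<lambda>G. colorable k G \<and> (\<exists>f. labeling_by_max k G f)))"
      by (intro exI[of _ "\<lambda>x. mat_code (?A x)"])
        (simp add: polytime_fp fp_mat_code fp_lift_iterate F(1) A mat_code_in_language)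
  qed (rule colorable_NP, use k in simp)
qed (rule TSV_class_P)

end
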